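(* Suppose $\gamma_0\ge\alpha_0$. Let $u_{h,h}\in V_{h,h}$ satisfy $a_\Omega(u_{h,h},v_{h,h})=(f,v_{h,h})$ for all $v_{h,h}\in V_{h,h}$, and let $u^{ms}_{h,H}\in V^{ms}_{h,H}$ satisfy $a_\Omega(u^{ms}_{h,H},v)=(f,v)$ for all $v\in V^{ms}_{h,H}$. Put $u_{h,H}=(\mathcal C_{h,H}|_{V_{h,H}})^{-1}\mathcal C_{h,H}u^{ms}_{h,H}\in V_{h,H}$. Then $$u_{h,h}-u^{ms}_{h,H}\in W_{0,h}\qquad\text{and}\qquad \mathcal C_{h,H}u_{h,h}=\mathcal C_{h,H}u_{h,H}.$$ Especially, $u_{h,h}|_{\Omega_1}=u^{ms}_{h,H}|_{\Omega_1}$.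
   Context: Setting. $\Omega\subset\mathbb R^d$, $d\in\{2,3\}$, is a polygonal/polyhedral domain, $f\in L^2(\Omega)$, and $A\in L^\infty(\Omega,\mathbb R^{d\times d})$ is symmetric with spectrum $\sigma(A(x))\subset[\alpha,\beta]$ for all $x\in\Omega$, where $\beta\ge\alpha>0$. $\Omega$ is decomposed into $\Omega_1$ (a union of one or several subdomains) and $\Omega_2=\Omega\setminus\overline{\Omega}_1$; $\Gamma=\partial\Omega_1\cap\partial\Omega_2$ is the interface, Lipschitz continuous with $|\Gamma|=O(1)$; $\Gamma_i=\partial\Omega\cap\partial\Omega_i$; $H^1_{\Gamma_i}(\Omega_i)=\{v\in H^1(\Omega_i): v|_{\Gamma_i}=0\}$. $(\cdot,\cdot)_\omega$ is the $L^2(\omega)$ inner product, $(\cdot,\cdot)=(\cdot,\cdot)_\Omega$, $\langle\cdot,\cdot\rangle_\gamma$ is the $L^2$ inner product on $\gamma\subseteq\Gamma$, $\|\cdot\|_{0,\omega}$ is the $L^2(\omega)$ norm, $\|\cdot\|_\gamma$ is the $L^2(\gamma)$ norm. Fine scale. $\mathcal M_{h,\Omega_1},\mathcal M_{h,\Omega_2}$ are regular quasi-uniform triangulations (closed simplices) of $\Omega_1,\Omega_2$; $h$ is the maximal element diameter in $\mathcal M_{h,h}=\mathcal M_{h,\Omega_1}\cup\mathcal M_{h,\Omega_2}$. $P_1$ denotes polynomials of total degree $\le1$. $V_{h,\Omega_i}=\{v\in H^1_{\Gamma_i}(\Omega_i): v|_T\in P_1\ \forall T\in\mathcal M_{h,\Omega_i}\}$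 and $V_{h,h}=\{v: v|_{\Omega_i}\in V_{h,\Omega_i},\ i=1,2\}$ (jumps across $\Gamma$ allowed). $\mathbf n$ is the unit normal on $\Gamma$ pointing from $\Omega_1$ to $\Omega_2$; $[v]=v|_{\Omega_1}-v|_{\Omega_2}$ and $\{v\}=(v|_{\Omega_1}+v|_{\Omega_2})/2$ on $\Gamma$; $\nabla_h$ is the piecewise gradient on $\Omega_1\cup\Omega_2$. One-sided traces of $A$ on $\Gamma$ are assumed to make sense with eigenvalues in $[\alpha,\beta]$. For a penalty parameter $\gamma_0>0$, $$a_\Omega(u,v)=(A\nabla_hu,\nabla_hv)-\langle\{A\nabla_hu\cdot\mathbf n\},[v]\rangle_{\Gamma}-\langle[u],\{A\nabla_hv\cdot\mathbf n\}\rangle_{\Gamma}+\langle\tfrac{\gamma_0}{h}[u],[v]\rangle_{\Gamma}.$$ $\alpha_0>0$ is a fixed constant (independent of the mesh sizes and of $\gamma_0$) such that, if $\gamma_0\ge\alpha_0$, then for some $c>0$, $a_\Omega(v,v)\ge c\big( \|A^{1/2}\nabla_hv\|_{0,\Omega}^2+\frac{\gamma_0}{h}\|[v]\|_\Gamma^2+\frac{h}{\gamma_0}\|\{A\nabla_hv\cdot\mathbf n\}\|_\Gamma^2\big)$ for all $v\in V_{h,h}$ (such a constant exists). Coarse scale. $\mathcal M_{H,\Omega_2}$ is a shape-regular triangulation of $\Omega_2$ with maximal diameter $H>h$, of which $\mathcal M_{h,\Omega_2}$ is a refinement; the partition of $\Gamma$ induced by the elements of $\mathcal M_{h,\Omega_1}$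 touching $\Gamma$ in positive $(d-1)$-measure is assumed to be a refinement of the one induced by $\mathcal M_{H,\Omega_2}$. $V_{H,\Omega_2}=\{v\in H^1_{\Gamma_2}(\Omega_2): v|_T\in P_1\ \forall T\in\mathcal M_{H,\Omega_2}\}$ and $V_{h,H}=\{v: v|_{\Omega_1}\in V_{h,\Omega_1},\ v|_{\Omega_2}\in V_{H,\Omega_2}\}\subset V_{h,h}$. With $\mathring{\mathcal N}_H$ the set of vertices of $\mathcal M_{H,\Omega_2}$ not on $\Gamma_2$ and $\Phi_z$ the nodal basis function at $z$, $\mathcal C_Hu=\sum_{z\in\mathring{\mathcal N}_H}\frac{(u,\Phi_z)_{\Omega_2}}{(1,\Phi_z)_{\Omega_2}}\Phi_z$ for $u\in H^1_{\Gamma_2}(\Omega_2)$. $\Pi_h:L^2(\Omega_1)\to V_{h,\Omega_1}$ is the $L^2$-projection. $\mathcal C_{h,H}:V_{h,h}\to V_{h,H}$ is given by $\mathcal C_{h,H}v|_{\Omega_1}=\Pi_h(v|_{\Omega_1})$, $\mathcal C_{h,H}v|_{\Omega_2}=\mathcal C_H(v|_{\Omega_2})$; its restriction to $V_{h,H}$ is an isomorphism of $V_{h,H}$. $W_{0,h}=\{v\in V_{h,h}:\mathcal C_{h,H}v=0\}$. Ideal multiscale space. $Q_h:V_{h,h}\to W_{0,h}$ is defined by $a_\Omega(Q_hv,w)=a_\Omega(v,w)$ for all $w\in W_{0,h}$, and $V^{ms}_{h,H}=(I-Q_h)V_{h,H}$. *)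

theory Defs
  imports "HOL-Analysis.Analysis" "HOL-Library.Function_Algebras"
begin

section \<open>Surface measure\<close>

text \<open>The covering sets are required to be bounded because \<^const>\<open>diameter\<close> is a junk value on
  unbounded sets. With the factor \<open>unit_ball_vol k / 2 ^ k\<close>, the \<open>k\<close>-dimensional Hausdorff
  measure is the \<open>k\<close>-dimensional surface area. The outer measure is a metric one, hence countably
  additive on the Borel sets, so \<^const>\<open>measure_of\<close> does not collapse to the zero measure below.\<close>

definition hausdorff_pre :: "nat \<Rightarrow> real \<Rightarrow> 'a::metric_space set \<Rightarrow> ennreal" where
  "hausdorff_pre k \<delta> S =
     (INF C \<in> {C :: nat \<Rightarrow> 'a set. S \<subseteq> (\<Union>i. C i) \<and> (\<forall>i. bounded (C i) \<and> diameter (C i) \<le> \<delta>)}.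
        (\<Sum>i. ennreal (unit_ball_vol (real k) * (diameter (C i) / 2) ^ k)))"

definition hausdorff_outer :: "nat \<Rightarrow> 'a::metric_space set \<Rightarrow> ennreal" where
  "hausdorff_outer k S = (SUP \<delta> \<in> {0<..}. hausdorff_pre k \<delta> S)"

definition surface_measure :: "(real ^ 'n) measure" where
  "surface_measure =
     completion (measure_of UNIV (sets borel) (hausdorff_outer (CARD('n) - 1)))"


section \<open>Function spaces\<close>

definition L2_on :: "(real ^ 'n) set \<Rightarrow> (real ^ 'n \<Rightarrow> real) \<Rightarrow> bool" where
  "L2_on S u \<longleftrightarrow> u \<in> borel_measurable (lebesgue_on S) \<and> integrable (lebesgue_on S) (\<lambda>x. (u x)\<^sup>2)"

definition L2_inner :: "(real ^ 'n) set \<Rightarrow> (real ^ 'n \<Rightarrow> real) \<Rightarrow> (real ^ 'n \<Rightarrow> real) \<Rightarrow> real" where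
  "L2_inner S u v = (LINT x:S|lebesgue. u x * v x)"

definition surface_inner :: "(real ^ 'n) set \<Rightarrow> (real ^ 'n \<Rightarrow> real) \<Rightarrow> (real ^ 'n \<Rightarrow> real) \<Rightarrow> real" where
  "surface_inner G u v = (LINT x:G|surface_measure. u x * v x)"

coinductive smooth :: "('a::euclidean_space \<Rightarrow> real) \<Rightarrow> bool" where
  "(\<forall>x. \<phi> differentiable at x) \<Longrightarrow> (\<forall>b\<in>Basis. smooth (\<lambda>x. frechet_derivative \<phi> (at x) b))
     \<Longrightarrow> smooth \<phi>"

definition test_function :: "(real ^ 'n) set \<Rightarrow> (real ^ 'n \<Rightarrow> real) \<Rightarrow> bool" where
  "test_function S \<phi> \<longleftrightarrow>
     smooth \<phi> \<and> compact (closure {x. \<phi> x \<noteq> 0}) \<and> closure {x. \<phi> x \<noteq> 0} \<subseteq> S"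

definition weak_gradient :: "(real ^ 'n) set \<Rightarrow> (real ^ 'n \<Rightarrow> real) \<Rightarrow> (real ^ 'n \<Rightarrow> real ^ 'n) \<Rightarrow> bool" where
  "weak_gradient S u g \<longleftrightarrow>
     (\<forall>\<phi>. test_function S \<phi> \<longrightarrow> (\<forall>b\<in>Basis.
        L2_inner S u (\<lambda>x. frechet_derivative \<phi> (at x) b) = - L2_inner S (\<lambda>x. g x \<bullet> b) \<phi>))"

definition H1 :: "(real ^ 'n) set \<Rightarrow> (real ^ 'n \<Rightarrow> real) set" where
  "H1 S = {u. L2_on S u \<and> (\<exists>g. (\<forall>b\<in>Basis. L2_on S (\<lambda>x. g x \<bullet> b)) \<and> weak_gradient S u g)}"

definition grad :: "(real ^ 'n \<Rightarrow> real) \<Rightarrow> real ^ 'n \<Rightarrow> real ^ 'n" where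
  "grad u x = (if \<exists>g. GDERIV u x :> g then THE g. GDERIV u x :> g else 0)"

text \<open>One-sided traces at a boundary point of an open set \<open>S\<close>, in the sense of vanishing mean
  deviation on small balls. For functions of class \<open>H\<^sup>1\<close> on a Lipschitz domain this is, at almost
  every boundary point, the value of the usual trace; it does not depend on the representative
  of an almost everywhere class.\<close>

definition has_trace :: "(real ^ 'n) set \<Rightarrow> (real ^ 'n \<Rightarrow> 'b::real_normed_vector) \<Rightarrow> real ^ 'n \<Rightarrow> 'b \<Rightarrow> bool" where
  "has_trace S F x L \<longleftrightarrow>
     ((\<lambda>r. (LINT y:S \<inter> ball x r|lebesgue. norm (F y - L)) / measure lebesgue (S \<inter> ball x r))
        \<longlongrightarrow> 0) (at_right 0)"

definition one_sided_trace :: "(real ^ 'n) set \<Rightarrow> (real ^ 'n \<Rightarrow> 'b::real_normed_vector) \<Rightarrow> real ^ 'n \<Rightarrow> 'b" where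
  "one_sided_trace S F x = (THE L. has_trace S F x L)"


section \<open>Domains, interfaces and coefficients\<close>

definition polyhedral_domain :: "(real ^ 'n) set \<Rightarrow> bool" where
  "polyhedral_domain S \<longleftrightarrow>
     open S \<and> connected S \<and> bounded S \<and> S \<noteq> {} \<and>
     (\<exists>P. finite P \<and> (\<forall>p\<in>P. polytope p) \<and> frontier S = \<Union>P)"

text \<open>Near each of its points the interface is the graph of a Lipschitz function over the
  hyperplane orthogonal to \<open>e\<close>, with the two subdomains on either side.\<close>

definition lipschitz_interface :: "(real ^ 'n) set \<Rightarrow> (real ^ 'n) set \<Rightarrow> (real ^ 'n) set \<Rightarrow> (real ^ 'n) set \<Rightarrow> bool" where
  "lipschitz_interface S S1 S2 G \<longleftrightarrow>
     (\<forall>x\<in>G. \<exists>U e g C. open U \<and> x \<in> U \<and> norm e = 1 \<and> C-lipschitz_on {y. y \<bullet> e = 0} g \<and>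
        G \<inter> U \<subseteq> {y. y \<bullet> e = g (y - (y \<bullet> e) *\<^sub>R e)} \<and>
        S1 \<inter> U = {y \<in> S \<inter> U. y \<bullet> e < g (y - (y \<bullet> e) *\<^sub>R e)} \<and>
        S2 \<inter> U = {y \<in> S \<inter> U. y \<bullet> e > g (y - (y \<bullet> e) *\<^sub>R e)})"

text \<open>The unit normal pointing from \<open>S1\<close> to \<open>S2\<close>; for polyhedral sets it is determined at
  almost every point of the interface.\<close>

definition unit_normal :: "(real ^ 'n) set \<Rightarrow> (real ^ 'n) set \<Rightarrow> real ^ 'n \<Rightarrow> real ^ 'n" where
  "unit_normal S1 S2 x =
     (THE n. norm n = 1 \<and> (\<exists>e>0.
        S1 \<inter> ball x e = {y \<in> ball x e. (y - x) \<bullet> n < 0} \<and>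
        S2 \<inter> ball x e = {y \<in> ball x e. (y - x) \<bullet> n > 0}))"

definition spectrum_within :: "real \<Rightarrow> real \<Rightarrow> real ^ 'n ^ 'n \<Rightarrow> bool" where
  "spectrum_within \<alpha> \<beta> B \<longleftrightarrow>
     (\<forall>\<mu> w. w \<noteq> 0 \<and> B *v w = \<mu> *\<^sub>R w \<longrightarrow> \<alpha> \<le> \<mu> \<and> \<mu> \<le> \<beta>)"

definition is_psd_sqrt :: "real ^ 'n ^ 'n \<Rightarrow> real ^ 'n ^ 'n \<Rightarrow> bool" where
  "is_psd_sqrt R B \<longleftrightarrow> transpose R = R \<and> (\<forall>w. 0 \<le> w \<bullet> (R *v w)) \<and> R ** R = B"


section \<open>Meshes and finite element spaces\<close>

definition mesh_of :: "(real ^ 'n) set \<Rightarrow> (real ^ 'n) set set \<Rightarrow> bool" where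
  "mesh_of S M \<longleftrightarrow> triangulation M \<and> (\<forall>T\<in>M. int CARD('n) simplex T) \<and> \<Union>M = closure S"

definition shape_regular :: "real \<Rightarrow> (real ^ 'n) set set \<Rightarrow> bool" where
  "shape_regular \<kappa> M \<longleftrightarrow> \<kappa> > 0 \<and> (\<forall>T\<in>M. \<exists>x. cball x (diameter T / \<kappa>) \<subseteq> T)"

definition quasi_uniform :: "real \<Rightarrow> (real ^ 'n) set set \<Rightarrow> bool" where
  "quasi_uniform \<kappa> M \<longleftrightarrow> \<kappa> > 0 \<and> (\<forall>T\<in>M. \<forall>T'\<in>M. diameter T \<le> \<kappa> * diameter T')"

definition mesh_size :: "(real ^ 'n) set set \<Rightarrow> real" where
  "mesh_size M = Max (diameter ` M)"

definition refines :: "'a set set \<Rightarrow> 'a set set \<Rightarrow> bool" where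
  "refines M N \<longleftrightarrow> \<Union>M = \<Union>N \<and> (\<forall>T\<in>M. \<exists>T'\<in>N. T \<subseteq> T')"

definition fits_boundary_part :: "(real ^ 'n) set set \<Rightarrow> (real ^ 'n) set \<Rightarrow> bool" where
  "fits_boundary_part M G \<longleftrightarrow> (\<forall>T\<in>M. \<forall>x\<in>T \<inter> G. \<exists>F. F face_of T \<and> x \<in> F \<and> F \<subseteq> G)"

text \<open>An element may touch the interface with several facets, so the cells of the induced
  partition are the traces of facets rather than of whole elements.\<close>

definition interface_cells :: "(real ^ 'n) set set \<Rightarrow> (real ^ 'n) set \<Rightarrow> (real ^ 'n) set set" where
  "interface_cells M G =
     {F \<inter> G |F T. T \<in> M \<and> F facet_of T \<and> emeasure surface_measure (F \<inter> G) > 0}"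

definition P1 :: "(real ^ 'n \<Rightarrow> real) set" where
  "P1 = {p. \<exists>c a. \<forall>x. p x = c + a \<bullet> x}"

text \<open>The elements are closed, so a function that is affine on each of them is continuous on the
  closure of \<open>S\<close> and its trace on \<open>G \<subseteq> frontier S\<close> is its restriction. The value \<open>0\<close>
  outside \<open>closure S\<close> is a convention that makes equality of functions the right notion.\<close>

definition fe_space :: "(real ^ 'n) set \<Rightarrow> (real ^ 'n) set \<Rightarrow> (real ^ 'n) set set \<Rightarrow> (real ^ 'n \<Rightarrow> real) set" where
  "fe_space S G M =
     {v \<in> H1 S. (\<forall>x\<in>G. v x = 0) \<and> (\<forall>T\<in>M. \<exists>p\<in>P1. \<forall>x\<in>T. v x = p x) \<and>
                (\<forall>x. x \<notin> closure S \<longrightarrow> v x = 0)}"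

definition vertices :: "(real ^ 'n) set set \<Rightarrow> (real ^ 'n) set" where
  "vertices M = {z. \<exists>T\<in>M. z extreme_point_of T}"

definition nodal_basis :: "(real ^ 'n) set \<Rightarrow> (real ^ 'n) set set \<Rightarrow> real ^ 'n \<Rightarrow> real ^ 'n \<Rightarrow> real" where
  "nodal_basis S M z =
     (THE \<phi>. (\<forall>T\<in>M. \<exists>p\<in>P1. \<forall>x\<in>T. \<phi> x = p x) \<and> (\<forall>x. x \<notin> closure S \<longrightarrow> \<phi> x = 0) \<and>
             (\<forall>y\<in>vertices M. \<phi> y = (if y = z then 1 else 0)))"

definition quasi_interpolation ::
    "(real ^ 'n) set \<Rightarrow> (real ^ 'n) set \<Rightarrow> (real ^ 'n) set set \<Rightarrow> (real ^ 'n \<Rightarrow> real) \<Rightarrow> real ^ 'n \<Rightarrow> real" where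
  "quasi_interpolation S G M u =
     (\<lambda>x. \<Sum>z\<in>vertices M - G.
        L2_inner S u (nodal_basis S M z) / L2_inner S (\<lambda>x. 1) (nodal_basis S M z) * nodal_basis S M z x)"

definition L2_projection :: "(real ^ 'n) set \<Rightarrow> (real ^ 'n \<Rightarrow> real) set \<Rightarrow> (real ^ 'n \<Rightarrow> real) \<Rightarrow> real ^ 'n \<Rightarrow> real" where
  "L2_projection S V u = (THE w. w \<in> V \<and> (\<forall>\<phi>\<in>V. L2_inner S w \<phi> = L2_inner S u \<phi>))"


section \<open>The discontinuous Galerkin multiscale method\<close>

text \<open>The components are the domain, the first subdomain, the coefficient, the fine meshes of both
  subdomains and the coarse mesh of the second one.\<close>

record ('n::finite) setting =
  Om :: "(real ^ 'n) set"
  Om1 :: "(real ^ 'n) set"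
  Co :: "real ^ 'n \<Rightarrow> real ^ 'n ^ 'n"
  Mh1 :: "(real ^ 'n) set set"
  Mh2 :: "(real ^ 'n) set set"
  MH2 :: "(real ^ 'n) set set"

definition Om2 :: "('n::finite) setting \<Rightarrow> (real ^ 'n) set" where
  "Om2 D = Om D - closure (Om1 D)"

definition Gam :: "('n::finite) setting \<Rightarrow> (real ^ 'n) set" where
  "Gam D = frontier (Om1 D) \<inter> frontier (Om2 D)"

definition Gam1 :: "('n::finite) setting \<Rightarrow> (real ^ 'n) set" where
  "Gam1 D = frontier (Om D) \<inter> frontier (Om1 D)"

definition Gam2 :: "('n::finite) setting \<Rightarrow> (real ^ 'n) set" where
  "Gam2 D = frontier (Om D) \<inter> frontier (Om2 D)"

definition fine_size :: "('n::finite) setting \<Rightarrow> real" where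
  "fine_size D = mesh_size (Mh1 D \<union> Mh2 D)"

locale multiscale_setting =
  fixes D :: "('n::finite) setting" and f :: "real ^ 'n \<Rightarrow> real" and \<alpha> \<beta> \<kappa> :: real
  assumes dimension: "CARD('n) \<in> {2, 3}"
    and domain: "polyhedral_domain (Om D)"
    and subdomain: "open (Om1 D)" "Om1 D \<subseteq> Om D" "Om1 D \<noteq> {}" "Om2 D \<noteq> {}"
      "finite (components (Om1 D))" "\<And>K. K \<in> components (Om1 D) \<Longrightarrow> polyhedral_domain K"
      "Om D \<inter> interior (closure (Om1 D)) \<subseteq> Om1 D"
    and interface: "lipschitz_interface (Om D) (Om1 D) (Om2 D) (Gam D)"
      "emeasure surface_measure (Gam D) < \<infinity>"
    and load: "L2_on (Om D) f"
    and ellipticity: "0 < \<alpha>" "\<alpha> \<le> \<beta>"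
    and coefficient: "Co D \<in> borel_measurable (lebesgue_on (Om D))"
      "\<exists>B. AE x in lebesgue_on (Om D). norm (Co D x) \<le> B"
      "\<And>x. x \<in> Om D \<Longrightarrow> transpose (Co D x) = Co D x"
      "\<And>x. x \<in> Om D \<Longrightarrow> spectrum_within \<alpha> \<beta> (Co D x)"
    and coefficient_trace:
      "AE x in surface_measure. x \<in> Gam D \<longrightarrow> (\<exists>B. has_trace (Om1 D) (Co D) x B \<and> spectrum_within \<alpha> \<beta> B)"
      "AE x in surface_measure. x \<in> Gam D \<longrightarrow> (\<exists>B. has_trace (Om2 D) (Co D) x B \<and> spectrum_within \<alpha> \<beta> B)"
    and fine_meshes: "mesh_of (Om1 D) (Mh1 D)" "mesh_of (Om2 D) (Mh2 D)"
      "shape_regular \<kappa> (Mh1 D)" "shape_regular \<kappa> (Mh2 D)"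
      "quasi_uniform \<kappa> (Mh1 D)" "quasi_uniform \<kappa> (Mh2 D)"
    and coarse_mesh: "mesh_of (Om2 D) (MH2 D)" "shape_regular \<kappa> (MH2 D)"
      "fits_boundary_part (MH2 D) (Gam2 D)"
      "mesh_size (MH2 D) > fine_size D" "refines (Mh2 D) (MH2 D)"
    and interface_partition:
      "refines (interface_cells (Mh1 D) (Gam D)) (interface_cells (MH2 D) (Gam D))"

text \<open>A function \<open>v\<close> that may jump across the interface is represented by the pair of its
  restrictions to the two subdomains, each continued to the closure of its subdomain; hence both
  one-sided values on the interface are available.\<close>

type_synonym 'n broken = "(real ^ 'n \<Rightarrow> real) \<times> (real ^ 'n \<Rightarrow> real)"

definition Vh1 :: "('n::finite) setting \<Rightarrow> (real ^ 'n \<Rightarrow> real) set" where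
  "Vh1 D = fe_space (Om1 D) (Gam1 D) (Mh1 D)"

definition Vh2 :: "('n::finite) setting \<Rightarrow> (real ^ 'n \<Rightarrow> real) set" where
  "Vh2 D = fe_space (Om2 D) (Gam2 D) (Mh2 D)"

definition VH2 :: "('n::finite) setting \<Rightarrow> (real ^ 'n \<Rightarrow> real) set" where
  "VH2 D = fe_space (Om2 D) (Gam2 D) (MH2 D)"

definition Vhh :: "('n::finite) setting \<Rightarrow> 'n broken set" where
  "Vhh D = Vh1 D \<times> Vh2 D"

definition VhH :: "('n::finite) setting \<Rightarrow> 'n broken set" where
  "VhH D = Vh1 D \<times> VH2 D"

text \<open>The interface is a Lebesgue null set, so integrals over the domain are sums of integrals over
  the two subdomains.\<close>

definition load_form :: "('n::finite) setting \<Rightarrow> (real ^ 'n \<Rightarrow> real) \<Rightarrow> 'n broken \<Rightarrow> real" where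
  "load_form D f v = L2_inner (Om1 D) f (fst v) + L2_inner (Om2 D) f (snd v)"

definition jump :: "'n broken \<Rightarrow> real ^ 'n \<Rightarrow> real" where
  "jump v x = fst v x - snd v x"

definition mean_flux :: "('n::finite) setting \<Rightarrow> 'n broken \<Rightarrow> real ^ 'n \<Rightarrow> real" where
  "mean_flux D v x =
     (one_sided_trace (Om1 D) (\<lambda>y. Co D y *v grad (fst v) y) x \<bullet> unit_normal (Om1 D) (Om2 D) x
    + one_sided_trace (Om2 D) (\<lambda>y. Co D y *v grad (snd v) y) x \<bullet> unit_normal (Om1 D) (Om2 D) x) / 2"

definition bulk_form :: "('n::finite) setting \<Rightarrow> 'n broken \<Rightarrow> 'n broken \<Rightarrow> real" where
  "bulk_form D u v =
     (LINT x:Om1 D|lebesgue. (Co D x *v grad (fst u) x) \<bullet> grad (fst v) x)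
   + (LINT x:Om2 D|lebesgue. (Co D x *v grad (snd u) x) \<bullet> grad (snd v) x)"

definition dg_form :: "('n::finite) setting \<Rightarrow> real \<Rightarrow> 'n broken \<Rightarrow> 'n broken \<Rightarrow> real" where
  "dg_form D \<gamma> u v =
     bulk_form D u v
   - surface_inner (Gam D) (mean_flux D u) (jump v)
   - surface_inner (Gam D) (jump u) (mean_flux D v)
   + surface_inner (Gam D) (\<lambda>x. \<gamma> / fine_size D * jump u x) (jump v)"

text \<open>Here \<open>R\<close> is the pointwise square root of the coefficient.\<close>

definition dg_norm_sq :: "('n::finite) setting \<Rightarrow> (real ^ 'n \<Rightarrow> real ^ 'n ^ 'n) \<Rightarrow> real \<Rightarrow> 'n broken \<Rightarrow> real" where
  "dg_norm_sq D R \<gamma> v =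
     (LINT x:Om1 D|lebesgue. (norm (R x *v grad (fst v) x))\<^sup>2)
   + (LINT x:Om2 D|lebesgue. (norm (R x *v grad (snd v) x))\<^sup>2)
   + \<gamma> / fine_size D * surface_inner (Gam D) (jump v) (jump v)
   + fine_size D / \<gamma> * surface_inner (Gam D) (mean_flux D v) (mean_flux D v)"

definition ChH :: "('n::finite) setting \<Rightarrow> 'n broken \<Rightarrow> 'n broken" where
  "ChH D v = (L2_projection (Om1 D) (Vh1 D) (fst v),
              quasi_interpolation (Om2 D) (Gam2 D) (MH2 D) (snd v))"

definition W0h :: "('n::finite) setting \<Rightarrow> 'n broken set" where
  "W0h D = {v \<in> Vhh D. ChH D v = 0}"

definition Qh :: "('n::finite) setting \<Rightarrow> real \<Rightarrow> 'n broken \<Rightarrow> 'n broken" where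
  "Qh D \<gamma> v = (THE q. q \<in> W0h D \<and> (\<forall>w\<in>W0h D. dg_form D \<gamma> q w = dg_form D \<gamma> v w))"

definition Vms :: "('n::finite) setting \<Rightarrow> real \<Rightarrow> 'n broken set" where
  "Vms D \<gamma> = (\<lambda>v. v - Qh D \<gamma> v) ` VhH D"

end

theory Submission
  imports Defs
begin

text \<open>Write \<open>a\<close> for the bilinear form, \<open>C\<close> for \<^const>\<open>ChH\<close> and \<open>Q\<close> for \<^const>\<open>Qh\<close>. The error
  \<open>e = u - ums\<close> is \<open>a\<close>-orthogonal to the multiscale space by Galerkin orthogonality. Since the coarse
  space has the same image under \<open>C\<close> as the fine space, there is a coarse \<open>y\<close> with \<open>C y = C e\<close>; put
  \<open>z = y - Q y\<close>. Then \<open>e - z\<close> lies in \<open>W0h\<close>, which is \<open>a\<close>-orthogonal to \<open>z\<close>, so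
  \<open>a z z = a e z - a (e - z) z = 0\<close>, and coercivity gives \<open>z = 0\<close>, i.e. \<open>e \<in> W0h\<close>. On the first
  subdomain \<open>C\<close> is the identity of the fine space, hence the equality there.

  The analytic content is in two facts. First, \<open>a\<close> is bilinear on the fine space: its integrands have to
  be integrable, and the traces of the fluxes have to exist and be additive almost everywhere on the
  interface. This holds off the faces of codimension two, where a point of the interface lies in exactly
  one element on each side. Second, coercivity makes \<open>a\<close> definite: vanishing gradients and an almost
  everywhere vanishing jump yield a continuous function of finite range on the connected domain, i.e. a
  constant, and it vanishes on the boundary. The jump vanishes everywhere because nonempty relatively
  open parts of the interface inside the domain have positive surface measure.\<close>

section \<open>Forms on finite-dimensional spaces\<close>

text \<open>Several objects are definite descriptions and become usable only after existence and
  uniqueness. For \<open>Qh\<close> this is solvability of the corrector problem on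
  \<open>W0h\<close>. Fine functions are spanned by finitely many nodal functions, and there a
  bilinear form that is definite already represents every functional; so coercivity at
  \<open>\<gamma>\<^sub>0\<close> enters only through definiteness. The surface measure is the
  second obstacle: \<open>measure_of\<close> reproduces the Hausdorff outer measure on Borel sets
  only once countable additivity is proved. Positivity on pieces of the interface is then obtained
  by comparison with the volume of a thickening, without computing any area. On the second subdomain
  the equality of the images under \<open>ChH\<close> is a statement about moments:
  \<open>quasi_interpolation\<close> sees a function only through its L2 products with the free
  coarse nodal functions, and these are preserved by the L2 projection onto the coarse
  space.\<close>

text \<open>Gram-Schmidt, one spanning vector at a time. The functional is arbitrary in the
  induction because the hypothesis is applied twice: to \<open>l\<close>, and to \<open>a x\<close>,
  which yields the part \<open>p\<close> to be subtracted from the new vector. As \<open>a\<close>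
  may be asymmetric, \<open>y\<close> is orthogonal to \<open>span S\<close> in the left argument
  only.\<close>

lemma (in vector_space) form_represents_functional_on_span:
  assumes V: "subspace V" and S: "finite S" "S \<subseteq> V"
    and add1: "\<And>x y z. x \<in> V \<Longrightarrow> y \<in> V \<Longrightarrow> z \<in> V \<Longrightarrow> a (x + y) z = a x z + (a y z :: 'a)"
    and scale1: "\<And>c x z. x \<in> V \<Longrightarrow> z \<in> V \<Longrightarrow> a (scale c x) z = c * a x z"
    and add2: "\<And>x y z. x \<in> V \<Longrightarrow> y \<in> V \<Longrightarrow> z \<in> V \<Longrightarrow> a z (x + y) = a z x + a z y"
    and scale2: "\<And>c x z. x \<in> V \<Longrightarrow> z \<in> V \<Longrightarrow> a z (scale c x) = c * a z x"
    and definite: "\<And>x. x \<in> V \<Longrightarrow> a x x = 0 \<Longrightarrow> x = 0"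
    and l: "\<And>x y. x \<in> V \<Longrightarrow> y \<in> V \<Longrightarrow> l (x + y) = l x + l y"
      "\<And>c x. x \<in> V \<Longrightarrow> l (scale c x) = c * l x"
  shows "\<exists>q\<in>span S. \<forall>w\<in>span S. a q w = l w"
  using S l
proof (induction S arbitrary: l rule: finite_induct)
  case empty
  have "0 \<in> V" using V by (rule subspace_0)
  then show ?case using empty(3)[of 0 0] scale2[of 0 0 0] by simp
next
  case (insert x S)
  have x: "x \<in> V" and SV: "S \<subseteq> V" using insert.prems by auto
  have spanV: "span S \<subseteq> V" using SV V by (simp add: span_minimal)
  obtain q where q: "q \<in> span S" "\<And>w. w \<in> span S \<Longrightarrow> a q w = l w"
    using insert.IH[OF SV insert.prems(2,3)] by blast
  have "\<exists>p\<in>span S. \<forall>w\<in>span S. a p w = a x w"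
    by (rule insert.IH[OF SV]) (simp_all only: add2[OF _ _ x] scale2[OF _ x])
  then obtain p where p: "p \<in> span S" "\<And>w. w \<in> span S \<Longrightarrow> a p w = a x w" by blast
  define y where "y = x - p"
  have pV: "p \<in> V" and qV: "q \<in> V" using p q spanV by auto
  have yV: "y \<in> V" unfolding y_def using V x pV by (rule subspace_diff)
  have xpy: "x = p + y" by (simp add: y_def)
  have y_orth: "a y w = 0" if "w \<in> span S" for w
  proof -
    have "a x w = a p w + a y w" unfolding xpy using pV yV that spanV by (intro add1) auto
    then show ?thesis using p(2)[OF that] by simp
  qed
  have decomp: "\<exists>w\<in>span S. \<exists>c. v = w + scale c y" if "v \<in> span (insert x S)" for v
  proof -
    obtain k where k: "v - scale k x \<in> span S" using \<open>v \<in> span (insert x S)\<close> by (auto simp: span_insert)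
    have "v = ((v - scale k x) + scale k p) + scale k y"
      unfolding y_def by (simp add: scale_right_diff_distrib)
    moreover have "(v - scale k x) + scale k p \<in> span S"
      using k p(1) by (intro span_add span_scale)
    ultimately show ?thesis by blast
  qed
  show ?case
  proof (cases "y = 0")
    case True
    have "a q w = l w" if "w \<in> span (insert x S)" for w
      using decomp[OF that] True q(2) by auto
    moreover have "q \<in> span (insert x S)" using q(1) span_mono[of S "insert x S"] by auto
    ultimately show ?thesis by blast
  next
    case False
    then have yy: "a y y \<noteq> 0" using definite yV by blast
    \<comment> \<open>The representative is corrected along \<open>y\<close>. The correction is
      invisible on \<open>span S\<close>, so \<open>c\<close> only has to repair the value at
      \<open>y\<close>, where \<open>q\<close> already contributes \<open>a q y\<close>.\<close>
    define c where "c = (l y - a q y) / a y y"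
    have "a (q + scale c y) w = l w" if w: "w \<in> span (insert x S)" for w
    proof -
      obtain w' k where w': "w' \<in> span S" "w = w' + scale k y" using decomp[OF w] by blast
      have V': "w' \<in> V" "scale k y \<in> V" "scale c y \<in> V"
        using w'(1) spanV V yV by (auto intro: subspace_scale)
      have wV: "w \<in> V" unfolding w'(2) using V V'(1,2) by (rule subspace_add)
      have "a (q + scale c y) w = a q w + c * a y w"
        using add1[OF qV V'(3) wV] scale1[OF yV wV] by simp
      also have "a q w = l w' + k * a q y"
        unfolding w'(2) using add2[OF V'(1,2) qV] scale2[OF yV qV] q(2)[OF w'(1)] by simp
      also have "a y w = k * a y y"
        unfolding w'(2) using add2[OF V'(1,2) yV] scale2[OF yV yV] y_orth[OF w'(1)] by simp
      also have "l w' + k * a q y + c * (k * a y y) = l w' + k * l y"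
        using yy by (simp add: c_def field_simps)
      also have "\<dots> = l w"
        unfolding w'(2) using insert.prems(2)[OF V'(1,2)] insert.prems(3)[OF yV] by simp
      finally show ?thesis .
    qed
    moreover have "q + scale c y \<in> span (insert x S)"
    proof -
      have "x - p \<in> span (insert x S)"
        using p(1) span_mono[of S "insert x S"] by (intro span_diff) (auto intro: span_base)
      then show ?thesis
        using q(1) span_mono[of S "insert x S"] unfolding y_def by (intro span_add span_scale) auto
    qed
    ultimately show ?thesis by blast
  qed
qed

text \<open>The set \<open>B\<close> only bounds the dimension and may lie outside \<open>V\<close>;
  this lets \<open>W0h\<close> be handled with nodal functions that do not belong to it. Uniqueness
  tests the difference of two solutions with itself.\<close>

lemma (in vector_space) form_represents_functional:
  assumes V: "subspace V" and finite_dimensional: "finite B" "V \<subseteq> span B"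
    and add1: "\<And>x y z. x \<in> V \<Longrightarrow> y \<in> V \<Longrightarrow> z \<in> V \<Longrightarrow> a (x + y) z = a x z + (a y z :: 'a)"
    and scale1: "\<And>c x z. x \<in> V \<Longrightarrow> z \<in> V \<Longrightarrow> a (scale c x) z = c * a x z"
    and add2: "\<And>x y z. x \<in> V \<Longrightarrow> y \<in> V \<Longrightarrow> z \<in> V \<Longrightarrow> a z (x + y) = a z x + a z y"
    and scale2: "\<And>c x z. x \<in> V \<Longrightarrow> z \<in> V \<Longrightarrow> a z (scale c x) = c * a z x"
    and definite: "\<And>x. x \<in> V \<Longrightarrow> a x x = 0 \<Longrightarrow> x = 0"
    and l: "\<And>x y. x \<in> V \<Longrightarrow> y \<in> V \<Longrightarrow> l (x + y) = l x + l y"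
      "\<And>c x. x \<in> V \<Longrightarrow> l (scale c x) = c * l x"
  shows "\<exists>!q. q \<in> V \<and> (\<forall>w\<in>V. a q w = l w)"
proof -
  obtain S where S: "S \<subseteq> V" "independent S" "V \<subseteq> span S"
    by (rule maximal_independent_subset)
  have "finite S"
    using independent_span_bound[OF finite_dimensional(1) S(2)] S(1) finite_dimensional(2) by blast
  have "span S = V" using S V by (simp add: span_subspace)
  have "\<exists>q\<in>span S. \<forall>w\<in>span S. a q w = l w"
    by (rule form_represents_functional_on_span[OF V \<open>finite S\<close> S(1)])
      (fact add1 scale1 add2 scale2 definite l)+
  then obtain q where q: "q \<in> V" "\<And>w. w \<in> V \<Longrightarrow> a q w = l w"
    unfolding \<open>span S = V\<close> by blast
  have "q' = q" if "q' \<in> V" "\<And>w. w \<in> V \<Longrightarrow> a q' w = l w" for q'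
  proof -
    have d: "q' - q \<in> V" using V that(1) q(1) by (rule subspace_diff)
    have "a (q' - q + q) (q' - q) = a (q' - q) (q' - q) + a q (q' - q)"
      by (rule add1[OF d q(1) d])
    then have "a (q' - q) (q' - q) = 0" using that(2)[OF d] q(2)[OF d] by simp
    then show ?thesis using definite[OF d] by simp
  qed
  then show ?thesis using q by blast
qed

section \<open>Hausdorff measure\<close>

abbreviation "hausdorff_weight k C \<equiv> ennreal (unit_ball_vol (real k) * (diameter C / 2) ^ k)"

definition hausdorff_covers :: "real \<Rightarrow> 'a::metric_space set \<Rightarrow> (nat \<Rightarrow> 'a set) set" where
  "hausdorff_covers \<delta> S =
     {C. S \<subseteq> (\<Union>i. C i) \<and> (\<forall>i. bounded (C i) \<and> diameter (C i) \<le> \<delta>)}"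

lemma hausdorff_pre_eq:
  "hausdorff_pre k \<delta> S = (INF C \<in> hausdorff_covers \<delta> S. \<Sum>i. hausdorff_weight k (C i))"
  by (simp add: hausdorff_pre_def hausdorff_covers_def)

lemma hausdorff_pre_le:
  assumes "C \<in> hausdorff_covers \<delta> S"
  shows "hausdorff_pre k \<delta> S \<le> (\<Sum>i. hausdorff_weight k (C i))"
  unfolding hausdorff_pre_eq using assms by (rule INF_lower)

lemma hausdorff_pre_mono: "A \<subseteq> B \<Longrightarrow> hausdorff_pre k \<delta> A \<le> hausdorff_pre k \<delta> B"
  unfolding hausdorff_pre_eq by (rule INF_superset_mono) (auto simp: hausdorff_covers_def)

lemma hausdorff_pre_antimono: "\<delta> \<le> \<delta>' \<Longrightarrow> hausdorff_pre k \<delta>' A \<le> hausdorff_pre k \<delta> A"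
  unfolding hausdorff_pre_eq
  by (rule INF_superset_mono) (auto simp: hausdorff_covers_def intro: order_trans)

lemma hausdorff_pre_le_outer: "\<delta> > 0 \<Longrightarrow> hausdorff_pre k \<delta> A \<le> hausdorff_outer k A"
  unfolding hausdorff_outer_def by (rule SUP_upper) simp

lemma hausdorff_outer_mono: "A \<subseteq> B \<Longrightarrow> hausdorff_outer k A \<le> hausdorff_outer k B"
  unfolding hausdorff_outer_def by (rule SUP_mono) (auto intro: hausdorff_pre_mono)

text \<open>For \<open>k = 0\<close> the weight of the empty set would be \<open>0 ^ 0\<close>, that
  is 1, and a cover by infinitely many empty sets would have infinite weight.\<close>

lemma hausdorff_outer_empty:
  assumes "k > 0" shows "hausdorff_outer k ({} :: 'a::metric_space set) = 0"
proof -
  have "hausdorff_pre k \<delta> ({} :: 'a set) \<le> (\<Sum>i. hausdorff_weight k ({} :: 'a set))" if "\<delta> > 0" for \<delta>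
    using that by (intro hausdorff_pre_le[of "\<lambda>_. {}"]) (auto simp: hausdorff_covers_def)
  then show ?thesis using assms by (simp add: hausdorff_outer_def zero_power SUP_eq_const)
qed

lemma ennreal_suminf_halves: "(\<Sum>n. ennreal e * ennreal ((1/2) ^ Suc n)) = ennreal e"
proof -
  have "(\<Sum>n. ennreal ((1/2) ^ Suc n)) = ennreal 1"
    using power_half_series by (intro suminf_ennreal_eq) auto
  then show ?thesis by simp
qed

text \<open>Near-optimal covers of the pieces, with a slack that halves from piece to piece, are
  merged into one sequence by the pairing bijection.\<close>

lemma hausdorff_pre_countably_subadditive:
  fixes A :: "nat \<Rightarrow> 'a::metric_space set"
  shows "hausdorff_pre k \<delta> (\<Union>i. A i) \<le> (\<Sum>i. hausdorff_pre k \<delta> (A i))"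
proof (rule ennreal_le_epsilon)
  fix e :: real assume e: "e > 0" and fin: "(\<Sum>i. hausdorff_pre k \<delta> (A i)) < top"
  have "\<exists>C\<in>hausdorff_covers \<delta> (A i). (\<Sum>j. hausdorff_weight k (C j))
      \<le> hausdorff_pre k \<delta> (A i) + ennreal e * ennreal ((1/2) ^ Suc i)" for i
  proof -
    have "hausdorff_pre k \<delta> (A i) \<noteq> top"
      using ennreal_suminf_lessD[OF fin, of i] by auto
    moreover have "ennreal e * ennreal ((1/2) ^ Suc i) > 0"
      using e by (simp add: ennreal_mult[symmetric])
    ultimately have "hausdorff_pre k \<delta> (A i) < hausdorff_pre k \<delta> (A i) + ennreal e * ennreal ((1/2) ^ Suc i)"
      by (simp add: ennreal_add_left_cancel_less[of _ 0, simplified])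
    then show ?thesis
      by (subst (asm) hausdorff_pre_eq) (auto simp: INF_less_iff intro: less_imp_le)
  qed
  then obtain C where C: "\<And>i. C i \<in> hausdorff_covers \<delta> (A i)"
    "\<And>i. (\<Sum>j. hausdorff_weight k (C i j)) \<le> hausdorff_pre k \<delta> (A i) + ennreal e * ennreal ((1/2) ^ Suc i)"
    by metis
  have "(\<lambda>n. case prod_decode n of (i, j) \<Rightarrow> C i j) \<in> hausdorff_covers \<delta> (\<Union>i. A i)"
  proof -
    have "x \<in> (\<Union>n. case prod_decode n of (i, j) \<Rightarrow> C i j)" if "x \<in> A i" for x i
    proof -
      have "x \<in> (\<Union>j. C i j)" using C(1)[of i] that unfolding hausdorff_covers_def by blast
      then obtain j where "x \<in> C i j" by blast
      then show ?thesis by (intro UN_I[of "prod_encode (i, j)"]) auto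
    qed
    then show ?thesis using C(1) by (auto simp: hausdorff_covers_def split: prod.split)
  qed
  then have "hausdorff_pre k \<delta> (\<Union>i. A i)
      \<le> (\<Sum>n. hausdorff_weight k (case prod_decode n of (i, j) \<Rightarrow> C i j))"
    by (rule hausdorff_pre_le)
  also have "\<dots> = (\<Sum>n. (\<lambda>(i, j). hausdorff_weight k (C i j)) (prod_decode n))"
    by (simp add: case_prod_beta)
  also have "\<dots> = (\<Sum>i. \<Sum>j. hausdorff_weight k (C i j))"
    by (rule suminf_ennreal_2dimen) simp
  also have "\<dots> \<le> (\<Sum>i. hausdorff_pre k \<delta> (A i) + ennreal e * ennreal ((1/2) ^ Suc i))"
    by (intro suminf_le C(2)) auto
  also have "\<dots> = (\<Sum>i. hausdorff_pre k \<delta> (A i)) + (\<Sum>i. ennreal e * ennreal ((1/2) ^ Suc i))"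
    by (rule suminf_add[symmetric]) auto
  also have "\<dots> = (\<Sum>i. hausdorff_pre k \<delta> (A i)) + ennreal e"
    by (subst ennreal_suminf_halves) simp
  finally show "hausdorff_pre k \<delta> (\<Union>i. A i) \<le> (\<Sum>i. hausdorff_pre k \<delta> (A i)) + ennreal e" .
qed

lemma hausdorff_outer_countably_subadditive:
  "hausdorff_outer k (\<Union>i. A i) \<le> (\<Sum>i. hausdorff_outer k (A i))"
  unfolding hausdorff_outer_def[of k "\<Union>i. A i"]
proof (rule SUP_least)
  fix \<delta> :: real assume "\<delta> \<in> {0<..}"
  then have "(\<Sum>i. hausdorff_pre k \<delta> (A i)) \<le> (\<Sum>i. hausdorff_outer k (A i))"
    by (intro suminf_le hausdorff_pre_le_outer) auto
  then show "hausdorff_pre k \<delta> (\<Union>i. A i) \<le> (\<Sum>i. hausdorff_outer k (A i))"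
    using hausdorff_pre_countably_subadditive order_trans by blast
qed

lemma outer_measure_space_hausdorff_outer:
  "k > 0 \<Longrightarrow> outer_measure_space (Pow UNIV) (hausdorff_outer k)"
  by (auto simp: outer_measure_space_def positive_def increasing_def countably_subadditive_def
      intro: hausdorff_outer_empty hausdorff_outer_mono hausdorff_outer_countably_subadditive)

lemma hausdorff_outer_Un:
  fixes A B :: "'a::metric_space set"
  assumes "k > 0"
  shows "hausdorff_outer k (A \<union> B) \<le> hausdorff_outer k A + hausdorff_outer k B"
proof -
  have "(\<Sum>n. hausdorff_outer k (binaryset A B n)) = hausdorff_outer k A + hausdorff_outer k B"
    using suminf_binaryset_eq[where f = "hausdorff_outer k :: 'a set \<Rightarrow> ennreal", OF hausdorff_outer_empty[OF assms]] by simp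
  then show ?thesis
    using hausdorff_outer_countably_subadditive[of k "binaryset A B"] by (simp add: UN_binaryset_eq)
qed

text \<open>Once \<delta> is below the gap \<open>e\<close>, no covering set meets both
  \<open>A\<close> and \<open>B\<close>, so a cover of the union falls apart into a cover of
  each.\<close>

lemma hausdorff_outer_separated:
  fixes A B :: "'a::metric_space set"
  assumes k: "k > 0" and e: "e > 0" and sep: "\<And>x y. x \<in> A \<Longrightarrow> y \<in> B \<Longrightarrow> e \<le> dist x y"
  shows "hausdorff_outer k A + hausdorff_outer k B \<le> hausdorff_outer k (A \<union> B)"
proof -
  have small: "hausdorff_pre k \<delta> A + hausdorff_pre k \<delta> B \<le> hausdorff_pre k \<delta> (A \<union> B)"
    if "0 < \<delta>" "\<delta> < e" for \<delta>
    unfolding hausdorff_pre_eq[of k \<delta> "A \<union> B"]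
  proof (rule INF_greatest)
    fix C :: "nat \<Rightarrow> 'a set" assume C: "C \<in> hausdorff_covers \<delta> (A \<union> B)"
    \<comment> \<open>Discarded sets become empty instead of being removed, which keeps the index
      set; they weigh nothing because \<open>k > 0\<close>.\<close>
    define CA where "CA = (\<lambda>i. if C i \<inter> A \<noteq> {} then C i else {})"
    define CB where "CB = (\<lambda>i. if C i \<inter> B \<noteq> {} then C i else {})"
    have "CA \<in> hausdorff_covers \<delta> A" "CB \<in> hausdorff_covers \<delta> B"
      using C \<open>0 < \<delta>\<close> by (auto simp: hausdorff_covers_def CA_def CB_def subset_iff) blast+
    then have "hausdorff_pre k \<delta> A + hausdorff_pre k \<delta> B
      \<le> (\<Sum>i. hausdorff_weight k (CA i)) + (\<Sum>i. hausdorff_weight k (CB i))"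
      by (intro add_mono hausdorff_pre_le)
    also have "\<dots> = (\<Sum>i. hausdorff_weight k (CA i) + hausdorff_weight k (CB i))"
      by (rule suminf_add) auto
    also have "\<dots> \<le> (\<Sum>i. hausdorff_weight k (C i))"
    proof (intro suminf_le)
      fix i
      have "C i \<inter> A = {} \<or> C i \<inter> B = {}"
      proof (rule ccontr)
        assume "\<not> ?thesis"
        then obtain x y where xy: "x \<in> C i" "x \<in> A" "y \<in> C i" "y \<in> B" by auto
        then have "dist x y \<le> diameter (C i)"
          using C by (intro diameter_bounded_bound) (auto simp: hausdorff_covers_def)
        also have "\<dots> \<le> \<delta>" using C by (auto simp: hausdorff_covers_def)
        finally show False using sep[OF xy(2,4)] \<open>\<delta> < e\<close> by simp
      qed
      then show "hausdorff_weight k (CA i) + hausdorff_weight k (CB i) \<le> hausdorff_weight k (C i)"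
        using k by (auto simp: CA_def CB_def zero_power)
    qed auto
    finally show "hausdorff_pre k \<delta> A + hausdorff_pre k \<delta> B \<le> (\<Sum>i. hausdorff_weight k (C i))" .
  qed
  \<comment> \<open>The two suprema run over independent scales. A common smaller scale below the
    gap reduces them to the case just shown.\<close>
  have any: "hausdorff_pre k \<delta> A + hausdorff_pre k \<delta>' B \<le> hausdorff_outer k (A \<union> B)"
    if "\<delta> > 0" "\<delta>' > 0" for \<delta> \<delta>'
  proof -
    let ?d = "min (min \<delta> \<delta>') (e / 2)"
    have d: "0 < ?d" "?d < e" using that e by auto
    have "hausdorff_pre k \<delta> A + hausdorff_pre k \<delta>' B \<le> hausdorff_pre k ?d A + hausdorff_pre k ?d B"
      by (intro add_mono hausdorff_pre_antimono) auto
    also have "\<dots> \<le> hausdorff_pre k ?d (A \<union> B)" using d by (rule small)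
    also have "\<dots> \<le> hausdorff_outer k (A \<union> B)" using d(1) by (rule hausdorff_pre_le_outer)
    finally show ?thesis .
  qed
  have ne: "{0<..} \<noteq> ({} :: real set)" by (auto intro: gt_ex)
  have "hausdorff_outer k A + hausdorff_outer k B
    = (SUP \<delta>\<in>{0<..}. hausdorff_pre k \<delta> A + hausdorff_outer k B)"
    unfolding hausdorff_outer_def[of k A] by (rule ennreal_SUP_add_left[OF ne, symmetric])
  also have "\<dots> \<le> hausdorff_outer k (A \<union> B)"
  proof (rule SUP_least)
    fix \<delta> :: real assume \<delta>: "\<delta> \<in> {0<..}"
    have "hausdorff_pre k \<delta> A + hausdorff_outer k B
      = (SUP \<delta>'\<in>{0<..}. hausdorff_pre k \<delta> A + hausdorff_pre k \<delta>' B)"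
      unfolding hausdorff_outer_def[of k B] by (rule ennreal_SUP_add_right[OF ne])
    also have "\<dots> \<le> hausdorff_outer k (A \<union> B)" using any \<delta> by (intro SUP_least) auto
    finally show "hausdorff_pre k \<delta> A + hausdorff_outer k B \<le> hausdorff_outer k (A \<union> B)" .
  qed
  finally show ?thesis .
qed


section \<open>Caratheodory measurability of closed sets\<close>

text \<open>Adjacent rings around a closed set may touch; only rings of equal parity are known to be
  apart. The resulting factor two is harmless for convergence.\<close>

lemma bounded_alternating_partial_sums:
  fixes a :: "nat \<Rightarrow> ennreal"
  assumes even: "\<And>n. (\<Sum>i<n. a (2 * i)) \<le> M" and odd: "\<And>n. (\<Sum>i<n. a (2 * i + 1)) \<le> M"
  shows "suminf a \<le> M + M"
proof -
  have "(\<Sum>i<n. a i) \<le> M + M" for n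
  proof -
    have "(\<Sum>i<2 * n. a i) = (\<Sum>i<n. a (2 * i)) + (\<Sum>i<n. a (2 * i + 1))"
      by (induction n) (auto simp: algebra_simps)
    moreover have "(\<Sum>i<n. a i) \<le> (\<Sum>i<2 * n. a i)" by (rule sum_mono2) auto
    ultimately show ?thesis using add_mono[OF even[of n] odd[of n]] by simp
  qed
  then show ?thesis by (intro suminf_le_const) auto
qed

lemma ennreal_suminf_tail_tendsto_0:
  fixes a :: "nat \<Rightarrow> ennreal"
  assumes "suminf a \<noteq> top"
  shows "(\<lambda>n. \<Sum>i. a (i + n)) \<longlonglongrightarrow> 0"
proof -
  define g where "g = (\<lambda>i. enn2real (a i))"
  have "a i < top" for i using ennreal_suminf_lessD[of a top i] assms by (simp add: less_top)
  then have a: "a = (\<lambda>i. ennreal (g i))" by (auto simp: g_def fun_eq_iff)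
  have g: "0 \<le> g i" for i by (simp add: g_def)
  have "summable g" using assms g unfolding a by (intro summable_suminf_not_top) auto
  then have "(\<Sum>i. a (i + n)) = ennreal (\<Sum>i. g (i + n))" for n
    unfolding a using g by (intro suminf_ennreal2) auto
  moreover have "(\<lambda>n. \<Sum>i. g (i + n)) \<longlonglongrightarrow> 0"
    by (rule suminf_exist_split2[OF \<open>summable g\<close>])
  then have "(\<lambda>n. ennreal (\<Sum>i. g (i + n))) \<longlonglongrightarrow> ennreal 0" by (rule tendsto_ennrealI)
  ultimately show ?thesis by simp
qed

text \<open>The rings \<open>R i\<close> below with indices of equal parity have positive distance from each other, so
  their outer measures add up to at most that of \<open>X\<close>.\<close>

lemma hausdorff_outer_closed_split:
  fixes S X :: "'a::metric_space set"
  assumes k: "k > 0" and S: "closed S"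
  shows "hausdorff_outer k (X \<inter> S) + hausdorff_outer k (X - S) \<le> hausdorff_outer k X"
\<comment> \<open>The empty \<open>S\<close> is split off because \<open>infdist\<close> to it is 0
  by convention. If \<open>X\<close> has infinite measure the bound is trivial; otherwise finiteness
  makes the series of ring measures converge.\<close>
proof (cases "S = {} \<or> hausdorff_outer k X = top")
  case True
  then show ?thesis by (auto simp: hausdorff_outer_empty[OF k])
next
  case False
  then have ne: "S \<noteq> {}" and fin: "hausdorff_outer k X \<noteq> top" by auto
  define Y where "Y = (\<lambda>n. {x \<in> X. 1 / real (Suc n) \<le> infdist x S})"
  define R where "R = (\<lambda>n. {x \<in> X. 1 / real (n + 2) \<le> infdist x S \<and> infdist x S < 1 / real (n + 1)})"
  have infdist_lip: "infdist x S \<le> infdist y S + dist x y" for x y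
    by (rule infdist_triangle)
  have step: "hausdorff_outer k (X \<inter> S) + hausdorff_outer k (Y n) \<le> hausdorff_outer k X" for n
  proof -
    have "1 / real (Suc n) \<le> dist x y" if "x \<in> X \<inter> S" "y \<in> Y n" for x y
      using that infdist_le[of x S y] by (auto simp: Y_def dist_commute)
    then have "hausdorff_outer k (X \<inter> S) + hausdorff_outer k (Y n)
      \<le> hausdorff_outer k ((X \<inter> S) \<union> Y n)"
      by (intro hausdorff_outer_separated[OF k, of "1 / real (Suc n)"]) auto
    also have "\<dots> \<le> hausdorff_outer k X" by (rule hausdorff_outer_mono) (auto simp: Y_def)
    finally show ?thesis .
  qed
  have rings: "(\<Sum>i<n. hausdorff_outer k (R (2 * i + p))) \<le> hausdorff_outer k (\<Union>i<n. R (2 * i + p))"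
    for n p
  proof (induction n)
    case 0 then show ?case by simp
  next
    case (Suc n)
    \<comment> \<open>Points of earlier rings have distance at least \<open>1 / (2 * n + p)\<close>
      from \<open>S\<close>, those of the new ring less than \<open>1 / (2 * n + p + 1)\<close>;
      \<open>e\<close> is the gap in between. For \<open>n = 0\<close> there is no earlier ring, and
      with \<open>p = 0\<close> the fraction would be \<open>1 / 0\<close>, whence the case
      split.\<close>
    define e where "e = 1 / real (2 * n + p) - 1 / real (2 * n + p + 1)"
    show ?case
    proof (cases "n = 0")
      case True then show ?thesis by (simp add: lessThan_Suc)
    next
      case False
      have "1 / real (2 * n + p + 1) < 1 / real (2 * n + p)"
        using False by (intro divide_strict_left_mono) auto
      then have "e > 0" by (simp add: e_def)
      have "e \<le> dist x y" if x: "x \<in> (\<Union>i<n. R (2 * i + p))" and y: "y \<in> R (2 * n + p)" for x y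
      proof -
        obtain i where i: "i < n" "1 / real (2 * i + p + 2) \<le> infdist x S" using x by (auto simp: R_def)
        have "1 / real (2 * n + p) \<le> 1 / real (2 * i + p + 2)"
          using i(1) by (intro divide_left_mono) auto
        moreover have "infdist y S < 1 / real (2 * n + p + 1)" using y by (auto simp: R_def)
        ultimately show ?thesis using i(2) infdist_lip[of x y] by (simp add: e_def)
      qed
      then have "hausdorff_outer k (\<Union>i<n. R (2 * i + p)) + hausdorff_outer k (R (2 * n + p))
        \<le> hausdorff_outer k ((\<Union>i<n. R (2 * i + p)) \<union> R (2 * n + p))"
        by (rule hausdorff_outer_separated[OF k \<open>e > 0\<close>])
      also have "(\<Union>i<n. R (2 * i + p)) \<union> R (2 * n + p) = (\<Union>i<Suc n. R (2 * i + p))"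
        by (simp add: lessThan_Suc Un_commute)
      finally have "hausdorff_outer k (\<Union>i<n. R (2 * i + p)) + hausdorff_outer k (R (2 * n + p))
        \<le> hausdorff_outer k (\<Union>i<Suc n. R (2 * i + p))" .
      from order_trans[OF add_right_mono[OF Suc.IH] this] show ?thesis by (simp add: add.commute)
    qed
  qed
  have "(\<Sum>i<n. hausdorff_outer k (R (2 * i + p))) \<le> hausdorff_outer k X" for n p
    using rings[of p n] hausdorff_outer_mono[of "\<Union>i<n. R (2 * i + p)" X k]
    by (rule order_trans) (auto simp: R_def)
  from this[of 0] this[of 1]
  have "(\<Sum>i. hausdorff_outer k (R i)) \<le> hausdorff_outer k X + hausdorff_outer k X"
    by (intro bounded_alternating_partial_sums) simp_all
  then have "(\<Sum>i. hausdorff_outer k (R i)) \<noteq> top"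
    using fin by (auto simp: top_unique)
  then have tail: "(\<lambda>n. \<Sum>i. hausdorff_outer k (R (i + n))) \<longlonglongrightarrow> 0"
    by (rule ennreal_suminf_tail_tendsto_0)
  \<comment> \<open>Closedness gives every point of \<open>X - S\<close> a positive distance from
    \<open>S\<close>; the least admissible \<open>m\<close> below then names its ring.\<close>
  have cover: "X - S \<subseteq> Y n \<union> (\<Union>i. R (i + n))" for n
  proof
    fix x assume x: "x \<in> X - S"
    then have pos: "infdist x S > 0"
      using S ne in_closed_iff_infdist_zero[OF S ne] infdist_nonneg[of x S] by fastforce
    show "x \<in> Y n \<union> (\<Union>i. R (i + n))"
    proof (cases "1 / real (Suc n) \<le> infdist x S")
      case True then show ?thesis using x by (auto simp: Y_def)
    next
      case False
      obtain m0 where "inverse (real (Suc m0)) < infdist x S" using reals_Archimedean[OF pos] by blast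
      moreover have "1 / real (m0 + 2) \<le> inverse (real (Suc m0))"
        by (simp add: inverse_eq_divide) (intro divide_left_mono; simp)
      ultimately have ex: "\<exists>m. 1 / real (m + 2) \<le> infdist x S"
        by (meson less_imp_le order_trans)
      define m where "m = (LEAST m. 1 / real (m + 2) \<le> infdist x S)"
      have m: "1 / real (m + 2) \<le> infdist x S" unfolding m_def by (rule LeastI_ex[OF ex])
      have up: "infdist x S < 1 / real (m + 1)"
      proof (cases m)
        case 0
        have "1 / real (Suc n) \<le> 1" by simp
        then have "infdist x S < 1" using False by linarith
        then show ?thesis using 0 by simp
      next
        case (Suc m')
        then have "\<not> 1 / real (m' + 2) \<le> infdist x S" unfolding m_def by (metis not_less_Least lessI)
        then show ?thesis using Suc by simp
      qed
      have "n \<le> m"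
      proof (rule ccontr)
        assume "\<not> n \<le> m"
        then have "1 / real (Suc n) \<le> 1 / real (m + 2)" by (intro divide_left_mono) auto
        then show False using m False by simp
      qed
      then have "x \<in> R ((m - n) + n)" using x m up by (auto simp: R_def)
      then show ?thesis by blast
    qed
  qed
  have le: "hausdorff_outer k (X \<inter> S) + hausdorff_outer k (X - S)
      \<le> hausdorff_outer k X + (\<Sum>i. hausdorff_outer k (R (i + n)))" for n
  proof -
    have "hausdorff_outer k (X - S) \<le> hausdorff_outer k (Y n \<union> (\<Union>i. R (i + n)))"
      by (rule hausdorff_outer_mono[OF cover])
    also have "\<dots> \<le> hausdorff_outer k (Y n) + hausdorff_outer k (\<Union>i. R (i + n))"
      by (rule hausdorff_outer_Un[OF k])
    also have "\<dots> \<le> hausdorff_outer k (Y n) + (\<Sum>i. hausdorff_outer k (R (i + n)))"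
      by (intro add_left_mono hausdorff_outer_countably_subadditive)
    finally have "hausdorff_outer k (X \<inter> S) + hausdorff_outer k (X - S)
      \<le> (hausdorff_outer k (X \<inter> S) + hausdorff_outer k (Y n)) + (\<Sum>i. hausdorff_outer k (R (i + n)))"
      by (simp add: add.assoc add_left_mono)
    also have "\<dots> \<le> hausdorff_outer k X + (\<Sum>i. hausdorff_outer k (R (i + n)))"
      by (intro add_right_mono step)
    finally show ?thesis .
  qed
  have "(\<lambda>n. hausdorff_outer k X + (\<Sum>i. hausdorff_outer k (R (i + n)))) \<longlonglongrightarrow> hausdorff_outer k X + 0"
    by (intro tendsto_add tendsto_const tail)
  then show ?thesis using le by (intro LIMSEQ_le_const) auto
qed

text \<open>By the splitting lemma and subadditivity, closed sets satisfy the Caratheodory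
  criterion. They generate the Borel sets, so these lie in \<open>lambda_system\<close>, on which an
  outer measure is countably additive.\<close>

lemma measure_space_hausdorff_outer:
  assumes k: "k > 0"
  shows "measure_space UNIV (sets borel) (hausdorff_outer k :: 'a::metric_space set \<Rightarrow> ennreal)"
proof -
  let ?H = "hausdorff_outer k :: 'a set \<Rightarrow> ennreal"
  let ?L = "lambda_system UNIV (Pow UNIV) ?H"
  have L: "measure_space UNIV ?L ?H"
    by (rule sigma_algebra.caratheodory_lemma[OF sigma_algebra_Pow outer_measure_space_hausdorff_outer[OF k]])
  then interpret L: sigma_algebra UNIV ?L by (simp add: measure_space_def)
  have "S \<in> ?L" if S: "closed S" for S :: "'a set"
  proof -
    have "?H (S \<inter> X) + ?H ((UNIV - S) \<inter> X) = ?H X" for X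
    proof (rule antisym)
      have eq: "(UNIV - S) \<inter> X = X - S" "S \<inter> X = X \<inter> S" by auto
      show "?H (S \<inter> X) + ?H ((UNIV - S) \<inter> X) \<le> ?H X"
        unfolding eq by (rule hausdorff_outer_closed_split[OF k S])
      have "?H X \<le> ?H ((S \<inter> X) \<union> ((UNIV - S) \<inter> X))" by (rule hausdorff_outer_mono) auto
      also have "\<dots> \<le> ?H (S \<inter> X) + ?H ((UNIV - S) \<inter> X)" by (rule hausdorff_outer_Un[OF k])
      finally show "?H X \<le> ?H (S \<inter> X) + ?H ((UNIV - S) \<inter> X)" .
    qed
    then show ?thesis by (simp add: lambda_system_def)
  qed
  then have sub: "sets borel \<subseteq> ?L"
    unfolding borel_eq_closed sets_measure_of[OF subset_UNIV[of "Collect closed", folded Pow_UNIV]]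
    by (intro L.sigma_sets_subset) blast
  have "countably_additive (sets borel) ?H"
    unfolding countably_additive_def
  proof (intro allI impI)
    fix A :: "nat \<Rightarrow> 'a set" assume A: "range A \<subseteq> sets borel" "disjoint_family A" "(\<Union>i. A i) \<in> sets borel"
    have "countably_additive ?L ?H" using L by (simp add: measure_space_def)
    then show "(\<Sum>i. ?H (A i)) = ?H (\<Union>i. A i)"
      unfolding countably_additive_def
      by (elim allE[of _ A] impE) (use A sub in \<open>blast intro: A(2)\<close>)+
  qed
  moreover have "sigma_algebra UNIV (sets (borel :: 'a measure))"
    using sets.sigma_algebra_axioms[of "borel :: 'a measure"] by simp
  ultimately show ?thesis
    using hausdorff_outer_empty[OF k] by (auto simp: measure_space_def positive_def)
qed

lemma space_surface_measure [simp]: "space surface_measure = UNIV"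
  by (simp add: surface_measure_def)

lemma borel_sets_surface_measure: "A \<in> sets borel \<Longrightarrow> A \<in> sets surface_measure"
  unfolding surface_measure_def
  by (intro sets_completionI_sets) (simp add: sets.sigma_sets_eq[of borel, simplified] )

lemma emeasure_surface_measure:
  fixes A :: "(real ^ 'n) set"
  assumes "CARD('n) \<ge> 2" "A \<in> sets borel"
  shows "emeasure surface_measure A = hausdorff_outer (CARD('n) - 1) A"
proof -
  have "measure_space UNIV (sets borel) (hausdorff_outer (CARD('n) - 1) :: (real ^ 'n) set \<Rightarrow> ennreal)"
    using assms(1) by (intro measure_space_hausdorff_outer) simp
  then have "emeasure (measure_of UNIV (sets borel) (hausdorff_outer (CARD('n) - 1))) A
      = hausdorff_outer (CARD('n) - 1) A"
    using assms(2) by (intro emeasure_measure_of_sigma) (auto simp: measure_space_def)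
  then show ?thesis
    using assms(2) unfolding surface_measure_def
    by (subst emeasure_completion) (simp_all add: sets.sigma_sets_eq[of borel, simplified])
qed

lemma null_sets_surface_measure_iff:
  fixes A :: "(real ^ 'n) set"
  assumes "CARD('n) \<ge> 2" "A \<in> sets borel"
  shows "A \<in> null_sets surface_measure \<longleftrightarrow> hausdorff_outer (CARD('n) - 1) A = 0"
  using assms by (simp add: null_sets_def emeasure_surface_measure borel_sets_surface_measure)

section \<open>Null sets and positive lower bounds\<close>

lemma hausdorff_outer_eq_0I:
  assumes "\<And>\<delta> e. \<delta> > 0 \<Longrightarrow> e > 0 \<Longrightarrow>
    \<exists>C. C \<in> hausdorff_covers \<delta> S \<and> (\<Sum>i. hausdorff_weight k (C i)) \<le> ennreal e"
  shows "hausdorff_outer k S = 0"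
proof -
  have "hausdorff_pre k \<delta> S = 0" if "\<delta> > 0" for \<delta>
  proof -
    have "hausdorff_pre k \<delta> S \<le> 0"
    proof (rule ennreal_le_epsilon)
      fix e :: real assume "e > 0"
      then obtain C where "C \<in> hausdorff_covers \<delta> S" "(\<Sum>i. hausdorff_weight k (C i)) \<le> ennreal e"
        using assms[OF \<open>\<delta> > 0\<close> \<open>e > 0\<close>] by (elim exE conjE)
      then show "hausdorff_pre k \<delta> S \<le> 0 + ennreal e"
        using order_trans[OF hausdorff_pre_le[of C \<delta> S k]] by simp
    qed
    then show ?thesis by simp
  qed
  then show ?thesis unfolding hausdorff_outer_def by (intro antisym SUP_least) auto
qed

lemma hausdorff_outer_singleton:
  assumes "k > 0" shows "hausdorff_outer k {a} = 0"
proof (rule hausdorff_outer_eq_0I, intro exI conjI)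
  fix \<delta> e :: real assume "\<delta> > 0" "e > 0"
  show "(\<lambda>_. {a}) \<in> hausdorff_covers \<delta> {a}" using \<open>\<delta> > 0\<close> by (auto simp: hausdorff_covers_def)
  show "(\<Sum>i. hausdorff_weight k {a}) \<le> ennreal e" using assms by (simp add: zero_power)
qed

text \<open>A subdivision into \<open>N\<close> equal pieces weighs at most a constant times
  \<open>N * (L / N) ^ 2\<close>, which tends to zero. In three dimensions this disposes of the
  edges of the elements.\<close>

lemma hausdorff_outer_closed_segment:
  fixes a b :: "'a::euclidean_space"
  assumes k: "k \<ge> 2" shows "hausdorff_outer k (closed_segment a b) = 0"
proof (rule hausdorff_outer_eq_0I)
  fix \<delta> e :: real assume \<delta>: "\<delta> > 0" and e: "e > 0"
  define L where "L = dist a b"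
  define c where "c = unit_ball_vol (real k)"
  have c: "c \<ge> 0" by (simp add: c_def)
  have lim: "(\<lambda>N. L * inverse (real N)) \<longlonglongrightarrow> L * 0"
    "(\<lambda>N. c * L ^ 2 * inverse (real N)) \<longlonglongrightarrow> c * L ^ 2 * 0"
    by (intro tendsto_mult tendsto_const lim_inverse_n)+
  have "\<forall>\<^sub>F N in sequentially. L * inverse (real N) < min \<delta> 1 \<and> c * L ^ 2 * inverse (real N) < e \<and> N > 0"
    using order_tendstoD(2)[OF lim(1), of "min \<delta> 1"] order_tendstoD(2)[OF lim(2), of e]
      eventually_gt_at_top[of 0] \<delta> e by (intro eventually_conj) auto
  \<comment> \<open>The bound by \<delta> makes the pieces admissible, the bound by 1 allows the
    exponent \<open>k\<close> to be lowered to 2, and the second condition is the final estimate of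
    the total weight.\<close>
  then obtain N where N: "L / real N < min \<delta> 1" "c * L ^ 2 / real N < e" "N > 0"
    by (auto simp: eventually_sequentially divide_inverse)
  define p where "p = (\<lambda>t. a + t *\<^sub>R (b - a))"
  define C where "C = (\<lambda>i. if i < N then p ` {real i / real N .. real (Suc i) / real N} else {})"
  have dist_p: "dist (p s) (p t) = L * \<bar>s - t\<bar>" for s t
  proof -
    have "p s - p t = (s - t) *\<^sub>R (b - a)" by (simp add: p_def algebra_simps)
    then show ?thesis by (simp add: dist_norm L_def norm_minus_commute)
  qed
  have diam: "diameter (C i) \<le> L / real N" "bounded (C i)" for i
  proof -
    have d: "dist x y \<le> L / real N" if "x \<in> C i" "y \<in> C i" for x y
    proof -
      from that obtain s t where st: "x = p s" "y = p t"
        "real i / real N \<le> s" "s \<le> real (Suc i) / real N" "real i / real N \<le> t" "t \<le> real (Suc i) / real N"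
        by (auto simp: C_def split: if_splits)
      have "\<bar>s - t\<bar> \<le> real (Suc i) / real N - real i / real N" using st by linarith
      also have "\<dots> = 1 / real N" using N(3) by (simp add: field_simps)
      finally show ?thesis
        unfolding st dist_p using mult_left_mono[of "\<bar>s - t\<bar>" "1 / real N" L] by (simp add: L_def)
    qed
    then show "diameter (C i) \<le> L / real N"
      using N(3) by (intro diameter_le) (auto simp: L_def dist_norm)
    show "bounded (C i)" using d unfolding bounded_two_points by blast
  qed
  have "C \<in> hausdorff_covers \<delta> (closed_segment a b)"
  proof -
    have "x \<in> (\<Union>i. C i)" if x: "x \<in> closed_segment a b" for x
    proof -
      obtain t where t': "x = (1 - t) *\<^sub>R a + t *\<^sub>R b" "0 \<le> t" "t \<le> 1"
        using x unfolding in_segment by blast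
      then have t: "x = p t" "0 \<le> t" "t \<le> 1" by (simp_all add: p_def algebra_simps)
      show ?thesis
      \<comment> \<open>At the end point the floor used below would be \<open>N\<close>, one past
        the last piece.\<close>
      proof (cases "t = 1")
        case True
        then have "x \<in> C (N - 1)" using N(3) t(1) unfolding C_def
          by (auto intro!: imageI simp: field_simps of_nat_diff)
        then show ?thesis by blast
      next
        case False
        define i where "i = nat \<lfloor>t * real N\<rfloor>"
        have i: "real i \<le> t * real N" "t * real N < real i + 1"
          using t(2) by (simp_all add: i_def)
        have "t * real N < 1 * real N" using t False N(3) by (intro mult_strict_right_mono) auto
        then have "i < N" using i by linarith
        then have "x \<in> C i" using i N(3) t(1) by (auto simp: C_def field_simps intro!: imageI)
        then show ?thesis by blast
      qed
    qed
    moreover have "diameter (C i) \<le> \<delta>" for i using diam(1)[of i] N(1) by simp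
    ultimately show ?thesis using diam(2) by (auto simp: hausdorff_covers_def)
  qed
  moreover have "(\<Sum>i. hausdorff_weight k (C i)) \<le> ennreal e"
  proof -
    have "(\<Sum>i. hausdorff_weight k (C i)) = (\<Sum>i<N. hausdorff_weight k (C i))"
      using k by (intro suminf_finite) (auto simp: C_def zero_power)
    also have "\<dots> \<le> (\<Sum>i<N. ennreal (c * (L / real N) ^ 2))"
    proof (rule sum_mono, rule ennreal_leI)
      fix i
      have "(diameter (C i) / 2) ^ k \<le> (L / real N) ^ k"
      proof (rule power_mono)
        show "diameter (C i) / 2 \<le> L / real N" "0 \<le> diameter (C i) / 2"
          using diam(1)[of i] diameter_ge_0[OF diam(2)[of i]] by linarith+
      qed
      also have "\<dots> \<le> (L / real N) ^ 2"
        using k N by (intro power_decreasing) (auto simp: L_def)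
      finally show "unit_ball_vol (real k) * (diameter (C i) / 2) ^ k \<le> c * (L / real N) ^ 2"
        using c by (simp add: c_def mult_left_mono)
    qed
    also have "\<dots> = ennreal (real N * (c * (L / real N) ^ 2))"
      using c by (simp add: ennreal_mult' flip: ennreal_of_nat_eq_real_of_nat)
    also have "real N * (c * (L / real N) ^ 2) = c * L ^ 2 / real N"
      using N(3) by (simp add: field_simps power2_eq_square)
    also have "ennreal \<dots> \<le> ennreal e" using N(2) by (intro ennreal_leI) simp
    finally show ?thesis .
  qed
  ultimately show "\<exists>C. C \<in> hausdorff_covers \<delta> (closed_segment a b) \<and> (\<Sum>i. hausdorff_weight k (C i)) \<le> ennreal e"
    by blast
qed

text \<open>A set of diameter \<open>r \<le> 1\<close>, thickened by a unit segment, is covered by about \<open>1 / r\<close> balls of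
  radius \<open>2 r\<close>. This bounds its Lebesgue measure by the Hausdorff weight one dimension lower, whatever
  the direction of the segment.\<close>

lemma thickening_cover:
  fixes C :: "'a::euclidean_space set" and e :: 'a
  assumes C: "bounded C" "diameter C \<le> 1" and e: "norm e = 1" and dim: "DIM('a) \<ge> 2"
  shows "\<exists>D\<in>sets lborel. {y + s *\<^sub>R e |y s. y \<in> C \<and> s \<in> {0..1}} \<subseteq> D \<and>
     emeasure lborel D \<le> ennreal (2 * unit_ball_vol DIM('a) * 2 ^ DIM('a) * diameter C ^ (DIM('a) - 1))"
proof (cases "C = {}")
  case True then show ?thesis by (intro bexI[of _ "{}"]) auto
next
  case False
  then obtain c where c: "c \<in> C" by auto
  define r where "r = diameter C"
  define d where "d = DIM('a)"
  have r: "0 \<le> r" "r \<le> 1" using C diameter_ge_0 by (auto simp: r_def)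
  have dist_c: "dist c y \<le> r" if "y \<in> C" for y
    unfolding r_def using C(1) c that by (rule diameter_bounded_bound)
  show ?thesis
  \<comment> \<open>A set of diameter zero is a point and its thickening a segment, negligible since
    the dimension is at least two. The general case divides by \<open>r\<close>.\<close>
  proof (cases "r = 0")
    case True
    let ?S = "closed_segment c (c + e)"
    have "{y + s *\<^sub>R e |y s. y \<in> C \<and> s \<in> {0..1}} \<subseteq> ?S"
    proof safe
      fix y s assume "y \<in> C" and s: "s \<in> {0..(1::real)}"
      then have "y = c" using dist_c[of y] True by simp
      then show "y + s *\<^sub>R e \<in> ?S"
        using s by (auto simp: closed_segment_def algebra_simps intro!: exI[of _ s])
    qed
    moreover have "negligible ?S"
      using dim by (simp add: negligible_convex_interior interior_closed_segment_ge2)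
    then have "emeasure lborel ?S = 0"
      by (simp add: negligible_iff_null_sets null_sets_def)
    ultimately show ?thesis by (intro bexI[of _ ?S]) auto
  next
    case False
    with r have rpos: "r > 0" by simp
    define N where "N = nat \<lfloor>1 / r\<rfloor>"
    have N: "real N \<le> 1 / r" "1 / r < real N + 1" using rpos by (simp_all add: N_def)
    \<comment> \<open>Rounding \<open>s\<close> down to a multiple of \<open>r\<close> moves a point
      by at most \<open>r\<close>, and replacing \<open>y\<close> by \<open>c\<close> by at most
      another \<open>r\<close>; hence the radius \<open>2 * r\<close>.\<close>
    define D where "D = (\<Union>j\<le>N. cball (c + (real j * r) *\<^sub>R e) (2 * r))"
    have "{y + s *\<^sub>R e |y s. y \<in> C \<and> s \<in> {0..1}} \<subseteq> D"
    proof safe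
      fix y s assume y: "y \<in> C" and s: "s \<in> {0..(1::real)}"
      define j where "j = nat \<lfloor>s / r\<rfloor>"
      have j: "real j \<le> s / r" "s / r < real j + 1" using s rpos by (simp_all add: j_def)
      have "s / r \<le> 1 / r" using s rpos by (simp add: divide_right_mono)
      then have "j \<le> N" unfolding j_def N_def by (intro nat_mono floor_mono)
      have "0 \<le> s - real j * r" "s - real j * r \<le> r"
        using j rpos by (auto simp: field_simps)
      then have "norm ((s - real j * r) *\<^sub>R e) \<le> r" using e by simp
      moreover have "norm (y - c) \<le> r" using dist_c[OF y] by (simp add: dist_norm norm_minus_commute)
      ultimately have "norm ((y - c) + (s - real j * r) *\<^sub>R e) \<le> r + r"
        using norm_triangle_mono by blast
      moreover have "y + s *\<^sub>R e - (c + (real j * r) *\<^sub>R e) = (y - c) + (s - real j * r) *\<^sub>R e"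
        by (simp add: algebra_simps)
      ultimately have "norm (y + s *\<^sub>R e - (c + (real j * r) *\<^sub>R e)) \<le> 2 * r" by (simp only: mult_2)
      then have "y + s *\<^sub>R e \<in> cball (c + (real j * r) *\<^sub>R e) (2 * r)"
        by (simp add: dist_norm norm_minus_commute)
      then show "y + s *\<^sub>R e \<in> D" using \<open>j \<le> N\<close> unfolding D_def by blast
    qed
    moreover have "emeasure lborel D \<le> ennreal (2 * unit_ball_vol d * 2 ^ d * r ^ (d - 1))"
    proof -
      have "emeasure lborel D \<le> (\<Sum>j\<le>N. emeasure lborel (cball (c + (real j * r) *\<^sub>R e) (2 * r)))"
        unfolding D_def by (intro emeasure_subadditive_finite) auto
      also have "\<dots> = (\<Sum>j\<le>N. ennreal (unit_ball_vol d * (2 * r) ^ d))"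
        using rpos by (simp add: emeasure_cball d_def)
      also have "\<dots> = ennreal (real (Suc N) * (unit_ball_vol d * (2 * r) ^ d))"
        using rpos by (simp add: ennreal_mult' flip: ennreal_of_nat_eq_real_of_nat)
      also have "real (Suc N) * (unit_ball_vol d * (2 * r) ^ d)
          \<le> (2 / r) * (unit_ball_vol d * (2 * r) ^ d)"
      proof (rule mult_right_mono)
        \<comment> \<open>Since \<open>r \<le> 1\<close>, the ball with index 0 is absorbed as well:
          \<open>N + 1 \<le> 2 / r\<close>.\<close>
        have "1 \<le> 1 / r" using rpos r by simp
        then show "real (Suc N) \<le> 2 / r" using N(1) by simp
      qed (use rpos in simp)
      also have "\<dots> = 2 * unit_ball_vol d * 2 ^ d * r ^ (d - 1)"
      proof -
        obtain m where "d = Suc m" using dim by (cases d) (auto simp: d_def)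
        then show ?thesis using rpos by (simp add: field_simps)
      qed
      finally show ?thesis by (simp add: ennreal_leI)
    qed
    ultimately show ?thesis unfolding d_def r_def by (intro bexI[of _ D]) (auto simp: D_def)
  qed
qed

text \<open>A cover of \<open>G\<close> by sets of diameter at most 1, thickened along
  \<open>e\<close>, covers \<open>W\<close>. So the weight of every such cover is at least a fixed
  multiple of the volume of \<open>W\<close>, and already \<open>hausdorff_pre\<close> at scale 1 is
  positive.\<close>

lemma hausdorff_outer_pos_of_thickening:
  fixes G :: "'a::euclidean_space set"
  assumes e: "norm e = 1" and dim: "DIM('a) \<ge> 2"
    and W: "open W" "W \<noteq> {}" "W \<subseteq> {y + s *\<^sub>R e |y s. y \<in> G \<and> s \<in> {0..1}}"
  shows "hausdorff_outer (DIM('a) - 1) G > 0"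
proof -
  define d where "d = DIM('a)"
  define c where "c = unit_ball_vol (real (d - 1))"
  define K where "K = 2 * unit_ball_vol d * 2 ^ d"
  have c: "c > 0" by (simp add: c_def)
  have K: "K > 0" by (simp add: K_def)
  \<comment> \<open>Converts \<open>K * diameter (C i) ^ (d - 1)\<close> into a multiple of the
    Hausdorff weight, whose normalisation carries \<open>c\<close> and halves the diameter.\<close>
  define K' where "K' = K * 2 ^ (d - 1) / c"
  have bound: "emeasure lborel W \<le> ennreal K' * (\<Sum>i. hausdorff_weight (d - 1) (C i))"
    if C: "C \<in> hausdorff_covers 1 G" for C
  proof -
    have "\<exists>D. D \<in> sets lborel \<and> {y + s *\<^sub>R e |y s. y \<in> C i \<and> s \<in> {0..1}} \<subseteq> D \<and>
       emeasure lborel D \<le> ennreal (K * diameter (C i) ^ (d - 1))" for i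
      unfolding K_def d_def
      using C e dim thickening_cover[of "C i" e] by (auto simp: hausdorff_covers_def)
    then have "\<exists>D. \<forall>i. D i \<in> sets lborel \<and> {y + s *\<^sub>R e |y s. y \<in> C i \<and> s \<in> {0..1}} \<subseteq> D i \<and>
       emeasure lborel (D i) \<le> ennreal (K * diameter (C i) ^ (d - 1))"
      by (intro choice allI)
    then obtain D where D: "\<And>i. D i \<in> sets lborel"
      "\<And>i. {y + s *\<^sub>R e |y s. y \<in> C i \<and> s \<in> {0..1}} \<subseteq> D i"
      "\<And>i. emeasure lborel (D i) \<le> ennreal (K * diameter (C i) ^ (d - 1))"
      by (elim exE) blast
    have "W \<subseteq> (\<Union>i. D i)"
    proof
      fix x assume "x \<in> W"
      then obtain y s where ys: "x = y + s *\<^sub>R e" "y \<in> G" "s \<in> {0..1}" using W(3) by blast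
      then obtain i where "y \<in> C i" using C unfolding hausdorff_covers_def by blast
      then show "x \<in> (\<Union>i. D i)" using D(2)[of i] ys by blast
    qed
    then have "emeasure lborel W \<le> emeasure lborel (\<Union>i. D i)"
      using D(1) by (intro emeasure_mono) auto
    also have "\<dots> \<le> (\<Sum>i. emeasure lborel (D i))"
      using D(1) by (intro emeasure_subadditive_countably) auto
    also have "\<dots> \<le> (\<Sum>i. ennreal K' * hausdorff_weight (d - 1) (C i))"
    proof (intro suminf_le)
      fix i
      have "0 \<le> diameter (C i)" using C by (intro diameter_ge_0) (auto simp: hausdorff_covers_def)
      moreover have "K' * (c * (diameter (C i) / 2) ^ (d - 1)) = K * diameter (C i) ^ (d - 1)"
        using c by (simp add: K'_def power_divide)
      ultimately have "ennreal K' * hausdorff_weight (d - 1) (C i) = ennreal (K * diameter (C i) ^ (d - 1))"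
        using c K unfolding c_def[symmetric] by (subst ennreal_mult[symmetric]) (auto simp: K'_def)
      then show "emeasure lborel (D i) \<le> ennreal K' * hausdorff_weight (d - 1) (C i)"
        using D(3)[of i] by simp
    qed auto
    finally show ?thesis by simp
  qed
  have "emeasure lborel W > 0"
  proof -
    have "\<not> negligible W" using W(1,2) open_not_negligible by blast
    then show ?thesis
      using W(1) by (auto simp: negligible_iff_null_sets null_sets_def zero_less_iff_neq_zero)
  qed
  show ?thesis
  proof (rule ccontr)
    assume "\<not> ?thesis"
    then have "hausdorff_pre (d - 1) 1 G = 0"
      using hausdorff_pre_le_outer[of 1 "d - 1" G] by (simp add: d_def)
    have "emeasure lborel W \<le> (INF C\<in>hausdorff_covers 1 G. ennreal K' * (\<Sum>i. hausdorff_weight (d - 1) (C i)))"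
      using bound by (rule INF_greatest)
    show False
    \<comment> \<open>The open set may be unbounded. An infinite volume is contradicted by any
      single cover of finite weight.\<close>
    proof (cases "emeasure lborel W = top")
      case True
      obtain C where "C \<in> hausdorff_covers 1 G" "(\<Sum>i. hausdorff_weight (d - 1) (C i)) < 1"
        using \<open>hausdorff_pre (d - 1) 1 G = 0\<close> zero_less_one[where 'a = ennreal]
        unfolding hausdorff_pre_eq by (metis (no_types, lifting) INF_less_iff)
      then show False using bound[of C] True by (auto simp: top_unique ennreal_mult_eq_top_iff)
    next
      case False
      then obtain m where m: "emeasure lborel W = ennreal m" "m > 0"
        using \<open>emeasure lborel W > 0\<close> by (cases "emeasure lborel W") auto
      have K': "K' > 0" using c K by (simp add: K'_def)
      then have "ennreal (m / K') > 0" using m by simp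
      then obtain C where C: "C \<in> hausdorff_covers 1 G" "(\<Sum>i. hausdorff_weight (d - 1) (C i)) < ennreal (m / K')"
        using \<open>hausdorff_pre (d - 1) 1 G = 0\<close>
        unfolding hausdorff_pre_eq by (metis (no_types, lifting) INF_less_iff)
      have "ennreal K' * (\<Sum>i. hausdorff_weight (d - 1) (C i)) < ennreal K' * ennreal (m / K')"
        using C(2) K' by (intro ennreal_mult_strict_left_mono) auto
      also have "\<dots> = ennreal m" using K' m by (simp flip: ennreal_mult)
      finally show False using bound[OF C(1)] m(1) by simp
    qed
  qed
qed

section \<open>Piecewise affine functions on a mesh\<close>

lemma P1_I: "(\<And>x. p x = c + a \<bullet> x) \<Longrightarrow> p \<in> P1"
  unfolding P1_def by blast

lemma P1_E:
  assumes "p \<in> P1" obtains c a where "p = (\<lambda>x. c + a \<bullet> x)"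
  using assms unfolding P1_def by blast

lemma P1_const: "(\<lambda>_. c) \<in> P1"
  by (rule P1_I[of _ c 0]) simp

lemma P1_inner: "(\<lambda>x. a \<bullet> x) \<in> P1"
  by (rule P1_I[of _ 0 a]) simp

lemma P1_add: assumes "p \<in> P1" "q \<in> P1" shows "(\<lambda>x. p x + q x) \<in> P1"
proof -
  from assms obtain c a c' a' where "p = (\<lambda>x. c + a \<bullet> x)" "q = (\<lambda>x. c' + a' \<bullet> x)"
    by (elim P1_E)
  then show ?thesis by (intro P1_I[of _ "c + c'" "a + a'"]) (simp add: inner_add_left)
qed

lemma P1_scale: assumes "p \<in> P1" shows "(\<lambda>x. k * p x) \<in> P1"
proof -
  from assms obtain c a where "p = (\<lambda>x. c + a \<bullet> x)" by (elim P1_E)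
  then show ?thesis by (intro P1_I[of _ "k * c" "k *\<^sub>R a"]) (simp add: algebra_simps)
qed

lemma P1_sum: "finite I \<Longrightarrow> (\<And>i. i \<in> I \<Longrightarrow> p i \<in> P1) \<Longrightarrow> (\<lambda>x. \<Sum>i\<in>I. p i x) \<in> P1"
  by (induction I rule: finite_induct) (auto intro: P1_const P1_add)

lemma P1_convex_comb:
  assumes "p \<in> P1" "u + v = 1" shows "p (u *\<^sub>R x + v *\<^sub>R y) = u * p x + v * p y"
proof -
  from assms obtain c a where p: "p = (\<lambda>x. c + a \<bullet> x)" by (elim P1_E)
  have "c = u * c + v * c" using assms(2) by (metis mult_1 ring_class.ring_distribs(2))
  then show ?thesis by (simp add: p inner_add_right algebra_simps)
qed

lemma continuous_on_P1: "p \<in> P1 \<Longrightarrow> continuous_on A p"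
  by (elim P1_E) (auto intro!: continuous_intros)

lemma P1_eq_on_hull:
  assumes "p \<in> P1" "q \<in> P1" "\<And>z. z \<in> C \<Longrightarrow> p z = q z" "x \<in> affine hull C"
  shows "p x = q x"
proof -
  have "affine {x. p x = q x}"
    unfolding affine_def using assms(1,2) by (auto simp: P1_convex_comb)
  then have "affine hull C \<subseteq> {x. p x = q x}" using assms(3) by (intro hull_minimal) auto
  then show ?thesis using assms(4) by blast
qed

lemma P1_nonneg_on_hull:
  assumes "p \<in> P1" "\<And>z. z \<in> C \<Longrightarrow> 0 \<le> p z" "x \<in> convex hull C"
  shows "0 \<le> p x"
proof -
  have "convex {x. 0 \<le> p x}"
    unfolding convex_def using assms(1) by (auto simp: P1_convex_comb)
  then have "convex hull C \<subseteq> {x. 0 \<le> p x}" using assms(2) by (intro hull_minimal) auto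
  then show ?thesis using assms(3) by blast
qed

text \<open>The differences from one point \<open>a\<close> are linearly independent, so a linear
  map \<open>g\<close> can take prescribed values on them; the adjoint of \<open>g\<close> at 1 is
  its gradient.\<close>

lemma P1_interpolation:
  fixes C :: "(real ^ 'n) set"
  assumes "\<not> affine_dependent C"
  shows "\<exists>p\<in>P1. \<forall>z\<in>C. p z = val z"
proof (cases "C = {}")
  case True then show ?thesis using P1_const by auto
next
  case False
  then obtain a where a: "a \<in> C" by auto
  let ?D = "(\<lambda>x. - a + x) ` (C - {a})"
  have "independent ?D" using assms affine_dependent_iff_dependent2[OF a] by simp
  from linear_independent_extend[OF this, of "\<lambda>y. val (a + y) - val a"]
  obtain g where g: "linear g" "\<And>y. y \<in> ?D \<Longrightarrow> g y = val (a + y) - val a" by blast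
  define w where "w = adjoint g 1"
  have gw: "g y = w \<bullet> y" for y
    using adjoint_works[OF g(1), of y 1] by (simp add: w_def inner_commute)
  show ?thesis
  proof (intro bexI[of _ "\<lambda>x. (val a - w \<bullet> a) + w \<bullet> x"] ballI)
    fix z assume z: "z \<in> C"
    show "val a - w \<bullet> a + w \<bullet> z = val z"
    proof (cases "z = a")
      case False
      then have "- a + z \<in> ?D" using z by blast
      then have "w \<bullet> (- a + z) = val z - val a" using g(2) gw by force
      then show ?thesis by (simp add: inner_diff_right)
    qed simp
  qed (rule P1_I, rule refl)
qed

section \<open>Barycentric coordinates of a simplex\<close>

definition corners :: "(real ^ 'n) set \<Rightarrow> (real ^ 'n) set" where
  "corners T = {z. z extreme_point_of T}"

locale full_simplex =
  fixes T :: "(real ^ 'n) set"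
  assumes simplex: "int CARD('n) simplex T"
begin

lemma corners_props:
  shows "finite (corners T)" "\<not> affine_dependent (corners T)" "card (corners T) = Suc CARD('n)"
    "convex hull (corners T) = T" "affine hull (corners T) = UNIV"
proof -
  obtain C where C: "\<not> affine_dependent C" "int (card C) = int CARD('n) + 1" "T = convex hull C"
    using simplex unfolding simplex_def by blast
  have "corners T = C"
    unfolding corners_def C(3) using extreme_point_of_convex_hull_affine_independent[OF C(1)] by simp
  moreover have "finite C" using C(1) by (rule aff_independent_finite)
  moreover have "card C = Suc CARD('n)" using C(2) by simp
  moreover have "affine hull C = UNIV"
    using C(1) \<open>card C = Suc CARD('n)\<close> by (intro affine_independent_span_eq) auto
  ultimately show "finite (corners T)" "\<not> affine_dependent (corners T)" "card (corners T) = Suc CARD('n)"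
    "convex hull (corners T) = T" "affine hull (corners T) = UNIV"
    using C by auto
qed

lemma compact: "compact T" and convex: "convex T" and closed: "closed T"
  using corners_props by (metis compact_convex_hull finite_imp_compact,
      metis convex_convex_hull, metis compact_convex_hull finite_imp_compact compact_imp_closed)

lemma corners_subset: "corners T \<subseteq> T"
  using corners_props(4) hull_subset by metis

lemma nonempty_interior: "interior T \<noteq> {}"
proof -
  have ne: "T \<noteq> {}" using corners_props(3) corners_subset by auto
  have "affine hull T = UNIV" using corners_props(4,5) affine_hull_convex_hull by metis
  then have "rel_interior T = interior T" by (rule rel_interior_interior)
  then show ?thesis using ne convex by (simp add: rel_interior_eq_empty flip: \<open>rel_interior T = interior T\<close>)
qed

text \<open>The barycentric coordinate of the corner \<open>c\<close>, taken as an affine function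
  on the whole space so that its sign also describes points outside \<open>T\<close>. The choice is
  unambiguous because the corners affinely span the space.\<close>

definition bary :: "real ^ 'n \<Rightarrow> real ^ 'n \<Rightarrow> real" where
  "bary c = (SOME p. p \<in> P1 \<and> (\<forall>z\<in>corners T. p z = (if z = c then 1 else 0)))"

lemma bary_P1: "bary c \<in> P1"
  and bary_corner: "z \<in> corners T \<Longrightarrow> bary c z = (if z = c then 1 else 0)"
proof -
  have "\<exists>p. p \<in> P1 \<and> (\<forall>z\<in>corners T. p z = (if z = c then 1 else 0))"
    using P1_interpolation[OF corners_props(2), of "\<lambda>z. if z = c then 1 else 0"] by blast
  from someI_ex[OF this] show "bary c \<in> P1" "z \<in> corners T \<Longrightarrow> bary c z = (if z = c then 1 else 0)"
    unfolding bary_def by blast+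
qed

text \<open>Both sides are affine and agree at the corners. Constants and linear functions in place
  of \<open>p\<close> give the two standard identities that follow.\<close>

lemma P1_bary_expansion: "p \<in> P1 \<Longrightarrow> p x = (\<Sum>c\<in>corners T. p c * bary c x)"
proof (rule P1_eq_on_hull[of p _ "corners T"])
  show "(\<lambda>x. \<Sum>c\<in>corners T. p c * bary c x) \<in> P1"
    by (intro P1_sum corners_props P1_scale bary_P1)
  show "p z = (\<Sum>c\<in>corners T. p c * bary c z)" if "z \<in> corners T" for z
    using that corners_props(1) by (simp add: bary_corner if_distrib[of "(*) _"] cong: if_cong)
qed (simp_all add: corners_props(5))

lemma bary_sum: "(\<Sum>c\<in>corners T. bary c x) = 1"
  using P1_bary_expansion[OF P1_const[of 1], of x] by simp

lemma bary_combination: "(\<Sum>c\<in>corners T. bary c x *\<^sub>R c) = x"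
proof (rule vector_eq_ldot[THEN iffD1, rule_format])
  fix a
  have "a \<bullet> (\<Sum>c\<in>corners T. bary c x *\<^sub>R c) = (\<Sum>c\<in>corners T. (a \<bullet> c) * bary c x)"
    by (simp add: inner_sum_right mult.commute)
  then show "a \<bullet> (\<Sum>c\<in>corners T. bary c x *\<^sub>R c) = a \<bullet> x"
    using P1_bary_expansion[OF P1_inner[of a], of x] by simp
qed

lemma in_simplex_iff: "x \<in> T \<longleftrightarrow> (\<forall>c\<in>corners T. 0 \<le> bary c x)"
proof
  assume "x \<in> T"
  then show "\<forall>c\<in>corners T. 0 \<le> bary c x"
    using P1_nonneg_on_hull[OF bary_P1, of "corners T" _ x] corners_props(4) by (auto simp: bary_corner)
next
  assume "\<forall>c\<in>corners T. 0 \<le> bary c x"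
  then have "x \<in> convex hull (corners T)"
    unfolding convex_hull_finite[OF corners_props(1)]
    by (auto intro!: exI[of _ "\<lambda>c. bary c x"] bary_sum bary_combination)
  then show "x \<in> T" using corners_props(4) by simp
qed

lemma in_interior: "(\<And>c. c \<in> corners T \<Longrightarrow> 0 < bary c x) \<Longrightarrow> x \<in> interior T"
proof (rule interiorI[of "\<Inter>c\<in>corners T. {x. 0 < bary c x}"])
  show "open (\<Inter>c\<in>corners T. {x. 0 < bary c x})"
    using corners_props(1) by (intro open_INT ballI open_Collect_less continuous_on_P1 bary_P1 P1_const)
  show "(\<Inter>c\<in>corners T. {x. 0 < bary c x}) \<subseteq> T"
    using in_simplex_iff by (auto intro: less_imp_le)
qed auto

text \<open>Dropping the vanishing weights leaves a convex combination of the other corners; for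
  distinct \<open>c\<close> and \<open>c'\<close> that is a point of a face of codimension
  two.\<close>

lemma in_hull_of_zero_bary:
  assumes "x \<in> T" "c \<in> corners T" "c' \<in> corners T" "bary c x = 0" "bary c' x = 0"
  shows "x \<in> convex hull (corners T - {c, c'})"
proof -
  let ?C = "corners T - {c, c'}"
  have fin: "finite ?C" using corners_props(1) by simp
  have "(\<Sum>d\<in>?C. bary d x) = (\<Sum>d\<in>corners T. bary d x)"
    "(\<Sum>d\<in>?C. bary d x *\<^sub>R d) = (\<Sum>d\<in>corners T. bary d x *\<^sub>R d)"
    using assms by (intro sum.mono_neutral_left corners_props; auto)+
  then show ?thesis
    unfolding convex_hull_finite[OF fin] using assms(1) in_simplex_iff
    by (auto intro!: exI[of _ "\<lambda>d. bary d x"] simp: bary_sum bary_combination)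
qed

text \<open>Off the faces of codimension two exactly one barycentric coordinate vanishes at a
  boundary point. The others stay positive nearby, so locally \<open>T\<close> is cut out by a
  single affine inequality, whose normalised gradient is \<open>a\<close>.\<close>

lemma frontier_is_halfspace:
  assumes x: "x \<in> T" "x \<notin> interior T"
    and regular: "\<And>c c'. c \<in> corners T \<Longrightarrow> c' \<in> corners T \<Longrightarrow> c \<noteq> c' \<Longrightarrow>
      x \<notin> convex hull (corners T - {c, c'})"
  shows "\<exists>a e. norm a = 1 \<and> e > 0 \<and> (\<forall>y\<in>ball x e. y \<in> T \<longleftrightarrow> 0 \<le> a \<bullet> (y - x))"
proof -
  obtain c where c: "c \<in> corners T" "bary c x = 0"
    using in_interior[of x] x in_simplex_iff by (metis order_le_less)
  obtain k a where ka: "bary c = (\<lambda>y. k + a \<bullet> y)" using bary_P1 by (rule P1_E)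
  have bc: "bary c y = a \<bullet> (y - x)" for y
    using c(2) by (simp add: ka inner_diff_right)
  have "a \<noteq> 0" using bary_corner[OF c(1), of c] bc[of c] by auto
  have pos: "0 < bary d x" if "d \<in> corners T" "d \<noteq> c" for d
  proof -
    have "bary d x \<noteq> 0"
      using regular[OF that(1) c(1) that(2)] in_hull_of_zero_bary[OF x(1) that(1) c(1) _ c(2)] by blast
    moreover have "0 \<le> bary d x" using x(1) in_simplex_iff that(1) by blast
    ultimately show ?thesis by simp
  qed
  have "open (\<Inter>d\<in>corners T - {c}. {x. 0 < bary d x})"
    using corners_props(1) by (intro open_INT ballI open_Collect_less continuous_on_P1 bary_P1 P1_const) auto
  moreover have "x \<in> (\<Inter>d\<in>corners T - {c}. {x. 0 < bary d x})" using pos by auto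
  ultimately obtain e where e: "e > 0" "ball x e \<subseteq> (\<Inter>d\<in>corners T - {c}. {x. 0 < bary d x})"
    by (rule openE)
  have "y \<in> T \<longleftrightarrow> 0 \<le> (a /\<^sub>R norm a) \<bullet> (y - x)" if y: "y \<in> ball x e" for y
  proof -
    have "0 < bary d y" if "d \<in> corners T" "d \<noteq> c" for d using e(2) y that by blast
    then have "0 \<le> bary d y" if "0 \<le> bary c y" "d \<in> corners T" for d
      using that by (cases "d = c") (auto intro: less_imp_le)
    then have "y \<in> T \<longleftrightarrow> 0 \<le> bary c y" using in_simplex_iff c(1) by blast
    then show ?thesis using \<open>a \<noteq> 0\<close> by (simp add: bc zero_le_mult_iff)
  qed
  moreover have "norm (a /\<^sub>R norm a) = 1" using \<open>a \<noteq> 0\<close> by simp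
  ultimately show ?thesis using e(1) by blast
qed

end

section \<open>Piecewise affine functions and their element gradients\<close>

definition pw_affine :: "(real ^ 'n) set set \<Rightarrow> (real ^ 'n \<Rightarrow> real) \<Rightarrow> bool" where
  "pw_affine M v \<longleftrightarrow> (\<forall>T\<in>M. \<exists>p\<in>P1. \<forall>x\<in>T. v x = p x)"

lemma pw_affine_add: "pw_affine M u \<Longrightarrow> pw_affine M v \<Longrightarrow> pw_affine M (\<lambda>x. u x + v x)"
  unfolding pw_affine_def
proof (intro ballI)
  fix T assume T: "T \<in> M"
    and "\<forall>T\<in>M. \<exists>p\<in>P1. \<forall>x\<in>T. u x = p x" "\<forall>T\<in>M. \<exists>p\<in>P1. \<forall>x\<in>T. v x = p x"
  then obtain p q where "p \<in> P1" "q \<in> P1" "\<forall>x\<in>T. u x = p x" "\<forall>x\<in>T. v x = q x" by blast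
  then show "\<exists>p\<in>P1. \<forall>x\<in>T. u x + v x = p x" by (intro bexI[of _ "\<lambda>x. p x + q x"] P1_add) auto
qed

lemma pw_affine_scale: "pw_affine M u \<Longrightarrow> pw_affine M (\<lambda>x. k * u x)"
  unfolding pw_affine_def
proof
  fix T assume T: "T \<in> M" and "\<forall>T\<in>M. \<exists>p\<in>P1. \<forall>x\<in>T. u x = p x"
  then obtain p where "p \<in> P1" "\<forall>x\<in>T. u x = p x" by blast
  then show "\<exists>p\<in>P1. \<forall>x\<in>T. k * u x = p x" by (intro bexI[of _ "\<lambda>x. k * p x"] P1_scale) auto
qed

lemma pw_affine_0: "pw_affine M (\<lambda>_. 0)"
  unfolding pw_affine_def by (intro ballI bexI[of _ "\<lambda>_. 0"] P1_const refl)

text \<open>The choice is unambiguous on a mesh element, which has interior points. Being attached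
  to the closed element, it also describes one side of a face, where \<open>grad\<close> need
  not.\<close>

definition elem_grad :: "(real ^ 'n \<Rightarrow> real) \<Rightarrow> (real ^ 'n) set \<Rightarrow> real ^ 'n" where
  "elem_grad v T = (SOME a. \<exists>c. \<forall>x\<in>T. v x = c + a \<bullet> x)"

lemma GDERIV_affine:
  assumes "\<And>y. y \<in> T \<Longrightarrow> v y = c + a \<bullet> y" "x \<in> interior T" shows "GDERIV v x :> a"
proof -
  have "((\<lambda>y. c + a \<bullet> y) has_derivative (\<lambda>h. h \<bullet> a)) (at x)"
    by (auto intro!: derivative_eq_intros simp: inner_commute)
  then show ?thesis unfolding gderiv_def
    by (rule has_derivative_transform_within_open[OF _ open_interior assms(2)])
      (use assms(1) interior_subset in force)
qed

lemma GDERIV_unique: "GDERIV v x :> a \<Longrightarrow> GDERIV v x :> b \<Longrightarrow> a = b"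
  unfolding gderiv_def
  by (metis (no_types, lifting) has_derivative_unique inner_commute vector_eq_ldot)

locale mesh =
  fixes S :: "(real ^ 'n) set" and M :: "(real ^ 'n) set set"
  assumes open_domain: "open S" and mesh: "mesh_of S M"
begin

lemma finite_mesh: "finite M" and Union_mesh: "\<Union>M = closure S"
  using mesh by (auto simp: mesh_of_def triangulation_def)

lemma full_simplex: "T \<in> M \<Longrightarrow> full_simplex T"
  using mesh by (auto simp: mesh_of_def full_simplex_def)

lemma face_Int: "T \<in> M \<Longrightarrow> T' \<in> M \<Longrightarrow> (T \<inter> T') face_of T"
  using mesh by (auto simp: mesh_of_def triangulation_def)

lemma subset_closure: "T \<in> M \<Longrightarrow> T \<subseteq> closure S" using Union_mesh by blast

lemma compact_closure_domain: "compact (closure S)"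
  unfolding Union_mesh[symmetric] using finite_mesh full_simplex.compact[OF full_simplex]
  by (intro compact_Union) auto

text \<open>A face that meets the interior is everything; this applies to the common face from both
  sides.\<close>

lemma interior_inject:
  assumes "T \<in> M" "T' \<in> M" "interior T \<inter> interior T' \<noteq> {}" shows "T = T'"
proof -
  have "interior T \<inter> interior T' \<subseteq> T \<inter> T'" using interior_subset by blast
  then have "(T \<inter> T') \<inter> interior T \<noteq> {}" "(T' \<inter> T) \<inter> interior T' \<noteq> {}" using assms(3) by blast+
  then have "T \<inter> T' = T" "T' \<inter> T = T'"
    using face_of_disjoint_interior face_Int assms(1,2) by metis+
  then show ?thesis by blast
qed

text \<open>Omitting two corners leaves a face of codimension two: a vertex in the plane, an edge in
  space.\<close>

definition skeleton :: "(real ^ 'n) set" where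
  "skeleton = (\<Union>T\<in>M. \<Union>c\<in>corners T. \<Union>c'\<in>corners T - {c}. convex hull (corners T - {c, c'}))"

text \<open>With \<open>CARD('n) - 1\<close> corners left, the pieces are single points in dimension
  two and segments in dimension three.\<close>

lemma skeleton_null:
  assumes dim: "CARD('n) \<in> {2, 3}"
  shows "skeleton \<in> null_sets surface_measure"
proof -
  have null: "convex hull (corners T - {c, c'}) \<in> null_sets surface_measure"
    if T: "T \<in> M" and c: "c \<in> corners T" "c' \<in> corners T - {c}" for T c c'
  proof -
    interpret full_simplex T using T by (rule full_simplex)
    let ?C = "corners T - {c, c'}"
    have fin: "finite ?C" and card: "card ?C = CARD('n) - 1"
      using corners_props(1,3) c by (auto simp: card_Diff_subset)
    have "hausdorff_outer (CARD('n) - 1) (convex hull ?C) = 0"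
    proof (cases "CARD('n) = 2")
      case True
      then obtain a where "?C = {a}" using card by (auto simp: card_1_singleton_iff)
      then have "convex hull ?C = {a}" by simp
      then show ?thesis using True by (simp only: hausdorff_outer_singleton)
    next
      case False
      with dim have 3: "CARD('n) = 3" by simp
      then obtain a b where "?C = {a, b}" using card by (auto simp: card_2_iff)
      then have "convex hull ?C = closed_segment a b" by (simp only: segment_convex_hull)
      then show ?thesis using 3 by (simp only: hausdorff_outer_closed_segment)
    qed
    moreover have "compact (convex hull ?C)"
      using fin by (intro compact_convex_hull finite_imp_compact)
    ultimately show ?thesis
      using dim by (subst null_sets_surface_measure_iff) (auto intro: borel_compact)
  qed
  show ?thesis
    unfolding skeleton_def
    by (intro null_sets_UN' countable_finite null ballI)
      (auto simp: finite_mesh full_simplex.corners_props(1)[OF full_simplex])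
qed

text \<open>Two elements through \<open>x\<close> are local half-spaces with inward normals
  \<open>a\<close> and \<open>b\<close>. Opposite half-spaces would fill a ball and make
  \<open>x\<close> interior to the closure; otherwise \<open>a + b\<close> points into both, and
  their interiors overlap.\<close>

lemma unique_element:
  assumes x: "x \<in> closure S" "x \<notin> interior (closure S)" "x \<notin> skeleton"
  shows "\<exists>!T. T \<in> M \<and> x \<in> T"
proof -
  have half: "\<exists>a e. norm a = 1 \<and> e > 0 \<and> (\<forall>y\<in>ball x e. y \<in> T \<longleftrightarrow> 0 \<le> a \<bullet> (y - x))"
    if T: "T \<in> M" "x \<in> T" for T
  proof (rule full_simplex.frontier_is_halfspace[OF full_simplex[OF T(1)] T(2)])
    show "x \<notin> interior T" using x(2) interior_mono[OF subset_closure[OF T(1)]] by blast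
    show "x \<notin> convex hull (corners T - {c, c'})"
      if "c \<in> corners T" "c' \<in> corners T" "c \<noteq> c'" for c c'
      using x(3) T(1) that unfolding skeleton_def by blast
  qed
  have "T = T'" if T: "T \<in> M" "x \<in> T" "T' \<in> M" "x \<in> T'" for T T'
  proof (rule ccontr)
    assume "T \<noteq> T'"
    obtain a e where a: "norm a = 1" "e > 0" "\<And>y. y \<in> ball x e \<Longrightarrow> y \<in> T \<longleftrightarrow> 0 \<le> a \<bullet> (y - x)"
      using half[OF T(1,2)] by blast
    obtain b e' where b: "norm b = 1" "e' > 0" "\<And>y. y \<in> ball x e' \<Longrightarrow> y \<in> T' \<longleftrightarrow> 0 \<le> b \<bullet> (y - x)"
      using half[OF T(3,4)] by blast
    show False
    proof (cases "a + b = 0")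
      case True
      then have ba: "b = - a" by (simp add: add_eq_0_iff)
      have "ball x (min e e') \<subseteq> T \<union> T'"
      proof
        fix y assume "y \<in> ball x (min e e')"
        then show "y \<in> T \<union> T'" using a(3)[of y] b(3)[of y] ba by auto
      qed
      then have "ball x (min e e') \<subseteq> closure S" using subset_closure T by blast
      then have "x \<in> interior (closure S)" using a(2) b(2) unfolding mem_interior by (metis min_less_iff_conj)
      then show False using x(2) by simp
    next
      case False
      define d where "d = a + b"
      have ab: "(norm d)\<^sup>2 = 2 * (1 + a \<bullet> b)"
        using a(1) b(1) by (simp add: d_def power2_norm_eq_inner inner_add_left inner_add_right
            inner_commute norm_eq_1)
      have "0 < (norm d)\<^sup>2" using False by (simp add: d_def)
      then have "0 < 1 + a \<bullet> b" unfolding ab by simp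
      then have ad: "0 < a \<bullet> d" "0 < b \<bullet> d"
        using a(1) b(1) by (simp_all add: d_def inner_add_right norm_eq_1 inner_commute add.commute)
      define O1 where "O1 = ball x (min e e') \<inter> {y. 0 < a \<bullet> (y - x)} \<inter> {y. 0 < b \<bullet> (y - x)}"
      have "open O1" unfolding O1_def
        by (intro open_Int open_ball open_Collect_less continuous_intros)
      moreover have "O1 \<subseteq> T" "O1 \<subseteq> T'" using a(3) b(3) by (auto simp: O1_def)
      ultimately have "O1 \<subseteq> interior T \<inter> interior T'" by (simp add: interior_maximal)
      moreover have "O1 \<noteq> {}"
      proof -
        define t where "t = min e e' / (2 * norm d)"
        have t: "t > 0" "t * norm d < min e e'" using a(2) b(2) False by (auto simp: t_def d_def)
        then have "x + t *\<^sub>R d \<in> O1" using ad by (auto simp: O1_def dist_norm)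
        then show ?thesis by blast
      qed
      ultimately show False using interior_inject[OF T(1,3)] \<open>T \<noteq> T'\<close> by blast
    qed
  qed
  moreover have "\<exists>T. T \<in> M \<and> x \<in> T" using x(1) Union_mesh by blast
  ultimately show ?thesis by blast
qed

lemma continuous_on_pw_affine:
  assumes "pw_affine M v" shows "continuous_on (closure S) v"
  unfolding Union_mesh[symmetric]
proof (rule continuous_on_closed_Union[of M "\<lambda>T. T", simplified])
  show "finite M" by (rule finite_mesh)
  show "closed T" if "T \<in> M" for T using full_simplex.closed[OF full_simplex[OF that]] .
  show "continuous_on T v" if T: "T \<in> M" for T
  proof -
    obtain p where "p \<in> P1" "\<And>x. x \<in> T \<Longrightarrow> v x = p x" using assms T unfolding pw_affine_def by blast
    then show ?thesis using continuous_on_P1[of p T] by (metis continuous_on_cong)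
  qed
qed

lemma elem_grad:
  assumes v: "pw_affine M v" and T: "T \<in> M"
  obtains c where "\<And>x. x \<in> T \<Longrightarrow> v x = c + elem_grad v T \<bullet> x"
proof -
  have "\<exists>a c. \<forall>x\<in>T. v x = c + a \<bullet> x" using v T unfolding pw_affine_def P1_def by fastforce
  from someI_ex[OF this] show ?thesis unfolding elem_grad_def[symmetric] using that by blast
qed

lemma GDERIV_elem_grad:
  assumes "pw_affine M v" "T \<in> M" "x \<in> interior T" shows "GDERIV v x :> elem_grad v T"
  using elem_grad[OF assms(1,2)] GDERIV_affine[OF _ assms(3)] by metis

lemma grad_interior:
  assumes "pw_affine M v" "T \<in> M" "x \<in> interior T" shows "grad v x = elem_grad v T"
  using GDERIV_elem_grad[OF assms] GDERIV_unique unfolding grad_def by (auto intro!: the_equality)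

lemma elem_grad_eqI:
  assumes "T \<in> M" "pw_affine M v" "\<And>x. x \<in> interior T \<Longrightarrow> GDERIV v x :> a" shows "elem_grad v T = a"
  using full_simplex.nonempty_interior[OF full_simplex[OF assms(1)]] GDERIV_unique assms
    GDERIV_elem_grad by (metis ex_in_conv)

lemma elem_grad_add:
  assumes "pw_affine M u" "pw_affine M v" "T \<in> M"
  shows "elem_grad (\<lambda>x. u x + v x) T = elem_grad u T + elem_grad v T"
  using assms by (intro elem_grad_eqI GDERIV_add GDERIV_elem_grad pw_affine_add)

lemma elem_grad_scale:
  assumes "pw_affine M u" "T \<in> M"
  shows "elem_grad (\<lambda>x. k * u x) T = k *\<^sub>R elem_grad u T"
  using assms
  by (intro elem_grad_eqI pw_affine_scale)
    (auto intro!: GDERIV_subst[OF GDERIV_mult[OF GDERIV_const GDERIV_elem_grad]])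

section \<open>The nodal basis\<close>

lemma finite_vertices: "finite (vertices M)"
proof -
  have "vertices M = (\<Union>T\<in>M. corners T)" by (auto simp: vertices_def corners_def)
  then show ?thesis using finite_mesh full_simplex.corners_props(1)[OF full_simplex] by simp
qed

lemma corners_subset_vertices: "T \<in> M \<Longrightarrow> corners T \<subseteq> vertices M"
  by (auto simp: vertices_def corners_def)

lemma pw_affine_eqI:
  assumes "pw_affine M u" "pw_affine M v" "\<And>z. z \<in> vertices M \<Longrightarrow> u z = v z" "x \<in> closure S"
  shows "u x = v x"
proof -
  obtain T where T: "T \<in> M" "x \<in> T" using assms(4) Union_mesh by blast
  interpret full_simplex T using T(1) by (rule full_simplex)
  obtain p where p: "p \<in> P1" "\<And>y. y \<in> T \<Longrightarrow> u y = p y"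
    using assms(1) T(1) unfolding pw_affine_def by blast
  obtain q where q: "q \<in> P1" "\<And>y. y \<in> T \<Longrightarrow> v y = q y"
    using assms(2) T(1) unfolding pw_affine_def by blast
  note pq = p(1) q(1) p(2) q(2)
  have "p x = q x"
  proof (rule P1_eq_on_hull[OF p(1) q(1), of "corners T"])
    fix z assume "z \<in> corners T"
    then have "z \<in> T" "z \<in> vertices M" using corners_subset corners_subset_vertices[OF T(1)] by blast+
    then show "p z = q z" using assms(3)[of z] p(2)[of z] q(2)[of z] by simp
  qed (simp add: corners_props(5))
  then show ?thesis using pq T by simp
qed

text \<open>Interpolants on neighbouring elements agree on the common face: by Krein-Milman it is
  the hull of its extreme points, and these are corners of both elements. So the arbitrary choice of
  an element in \<open>v\<close> does no harm.\<close>

lemma pw_affine_interpolation: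
  "\<exists>v. pw_affine M v \<and> (\<forall>x. x \<notin> closure S \<longrightarrow> v x = 0) \<and> (\<forall>z\<in>vertices M. v z = val z)"
proof -
  have "\<forall>T\<in>M. \<exists>p. p \<in> P1 \<and> (\<forall>z\<in>corners T. p z = val z)"
    using P1_interpolation[OF full_simplex.corners_props(2)[OF full_simplex]] by blast
  then obtain p where "\<forall>T\<in>M. p T \<in> P1 \<and> (\<forall>z\<in>corners T. p T z = val z)"
    by (elim bchoice[THEN exE])
  then have p: "\<And>T. T \<in> M \<Longrightarrow> p T \<in> P1" "\<And>T z. T \<in> M \<Longrightarrow> z \<in> corners T \<Longrightarrow> p T z = val z"
    by blast+
  have consistent: "p T x = p T' x" if T: "T \<in> M" "x \<in> T" "T' \<in> M" "x \<in> T'" for T T' x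
  proof -
    have face: "(T \<inter> T') face_of T" "(T \<inter> T') face_of T'"
      using face_Int[OF T(1,3)] face_Int[OF T(3,1)] by (simp_all add: Int_commute)
    have "compact (T \<inter> T')" "convex (T \<inter> T')"
      using full_simplex.compact[OF full_simplex] full_simplex.convex[OF full_simplex]
        full_simplex.closed[OF full_simplex] T by (auto intro: convex_Int compact_Int_closed)
    then have "T \<inter> T' = convex hull {z. z extreme_point_of (T \<inter> T')}" by (rule Krein_Milman_Minkowski)
    then have "x \<in> affine hull {z. z extreme_point_of (T \<inter> T')}"
      using T convex_hull_subset_affine_hull by blast
    then show ?thesis
    proof (rule P1_eq_on_hull[OF p(1)[OF T(1)] p(1)[OF T(3)], rotated])
      fix z assume "z \<in> {z. z extreme_point_of (T \<inter> T')}"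
      then have "z \<in> corners T" "z \<in> corners T'"
        using extreme_point_of_face[OF face(1)] extreme_point_of_face[OF face(2)]
        by (auto simp: corners_def)
      then show "p T z = p T' z" using p(2) T by simp
    qed
  qed
  define v where "v = (\<lambda>x. if x \<in> closure S then p (SOME T. T \<in> M \<and> x \<in> T) x else 0)"
  have v: "v x = p T x" if T: "T \<in> M" "x \<in> T" for x T
  proof -
    have "\<exists>T. T \<in> M \<and> x \<in> T" using T by blast
    then have "(SOME T. T \<in> M \<and> x \<in> T) \<in> M \<and> x \<in> (SOME T. T \<in> M \<and> x \<in> T)" by (rule someI_ex)
    then have "p (SOME T. T \<in> M \<and> x \<in> T) x = p T x"
      by (intro consistent) (simp_all add: T)
    moreover have "x \<in> closure S" using T subset_closure by blast
    ultimately show ?thesis by (simp add: v_def)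
  qed
  have "pw_affine M v" unfolding pw_affine_def using p(1) v by blast
  moreover have "v z = val z" if z: "z \<in> vertices M" for z
  proof -
    obtain T where T: "T \<in> M" "z \<in> corners T" using z by (auto simp: vertices_def corners_def)
    then have "z \<in> T" using full_simplex.corners_subset[OF full_simplex] by blast
    with T show ?thesis using v[of T z] p(2)[of T z] by simp
  qed
  ultimately show ?thesis by (intro exI[of _ v]) (simp add: v_def)
qed

abbreviation "\<Phi> \<equiv> nodal_basis S M"

text \<open>Justifies the definite description in \<open>nodal_basis\<close>; the prescribed value 0
  off the closure is what makes it unique on the whole space.\<close>

lemma
  shows nodal_pw_affine: "pw_affine M (\<Phi> z)"
    and nodal_outside: "x \<notin> closure S \<Longrightarrow> \<Phi> z x = 0"
    and nodal_vertex: "y \<in> vertices M \<Longrightarrow> \<Phi> z y = (if y = z then 1 else 0)"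
proof -
  define P where "P = (\<lambda>\<phi>. pw_affine M \<phi> \<and> (\<forall>x. x \<notin> closure S \<longrightarrow> \<phi> x = 0) \<and>
    (\<forall>y\<in>vertices M. \<phi> y = (if y = z then 1 else 0)))"
  have "\<exists>!\<phi>. P \<phi>"
  proof (rule ex_ex1I)
    show "\<exists>\<phi>. P \<phi>" unfolding P_def by (rule pw_affine_interpolation)
    fix \<phi> \<psi> assume "P \<phi>" "P \<psi>"
    then have "\<phi> x = \<psi> x" for x
      using pw_affine_eqI[of \<phi> \<psi> x] unfolding P_def by (cases "x \<in> closure S") auto
    then show "\<phi> = \<psi>" by blast
  qed
  then have "P (THE \<phi>. P \<phi>)" by (rule theI')
  moreover have "(THE \<phi>. P \<phi>) = \<Phi> z" unfolding nodal_basis_def P_def pw_affine_def ..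
  ultimately have "P (\<Phi> z)" by simp
  then show "pw_affine M (\<Phi> z)" "x \<notin> closure S \<Longrightarrow> \<Phi> z x = 0"
    "y \<in> vertices M \<Longrightarrow> \<Phi> z y = (if y = z then 1 else 0)" unfolding P_def by blast+
qed

lemma pw_affine_sum:
  "finite I \<Longrightarrow> (\<And>i. i \<in> I \<Longrightarrow> pw_affine M (v i)) \<Longrightarrow> pw_affine M (\<lambda>x. \<Sum>i\<in>I. v i x)"
  by (induction I rule: finite_induct) (auto intro: pw_affine_0 pw_affine_add)

lemma nodal_expansion:
  assumes "pw_affine M v" "\<And>x. x \<notin> closure S \<Longrightarrow> v x = 0"
  shows "v x = (\<Sum>z\<in>vertices M. v z * \<Phi> z x)"
proof (cases "x \<in> closure S")
  case True
  have "pw_affine M (\<lambda>x. \<Sum>z\<in>vertices M. v z * \<Phi> z x)"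
    by (intro pw_affine_sum finite_vertices pw_affine_scale nodal_pw_affine)
  from assms(1) this _ True show ?thesis
    by (rule pw_affine_eqI)
      (simp add: nodal_vertex finite_vertices if_distrib[of "(*) _"] cong: if_cong)
next
  case False
  then show ?thesis using assms(2) by (simp add: nodal_outside)
qed

lemma nodal_nonneg: "0 \<le> \<Phi> z x"
proof (cases "x \<in> closure S")
  case True
  then obtain T where T: "T \<in> M" "x \<in> T" using Union_mesh by blast
  interpret full_simplex T using T(1) by (rule full_simplex)
  obtain p where p: "p \<in> P1" "\<And>y. y \<in> T \<Longrightarrow> \<Phi> z y = p y"
    using nodal_pw_affine[of z] T(1) unfolding pw_affine_def by blast
  have "0 \<le> p c" if "c \<in> corners T" for c
  proof -
    have "c \<in> T" "c \<in> vertices M" using that corners_subset corners_subset_vertices[OF T(1)] by blast+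
    then show ?thesis using p(2)[of c] nodal_vertex[of c z] by (simp split: if_splits)
  qed
  moreover have "x \<in> convex hull (corners T)" unfolding corners_props(4) by (rule T(2))
  ultimately have "0 \<le> p x" by (rule P1_nonneg_on_hull[OF p(1)])
  then show ?thesis using p(2) T(2) by simp
qed (simp add: nodal_outside)

text \<open>The face of \<open>T\<close> that contains \<open>x\<close> and lies in \<open>G\<close>
  has all its corners in \<open>G\<close>, hence different from \<open>z\<close>. An affine function
  vanishing at them vanishes on the face.\<close>

lemma nodal_zero_on_fitted_part:
  assumes fits: "fits_boundary_part M G" and z: "z \<notin> G" and x: "x \<in> G"
  shows "\<Phi> z x = 0"
proof (cases "x \<in> closure S")
  case True
  then obtain T where T: "T \<in> M" "x \<in> T" using Union_mesh by blast
  interpret full_simplex T using T(1) by (rule full_simplex)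
  obtain F where F: "F face_of T" "x \<in> F" "F \<subseteq> G"
    using fits T x unfolding fits_boundary_part_def by blast
  obtain p where p: "p \<in> P1" "\<And>y. y \<in> T \<Longrightarrow> \<Phi> z y = p y"
    using nodal_pw_affine[of z] T(1) unfolding pw_affine_def by blast
  have "compact F" "convex F"
    using F(1) compact convex by (auto intro: face_of_imp_compact face_of_imp_convex)
  then have "F = convex hull {y. y extreme_point_of F}" by (rule Krein_Milman_Minkowski)
  then have "x \<in> affine hull {y. y extreme_point_of F}"
    using F(2) convex_hull_subset_affine_hull by blast
  then have "p x = 0"
  proof (rule P1_eq_on_hull[OF p(1) P1_const, rotated])
    fix y assume "y \<in> {y. y extreme_point_of F}"
    then have y: "y \<in> corners T" "y \<in> F"
      using extreme_point_of_face[OF F(1)] by (auto simp: corners_def)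
    have "y \<in> T" "y \<in> vertices M" "y \<noteq> z"
      using y corners_subset corners_subset_vertices[OF T(1)] z F(3) by blast+
    then show "p y = 0" using p(2)[of y] nodal_vertex[of y z] by simp
  qed
  then show ?thesis using p(2) T(2) by simp
qed (simp add: nodal_outside)

end

section \<open>Weak differentiability of piecewise affine functions\<close>

text \<open>From \<open>a\<close> one goes directly to the last point \<open>c\<close> of a set
  containing \<open>a\<close>, using the bound on that set alone. The rest of the way avoids this
  set, so one set fewer remains; the sets may be disconnected.\<close>

lemma lipschitz_on_finite_closed_cover:
  fixes h :: "real \<Rightarrow> real"
  assumes "finite F" "\<And>I. I \<in> F \<Longrightarrow> closed I"
    and "\<And>I s t. I \<in> F \<Longrightarrow> s \<in> I \<Longrightarrow> t \<in> I \<Longrightarrow> \<bar>h s - h t\<bar> \<le> L * \<bar>s - t\<bar>"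
    and "a \<le> b" "{a..b} \<subseteq> \<Union>F"
  shows "\<bar>h b - h a\<bar> \<le> L * (b - a)"
  using assms
proof (induction "card F" arbitrary: F a)
  case 0
  then have "{a..b} = {}" by auto
  then show ?case using \<open>a \<le> b\<close> by simp
next
  case (Suc n)
  have "a \<in> \<Union>F" using Suc.prems(4,5) by auto
  then obtain I where I: "I \<in> F" "a \<in> I" by blast
  have cpt: "compact (I \<inter> {a..b})"
    using Suc.prems(2)[OF I(1)] by (intro closed_Int_compact compact_Icc)
  have ne: "I \<inter> {a..b} \<noteq> {}" using I(2) Suc.prems(4) by auto
  obtain c where c: "c \<in> I \<inter> {a..b}" "\<And>t. t \<in> I \<inter> {a..b} \<Longrightarrow> t \<le> c"
    using compact_attains_sup[OF cpt ne] by blast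
  have ac: "\<bar>h c - h a\<bar> \<le> L * (c - a)"
    using Suc.prems(3)[OF I(1), of c a] c(1) I(2) by auto
  show ?case
  proof (cases "c = b")
    case True then show ?thesis using ac by simp
  next
    case False
    then have "c < b" using c(1) by auto
    let ?F = "F - {I}"
    \<comment> \<open>Beyond \<open>c\<close> the set \<open>I\<close> does not return. Closedness
      of the remaining sets then recovers the end point \<open>c\<close> itself.\<close>
    have "{c<..b} \<subseteq> \<Union>?F"
    proof
      fix t assume t: "t \<in> {c<..b}"
      then have "t \<in> {a..b}" using c(1) by auto
      then obtain J where J: "J \<in> F" "t \<in> J" using Suc.prems(5) by blast
      have "t \<notin> I" using c(2)[of t] t \<open>t \<in> {a..b}\<close> by auto
      then show "t \<in> \<Union>?F" using J by blast
    qed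
    moreover have "closed (\<Union>?F)" using Suc.prems(1,2) by (intro closed_Union) auto
    ultimately have "closure {c<..b} \<subseteq> \<Union>?F" by (rule closure_minimal)
    then have "{c..b} \<subseteq> \<Union>?F" using \<open>c < b\<close> by simp
    moreover have "n = card ?F" using Suc.hyps(2) I(1) Suc.prems(1) by simp
    ultimately have "\<bar>h b - h c\<bar> \<le> L * (b - c)"
      using Suc.prems(1-3) \<open>c < b\<close> by (intro Suc.hyps(1)) auto
    then show ?thesis using ac by (simp add: algebra_simps abs_le_iff)
  qed
qed

lemma test_functionD:
  fixes \<phi> :: "real ^ 'n \<Rightarrow> real"
  assumes "test_function S \<phi>"
  shows "\<And>x. \<phi> differentiable at x"
    and "b \<in> Basis \<Longrightarrow> continuous_on UNIV (\<lambda>x. frechet_derivative \<phi> (at x) b)"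
proof -
  have "smooth \<phi>" using assms by (simp add: test_function_def)
  then have d: "\<forall>x. \<phi> differentiable at x" "\<forall>b\<in>Basis. smooth (\<lambda>x. frechet_derivative \<phi> (at x) b)"
    by (auto elim: smooth.cases)
  then show "\<phi> differentiable at x" for x by blast
  assume "b \<in> Basis"
  then have "smooth (\<lambda>x. frechet_derivative \<phi> (at x) b)" using d(2) by blast
  then have "\<forall>x. (\<lambda>x. frechet_derivative \<phi> (at x) b) differentiable at x"
    by (auto elim: smooth.cases)
  then show "continuous_on UNIV (\<lambda>x. frechet_derivative \<phi> (at x) b)"
    by (auto intro!: continuous_at_imp_continuous_on differentiable_imp_continuous_within)
qed

lemma bounded_imp_integrable_lebesgue_on:
  fixes f :: "'a::euclidean_space \<Rightarrow> 'b::{banach, second_countable_topology}"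
  assumes "S \<in> lmeasurable" "f \<in> borel_measurable (lebesgue_on S)" "\<And>x. x \<in> S \<Longrightarrow> norm (f x) \<le> B"
  shows "integrable (lebesgue_on S) f"
proof -
  interpret finite_measure "lebesgue_on S" using assms(1) by (rule finite_measure_lebesgue_on)
  show ?thesis using assms(2,3) by (intro integrable_const_bound[of _ B] AE_I2) auto
qed

context mesh
begin

lemma lmeasurable_domain: "S \<in> lmeasurable"
  using compact_closure_domain open_domain closure_subset
  by (intro bounded_set_imp_lmeasurable)
    (auto intro: bounded_subset compact_imp_bounded simp: lmeasurable_open)

lemma sets_domain: "S \<in> sets lebesgue"
  using lmeasurable_domain by (rule fmeasurableD)

text \<open>A representative of the gradient that is Borel and bounded everywhere; off the element
  interiors it is 0. On the domain \<open>grad\<close> agrees with it almost everywhere.\<close>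

definition pw_grad :: "(real ^ 'n \<Rightarrow> real) \<Rightarrow> real ^ 'n \<Rightarrow> real ^ 'n" where
  "pw_grad v x = (\<Sum>T\<in>M. indicator (interior T) x *\<^sub>R elem_grad v T)"

lemma pw_grad_interior: "T \<in> M \<Longrightarrow> x \<in> interior T \<Longrightarrow> pw_grad v x = elem_grad v T"
proof -
  assume T: "T \<in> M" "x \<in> interior T"
  have "pw_grad v x = (\<Sum>T'\<in>{T}. indicator (interior T') x *\<^sub>R elem_grad v T')"
    unfolding pw_grad_def
  proof (rule sum.mono_neutral_right)
    show "\<forall>T'\<in>M - {T}. indicator (interior T') x *\<^sub>R elem_grad v T' = 0"
      using interior_inject[OF T(1)] T(2) by (auto simp: indicator_def)
  qed (use T finite_mesh in auto)
  then show ?thesis using T(2) by simp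
qed

lemma norm_pw_grad_le: "norm (pw_grad v x) \<le> (\<Sum>T\<in>M. norm (elem_grad v T))"
  unfolding pw_grad_def
  by (rule order_trans[OF norm_sum sum_mono]) (auto simp: indicator_def)

lemma borel_measurable_pw_grad: "pw_grad v \<in> borel_measurable borel"
  unfolding pw_grad_def[abs_def] by (intro borel_measurable_sum borel_measurable_scaleR
    borel_measurable_indicator borel_measurable_const) auto

definition mesh_frontier :: "(real ^ 'n) set" where
  "mesh_frontier = (\<Union>T\<in>M. frontier T)"

lemma negligible_mesh_frontier: "negligible mesh_frontier"
  unfolding mesh_frontier_def using finite_mesh full_simplex.convex[OF full_simplex]
  by (intro negligible_Union) (auto intro: negligible_convex_frontier)

lemma in_some_interior:
  assumes "x \<in> S" "x \<notin> mesh_frontier" obtains T where "T \<in> M" "x \<in> interior T"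
proof -
  obtain T where T: "T \<in> M" "x \<in> T" using assms(1) Union_mesh closure_subset[of S] by blast
  then have "x \<notin> frontier T" using assms(2) unfolding mesh_frontier_def by blast
  then have "x \<in> interior T" using T(2) closure_subset[of T] unfolding frontier_def by blast
  then show ?thesis using T(1) that by blast
qed

lemma pw_affine_bounded:
  assumes "pw_affine M v" obtains B where "B > 0" "\<And>x. x \<in> closure S \<Longrightarrow> \<bar>v x\<bar> \<le> B"
proof -
  have "bounded (v ` closure S)"
    using compact_continuous_image[OF continuous_on_pw_affine[OF assms] compact_closure_domain]
    by (rule compact_imp_bounded)
  then obtain B where "B > 0" "\<forall>y\<in>v ` closure S. norm y \<le> B" unfolding bounded_pos by blast
  then show ?thesis using that by auto
qed

text \<open>The domain may be nonconvex, so the bound is stated along a segment inside its closure,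
  which the elements cut into finitely many closed pieces. The sum of the gradient norms stands in
  for their maximum.\<close>

lemma pw_affine_lipschitz_on_segment:
  assumes v: "pw_affine M v" and seg: "closed_segment x y \<subseteq> closure S"
  shows "\<bar>v y - v x\<bar> \<le> (\<Sum>T\<in>M. norm (elem_grad v T)) * norm (y - x)"
proof -
  let ?L = "\<Sum>T\<in>M. norm (elem_grad v T)"
  define p where "p = (\<lambda>s::real. x + s *\<^sub>R (y - x))"
  have cont: "continuous_on UNIV p" unfolding p_def by (intro continuous_intros)
  have "\<bar>(v \<circ> p) 1 - (v \<circ> p) 0\<bar> \<le> (?L * norm (y - x)) * (1 - 0)"
  proof (rule lipschitz_on_finite_closed_cover[of "(\<lambda>T. p -` T) ` M"])
    show "finite ((\<lambda>T. p -` T) ` M)" using finite_mesh by simp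
    show "closed I" if I: "I \<in> (\<lambda>T. p -` T) ` M" for I
    proof -
      obtain T where T: "T \<in> M" "I = p -` T" using I by blast
      show ?thesis unfolding T(2)
        using full_simplex.closed[OF full_simplex[OF T(1)]] cont by (rule closed_vimage)
    qed
    show "{0..1} \<subseteq> \<Union> ((\<lambda>T. p -` T) ` M)"
    proof
      fix s :: real assume s: "s \<in> {0..1}"
      have "p s = (1 - s) *\<^sub>R x + s *\<^sub>R y" by (simp add: p_def algebra_simps)
      then have "p s \<in> closed_segment x y" using s unfolding in_segment by auto
      then have "p s \<in> \<Union>M" using seg Union_mesh by blast
      then show "s \<in> \<Union> ((\<lambda>T. p -` T) ` M)" by blast
    qed
    show "\<bar>(v \<circ> p) s - (v \<circ> p) t\<bar> \<le> ?L * norm (y - x) * \<bar>s - t\<bar>"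
      if I: "I \<in> (\<lambda>T. p -` T) ` M" and st: "s \<in> I" "t \<in> I" for I s t
    proof -
      obtain T where T: "T \<in> M" "p s \<in> T" "p t \<in> T" using I st by blast
      obtain c where c: "\<And>z. z \<in> T \<Longrightarrow> v z = c + elem_grad v T \<bullet> z"
        using elem_grad[OF v T(1)] by blast
      have "p s - p t = (s - t) *\<^sub>R (y - x)" by (simp add: p_def algebra_simps)
      then have "v (p s) - v (p t) = (s - t) * (elem_grad v T \<bullet> (y - x))"
        using c[OF T(2)] c[OF T(3)] by (metis add_diff_cancel_left inner_diff_right inner_scaleR_right)
      then have "\<bar>v (p s) - v (p t)\<bar> = \<bar>elem_grad v T \<bullet> (y - x)\<bar> * \<bar>s - t\<bar>" by (simp add: abs_mult)
      also have "\<dots> \<le> (norm (elem_grad v T) * norm (y - x)) * \<bar>s - t\<bar>"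
        by (intro mult_right_mono Cauchy_Schwarz_ineq2) simp
      also have "\<dots> \<le> (?L * norm (y - x)) * \<bar>s - t\<bar>"
        using T(1) finite_mesh by (intro mult_right_mono member_le_sum) auto
      finally show ?thesis by simp
    qed
  qed simp
  then show ?thesis by (simp add: p_def)
qed

text \<open>The integral of a difference quotient of the compactly supported function \<open>u * \<phi>\<close> is zero by
  translation invariance; by dominated convergence, so is that of its derivative, which exists off
  the element boundaries.\<close>

lemma pw_affine_integration_by_parts:
  assumes u: "pw_affine M u" and \<phi>: "test_function S \<phi>" and b: "b \<in> Basis"
  defines "\<psi> \<equiv> \<lambda>x. frechet_derivative \<phi> (at x) b"
  shows "L2_inner S u \<psi> = - L2_inner S (\<lambda>x. pw_grad u x \<bullet> b) \<phi>"
proof -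
  define K where "K = closure {x. \<phi> x \<noteq> 0}"
  have K: "compact K" "K \<subseteq> S" using \<phi> by (auto simp: test_function_def K_def)
  have \<phi>0: "\<phi> x = 0" if "x \<notin> K" for x using that closure_subset[of "{x. \<phi> x \<noteq> 0}"] unfolding K_def by blast
  have \<phi>_deriv: "(\<phi> has_derivative frechet_derivative \<phi> (at x)) (at x)" for x
    using test_functionD(1)[OF \<phi>] unfolding frechet_derivative_works .
  have cont_\<phi>: "continuous_on UNIV \<phi>"
    using test_functionD(1)[OF \<phi>]
    by (auto intro!: continuous_at_imp_continuous_on differentiable_imp_continuous_within)
  have cont_\<psi>: "continuous_on UNIV \<psi>" unfolding \<psi>_def using test_functionD(2)[OF \<phi> b] .
  have \<psi>0: "\<psi> x = 0" if x: "x \<notin> K" for x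
  proof -
    have "(\<phi> has_derivative (\<lambda>h. 0)) (at x)"
    proof (rule has_derivative_transform_within_open[of "\<lambda>_. 0" _ x UNIV "- K"])
      show "open (- K)" using K(1) by (simp add: compact_imp_closed open_Compl)
    qed (use \<phi>0 x in auto)
    then have "frechet_derivative \<phi> (at x) = (\<lambda>h. 0)" by (rule has_derivative_unique[OF \<phi>_deriv])
    then show ?thesis by (simp add: \<psi>_def)
  qed
  \<comment> \<open>The function \<open>u\<close> is controlled only on the closure of
    \<open>S\<close>. Multiplied by a function vanishing off the compact \<open>K\<close>, it is
    continuous on \<open>S\<close> and on \<open>- K\<close>, two open sets that cover the
    space.\<close>
  have cont_prod: "continuous_on UNIV (\<lambda>x. u x * g x)"
    if g: "continuous_on UNIV g" "\<And>x. x \<notin> K \<Longrightarrow> g x = 0" for g :: "real ^ 'n \<Rightarrow> real"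
  proof -
    have "continuous_on S (\<lambda>x. u x * g x)"
      using continuous_on_pw_affine[OF u] g(1) closure_subset
      by (intro continuous_on_mult) (auto intro: continuous_on_subset)
    moreover have "continuous_on (- K) (\<lambda>x. u x * g x)"
      by (subst continuous_on_cong[of _ "- K" _ "\<lambda>_. 0"]) (auto simp: g(2))
    moreover have "open (- K)" using K(1) by (simp add: compact_imp_closed open_Compl)
    ultimately have "continuous_on (S \<union> - K) (\<lambda>x. u x * g x)"
      using open_domain by (intro continuous_on_open_Un)
    moreover have "S \<union> - K = UNIV" using K(2) by blast
    ultimately show ?thesis by simp
  qed
  define w where "w = (\<lambda>x. u x * \<phi> x)"
  have cont_w: "continuous_on UNIV w" unfolding w_def using cont_\<phi> \<phi>0 by (rule cont_prod)
  \<comment> \<open>Shifts shorter than \<open>e\<close> keep the points of \<open>K\<close> inside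
    \<open>S\<close>, and with them the segments along which \<open>u\<close> is compared.\<close>
  obtain e where e: "e > 0" "(\<Union>x\<in>K. cball x e) \<subseteq> S"
    using compact_subset_open_imp_cball_epsilon_subset[OF K(1) open_domain K(2)] by blast
  obtain Bu where Bu: "Bu > 0" "\<And>x. x \<in> closure S \<Longrightarrow> \<bar>u x\<bar> \<le> Bu"
    using pw_affine_bounded[OF u] by blast
  have bound: "\<exists>B. B \<ge> 0 \<and> (\<forall>x. \<bar>g x\<bar> \<le> B)"
    if g: "continuous_on UNIV g" "\<And>x. x \<notin> K \<Longrightarrow> g x = 0" for g :: "real ^ 'n \<Rightarrow> real"
  proof -
    have "bounded (g ` K)"
      using continuous_on_subset[OF g(1) subset_UNIV] K(1)
      by (intro compact_imp_bounded compact_continuous_image)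
    then obtain B where B: "B > 0" "\<forall>y\<in>g ` K. norm y \<le> B" unfolding bounded_pos by blast
    have "\<bar>g x\<bar> \<le> B" for x using B g(2)[of x] by (cases "x \<in> K") auto
    then show ?thesis using B(1) by (intro exI[of _ B]) auto
  qed
  obtain F where F: "F \<ge> 0" "\<And>x. \<bar>\<phi> x\<bar> \<le> F" using bound[OF cont_\<phi> \<phi>0] by blast
  obtain D where D: "D \<ge> 0" "\<And>x. \<bar>\<psi> x\<bar> \<le> D" using bound[OF cont_\<psi> \<psi>0] by blast
  define L where "L = (\<Sum>T\<in>M. norm (elem_grad u T))"
  have L: "L \<ge> 0" by (simp add: L_def sum_nonneg)
  have along: "((\<lambda>s. \<phi> (x + s *\<^sub>R b)) has_real_derivative \<psi> (x + s *\<^sub>R b)) (at s)" for x s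
  proof -
    have "((\<lambda>s. \<phi> (x + s *\<^sub>R b)) has_derivative (\<lambda>h. frechet_derivative \<phi> (at (x + s *\<^sub>R b)) (h *\<^sub>R b))) (at s)"
      by (rule has_derivative_compose[OF _ \<phi>_deriv]) (auto intro!: derivative_eq_intros)
    moreover have "frechet_derivative \<phi> (at (x + s *\<^sub>R b)) (h *\<^sub>R b) = \<psi> (x + s *\<^sub>R b) * h" for h
      using linear_scale[OF has_derivative_linear[OF \<phi>_deriv[of "x + s *\<^sub>R b"]], of h b]
      by (simp add: \<psi>_def)
    ultimately show ?thesis by (simp add: has_field_derivative_def)
  qed
  have \<phi>_lip: "\<bar>\<phi> (x + t *\<^sub>R b) - \<phi> x\<bar> \<le> D * \<bar>t\<bar>" for x t
  proof -
    have "norm (\<phi> (x + t *\<^sub>R b) - \<phi> (x + 0 *\<^sub>R b)) \<le> D * norm (t - 0)"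
      using along D(2) by (intro field_differentiable_bound[of UNIV _ "\<lambda>s. \<psi> (x + s *\<^sub>R b)"]) auto
    then show ?thesis by simp
  qed
  \<comment> \<open>The product rule: bound of \<open>u\<close> times slope of \<phi>, plus slope of
    \<open>u\<close> times bound of \<phi>. Together with the indicator of \<open>S\<close> this is
    the dominating function.\<close>
  define C where "C = Bu * D + L * F"
  have w_lip: "\<bar>w (x + t *\<^sub>R b) - w x\<bar> \<le> (C * indicator S x) * \<bar>t\<bar>" if t: "\<bar>t\<bar> < e" for x t
  proof (cases "x \<in> K \<or> x + t *\<^sub>R b \<in> K")
    case True
    have nb: "norm (t *\<^sub>R b) \<le> e" using t b by (simp add: norm_Basis)
    obtain z where z: "z \<in> K" "x \<in> cball z e" "x + t *\<^sub>R b \<in> cball z e"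
      using True
    proof
      assume "x \<in> K" then show ?thesis using that[of x] e(1) nb by (simp add: dist_norm)
    next
      assume "x + t *\<^sub>R b \<in> K" then show ?thesis
        using that[of "x + t *\<^sub>R b"] e(1) nb by (simp add: dist_norm norm_minus_commute)
    qed
    have ball: "cball z e \<subseteq> S" using e(2) z(1) by blast
    have "closed_segment x (x + t *\<^sub>R b) \<subseteq> cball z e"
      using z(2,3) by (intro closed_segment_subset convex_cball)
    then have seg: "closed_segment x (x + t *\<^sub>R b) \<subseteq> closure S"
      using ball closure_subset[of S] by blast
    have "w (x + t *\<^sub>R b) - w x
      = u (x + t *\<^sub>R b) * (\<phi> (x + t *\<^sub>R b) - \<phi> x) + (u (x + t *\<^sub>R b) - u x) * \<phi> x"
      by (simp add: w_def algebra_simps)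
    also have "\<bar>\<dots>\<bar> \<le> \<bar>u (x + t *\<^sub>R b)\<bar> * \<bar>\<phi> (x + t *\<^sub>R b) - \<phi> x\<bar> + \<bar>u (x + t *\<^sub>R b) - u x\<bar> * \<bar>\<phi> x\<bar>"
      unfolding abs_mult[symmetric] by (rule abs_triangle_ineq)
    also have "\<dots> \<le> Bu * (D * \<bar>t\<bar>) + (L * \<bar>t\<bar>) * F"
    proof (intro add_mono mult_mono)
      show "\<bar>u (x + t *\<^sub>R b)\<bar> \<le> Bu" using Bu(2) ball z(3) closure_subset[of S] by blast
      show "\<bar>u (x + t *\<^sub>R b) - u x\<bar> \<le> L * \<bar>t\<bar>"
        using pw_affine_lipschitz_on_segment[OF u seg] b by (simp add: L_def)
    qed (use \<phi>_lip F Bu(1) D(1) L in auto)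
    also have "\<dots> = (C * indicator S x) * \<bar>t\<bar>"
      using ball z(2) by (auto simp: C_def algebra_simps)
    finally show ?thesis .
  next
    case False
    then show ?thesis using Bu(1) D(1) L F(1) by (simp add: w_def \<phi>0 C_def)
  qed
  have int_w: "integrable lborel w"
  proof -
    have "integrable lborel (\<lambda>x. indicator K x *\<^sub>R w x)"
      using K(1) continuous_on_subset[OF cont_w subset_UNIV] by (rule borel_integrable_compact)
    moreover have "(\<lambda>x. indicator K x *\<^sub>R w x) = w"
    proof
      fix x show "indicator K x *\<^sub>R w x = w x" by (cases "x \<in> K") (auto simp: w_def \<phi>0)
    qed
    ultimately show ?thesis by simp
  qed
  have borel_w: "w \<in> borel_measurable borel" using cont_w by (rule borel_measurable_continuous_onI)
  have shift: "integrable lborel (\<lambda>x. w (x + c))" "(\<integral>x. w (x + c) \<partial>lborel) = (\<integral>x. w x \<partial>lborel)" for c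
  proof -
    have "integrable (distr lborel borel ((+) c)) w" unfolding lborel_distr_plus by (rule int_w)
    then show "integrable lborel (\<lambda>x. w (x + c))"
      using borel_w by (simp add: integrable_distr_eq add.commute)
    have "(\<integral>x. w x \<partial>lborel) = (\<integral>x. w x \<partial>(distr lborel borel ((+) c)))" unfolding lborel_distr_plus ..
    also have "\<dots> = (\<integral>x. w (x + c) \<partial>lborel)"
      using borel_w by (simp add: integral_distr add.commute)
    finally show "(\<integral>x. w (x + c) \<partial>lborel) = (\<integral>x. w x \<partial>lborel)" by simp
  qed
  \<comment> \<open>The offset 2 keeps every step strictly below \<open>e\<close>.\<close>
  define \<tau> where "\<tau> = (\<lambda>n::nat. e / real (n + 2))"
  have \<tau>: "0 < \<tau> n" "\<tau> n < e" for n
  proof -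
    show "0 < \<tau> n" using e(1) by (simp add: \<tau>_def)
    have "e / real (n + 2) < e / 1" using e(1) by (intro divide_strict_left_mono) auto
    then show "\<tau> n < e" by (simp add: \<tau>_def)
  qed
  have \<tau>_lim: "\<tau> \<longlonglongrightarrow> 0"
  proof -
    have "(\<lambda>n. e * inverse (real (n + 2))) \<longlonglongrightarrow> e * 0"
      using LIMSEQ_ignore_initial_segment[OF lim_inverse_n, of 2] by (intro tendsto_mult tendsto_const) simp
    then show ?thesis by (simp add: \<tau>_def[abs_def] divide_inverse)
  qed
  define q where "q = (\<lambda>n x. (w (x + \<tau> n *\<^sub>R b) - w x) / \<tau> n)"
  define r where "r = (\<lambda>x. (pw_grad u x \<bullet> b) * \<phi> x + u x * \<psi> x)"
  have q_lim: "(\<lambda>n. q n x) \<longlonglongrightarrow> r x" if x: "x \<notin> mesh_frontier" for x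
  proof -
    have "((\<lambda>s. w (x + s *\<^sub>R b)) has_real_derivative r x) (at 0)"
    proof (cases "x \<in> K")
      case True
      then obtain T where T: "T \<in> M" "x \<in> interior T" using in_some_interior x K(2) by blast
      have "(u has_derivative (\<lambda>h. h \<bullet> elem_grad u T)) (at x)"
        using GDERIV_elem_grad[OF u T] unfolding gderiv_def .
      then have "(u has_derivative (\<lambda>h. h \<bullet> elem_grad u T)) (at (x + 0 *\<^sub>R b))" by simp
      then have "((\<lambda>s. u (x + s *\<^sub>R b)) has_derivative (\<lambda>h. (h *\<^sub>R b) \<bullet> elem_grad u T)) (at 0)"
        by (rule has_derivative_compose[rotated]) (auto intro!: derivative_eq_intros)
      moreover have "(\<lambda>h. (h *\<^sub>R b) \<bullet> elem_grad u T) = (*) (pw_grad u x \<bullet> b)"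
        by (simp add: fun_eq_iff pw_grad_interior[OF T] inner_commute)
      ultimately have "((\<lambda>s. u (x + s *\<^sub>R b)) has_real_derivative (pw_grad u x \<bullet> b)) (at 0)"
        unfolding has_field_derivative_def by simp
      from DERIV_mult[OF this along[of x 0]] show ?thesis
        by (simp add: w_def r_def algebra_simps)
    next
      case False
      have "open (- K)" using K(1) by (simp add: compact_imp_closed open_Compl)
      then have "open ((\<lambda>s::real. x + s *\<^sub>R b) -` (- K))"
        by (rule open_vimage) (intro continuous_intros)
      then have "((\<lambda>s. w (x + s *\<^sub>R b)) has_real_derivative 0) (at 0)"
        by (rule has_field_derivative_transform_within_open[OF DERIV_const[of 0]])
          (use False \<phi>0 in \<open>auto simp: w_def\<close>)
      then show ?thesis using False by (simp add: r_def \<phi>0 \<psi>0)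
    qed
    then have "((\<lambda>s. (w (x + s *\<^sub>R b) - w x) / s) \<longlongrightarrow> r x) (at 0)"
      by (simp add: has_field_derivative_iff)
    moreover have "filterlim \<tau> (at 0) sequentially"
      using \<tau>_lim \<tau>(1) by (auto simp: filterlim_at intro!: always_eventually less_imp_neq[THEN not_sym])
    ultimately show ?thesis unfolding q_def by (rule filterlim_compose)
  qed
  have borel_grad: "(\<lambda>x. (pw_grad u x \<bullet> b) * \<phi> x) \<in> borel_measurable borel"
    by (intro borel_measurable_times borel_measurable_inner borel_measurable_const
        borel_measurable_pw_grad borel_measurable_continuous_onI[OF cont_\<phi>])
  have cont_u\<psi>: "continuous_on UNIV (\<lambda>x. u x * \<psi> x)" using cont_\<psi> \<psi>0 by (rule cont_prod)
  then have borel_u\<psi>: "(\<lambda>x. u x * \<psi> x) \<in> borel_measurable borel" by (rule borel_measurable_continuous_onI)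
  have int_bound: "integrable lborel g"
    if g: "g \<in> borel_measurable borel" "\<And>x. x \<notin> K \<Longrightarrow> g x = 0" "\<And>x. \<bar>g x\<bar> \<le> B" for g :: "real ^ 'n \<Rightarrow> real" and B
  proof (rule Bochner_Integration.integrable_bound)
    show "integrable lborel (\<lambda>x. B * indicator K x)"
      using K(1) emeasure_compact_finite by (intro integrable_mult_right integrable_real_indicator) (auto intro: borel_compact)
    show "AE x in lborel. norm (g x) \<le> norm (B * indicator K x)"
    proof (rule AE_I2)
      fix x show "norm (g x) \<le> norm (B * indicator K x)"
        using g(2)[of x] g(3)[of x] by (cases "x \<in> K") auto
    qed
  qed (use g in simp)
  have int_grad: "integrable lborel (\<lambda>x. (pw_grad u x \<bullet> b) * \<phi> x)"
  proof (rule int_bound[OF borel_grad])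
    fix x
    have "\<bar>pw_grad u x \<bullet> b\<bar> \<le> L"
      using Cauchy_Schwarz_ineq2[of "pw_grad u x" b] norm_pw_grad_le[of u x] b by (simp add: L_def)
    then show "\<bar>(pw_grad u x \<bullet> b) * \<phi> x\<bar> \<le> L * F"
      unfolding abs_mult using F L by (intro mult_mono) auto
  qed (simp add: \<phi>0)
  have int_u\<psi>: "integrable lborel (\<lambda>x. u x * \<psi> x)"
  proof (rule int_bound[OF borel_u\<psi>])
    fix x
    show "\<bar>u x * \<psi> x\<bar> \<le> Bu * D"
    proof (cases "x \<in> K")
      case True
      then have "\<bar>u x\<bar> \<le> Bu" using Bu(2) K(2) closure_subset[of S] by blast
      then show ?thesis unfolding abs_mult using D Bu(1) by (intro mult_mono) auto
    qed (use \<psi>0 Bu(1) D(1) in simp)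
  qed (simp add: \<psi>0)
  have "(\<lambda>n. \<integral>x. q n x \<partial>lborel) \<longlonglongrightarrow> (\<integral>x. r x \<partial>lborel)"
  proof (rule integral_dominated_convergence)
    show "r \<in> borel_measurable lborel"
      unfolding r_def using borel_grad borel_u\<psi> by simp
    show "q n \<in> borel_measurable lborel" for n
    proof -
      have "continuous_on UNIV (q n)"
        unfolding q_def using \<tau>(1)[of n]
        by (intro continuous_intros continuous_on_compose2[OF cont_w]) auto
      then show ?thesis using borel_measurable_continuous_onI by simp
    qed
    show "integrable lborel (\<lambda>x. C * indicator S x)"
      using lmeasurable_domain open_domain
      by (intro integrable_mult_right integrable_real_indicator)
        (auto simp: fmeasurable_def)
    show "AE x in lborel. (\<lambda>n. q n x) \<longlonglongrightarrow> r x"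
    proof -
      have "AE x in lebesgue. x \<notin> mesh_frontier"
        using negligible_mesh_frontier by (simp add: negligible_iff_null_sets AE_not_in)
      then have "AE x in lborel. x \<notin> mesh_frontier" by (simp add: AE_completion_iff)
      then show ?thesis by (rule eventually_mono) (rule q_lim)
    qed
    show "AE x in lborel. norm (q n x) \<le> C * indicator S x" for n
    proof (rule AE_I2)
      fix x
      have "norm (q n x) = \<bar>w (x + \<tau> n *\<^sub>R b) - w x\<bar> / \<tau> n"
        using \<tau>(1)[of n] by (simp add: q_def)
      also have "\<dots> \<le> ((C * indicator S x) * \<tau> n) / \<tau> n"
        using w_lip[of "\<tau> n" x] \<tau>[of n] by (intro divide_right_mono) auto
      also have "\<dots> = C * indicator S x" using \<tau>(1)[of n] by simp
      finally show "norm (q n x) \<le> C * indicator S x" .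
    qed
  qed
  moreover have "(\<integral>x. q n x \<partial>lborel) = 0" for n
    unfolding q_def using shift int_w by (simp add: Bochner_Integration.integral_diff)
  ultimately have "(\<integral>x. r x \<partial>lborel) = 0" by (simp add: LIMSEQ_const_iff)
  then have zero: "(\<integral>x. u x * \<psi> x \<partial>lborel) = - (\<integral>x. (pw_grad u x \<bullet> b) * \<phi> x \<partial>lborel)"
    unfolding r_def using int_grad int_u\<psi> by (simp add: Bochner_Integration.integral_add)
  have set_int: "(LINT x:S|lebesgue. g x) = (\<integral>x. g x \<partial>lborel)"
    if g: "g \<in> borel_measurable borel" "\<And>x. x \<notin> K \<Longrightarrow> g x = 0" for g :: "real ^ 'n \<Rightarrow> real"
  proof -
    have "(\<lambda>x. indicator S x *\<^sub>R g x) = g"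
    proof
      fix x show "indicator S x *\<^sub>R g x = g x" using g(2)[of x] K(2) by (cases "x \<in> S") auto
    qed
    then show ?thesis unfolding set_lebesgue_integral_def using g(1) by (simp add: integral_completion)
  qed
  show ?thesis
    unfolding L2_inner_def
    using set_int[OF borel_u\<psi>] set_int[OF borel_grad] zero by (simp add: \<psi>0 \<phi>0)
qed

text \<open>The function and \<open>pw_grad\<close> are bounded and measurable on a set of finite
  measure, and integration by parts makes \<open>pw_grad\<close> the weak gradient.\<close>

lemma pw_affine_in_H1:
  assumes u: "pw_affine M u" shows "u \<in> H1 S"
proof -
  obtain B where B: "\<And>x. x \<in> closure S \<Longrightarrow> \<bar>u x\<bar> \<le> B" using pw_affine_bounded[OF u] by blast
  have um: "u \<in> borel_measurable (lebesgue_on S)"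
    using continuous_on_subset[OF continuous_on_pw_affine[OF u] closure_subset] sets_domain
    by (rule continuous_imp_measurable_on_sets_lebesgue)
  have "integrable (lebesgue_on S) (\<lambda>x. (u x)\<^sup>2)"
  proof (rule bounded_imp_integrable_lebesgue_on[OF lmeasurable_domain])
    show "(\<lambda>x. (u x)\<^sup>2) \<in> borel_measurable (lebesgue_on S)" using um by measurable
    fix x assume "x \<in> S"
    then have "\<bar>u x\<bar> \<le> B" using B closure_subset[of S] by blast
    then show "norm ((u x)\<^sup>2) \<le> B\<^sup>2" by (metis abs_ge_zero norm_power power_mono real_norm_def)
  qed
  then have "L2_on S u" using um by (simp add: L2_on_def)
  moreover have "L2_on S (\<lambda>x. pw_grad u x \<bullet> b)" if b: "b \<in> Basis" for b
  proof -
    let ?L = "\<Sum>T\<in>M. norm (elem_grad u T)"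
    have "(\<lambda>x. pw_grad u x \<bullet> b) \<in> borel_measurable borel"
      using borel_measurable_pw_grad by (intro borel_measurable_inner borel_measurable_const)
    then have m: "(\<lambda>x. pw_grad u x \<bullet> b) \<in> borel_measurable (lebesgue_on S)"
      by (intro measurable_restrict_space1 measurable_completion) simp
    moreover have "integrable (lebesgue_on S) (\<lambda>x. (pw_grad u x \<bullet> b)\<^sup>2)"
    proof (rule bounded_imp_integrable_lebesgue_on[OF lmeasurable_domain])
      show "(\<lambda>x. (pw_grad u x \<bullet> b)\<^sup>2) \<in> borel_measurable (lebesgue_on S)" using m by measurable
      fix x
      have "\<bar>pw_grad u x \<bullet> b\<bar> \<le> ?L"
        using Cauchy_Schwarz_ineq2[of "pw_grad u x" b] norm_pw_grad_le[of u x] b by simp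
      then show "norm ((pw_grad u x \<bullet> b)\<^sup>2) \<le> ?L\<^sup>2"
        by (metis abs_ge_zero norm_power power_mono real_norm_def)
    qed
    ultimately show ?thesis by (simp add: L2_on_def)
  qed
  moreover have "weak_gradient S u (pw_grad u)"
    unfolding weak_gradient_def using pw_affine_integration_by_parts[OF u] by blast
  ultimately show ?thesis unfolding H1_def by blast
qed

text \<open>The \<open>H1\<close> clause follows from the others, so from here on the finite element
  spaces are handled by pointwise conditions alone.\<close>

lemma in_fe_space_iff:
  "v \<in> fe_space S G M \<longleftrightarrow> pw_affine M v \<and> (\<forall>x\<in>G. v x = 0) \<and> (\<forall>x. x \<notin> closure S \<longrightarrow> v x = 0)"
  unfolding fe_space_def using pw_affine_in_H1 by (auto simp: pw_affine_def)

end

section \<open>The \<open>L\<^sup>2\<close> inner product and quasi-interpolation\<close>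

interpretation fun_space: vector_space "\<lambda>(c::real) (u::'a \<Rightarrow> real) x. c * u x"
  by standard (auto simp: fun_eq_iff algebra_simps)

lemma sum_fun_apply: "(\<Sum>i\<in>I. g i) x = (\<Sum>i\<in>I. g i x)" for g :: "'i \<Rightarrow> 'a \<Rightarrow> real"
  by (induction I rule: infinite_finite_induct) auto

lemma L2_inner_commute: "L2_inner S u v = L2_inner S v u"
  by (simp add: L2_inner_def mult.commute)

context mesh
begin

lemma set_integrable_continuous:
  fixes g :: "real ^ 'n \<Rightarrow> real"
  assumes "continuous_on (closure S) g" shows "set_integrable lebesgue S g"
proof -
  have "bounded (g ` closure S)"
    using compact_continuous_image[OF assms compact_closure_domain] by (rule compact_imp_bounded)
  then obtain B where B: "\<forall>y\<in>g ` closure S. norm y \<le> B" unfolding bounded_pos by blast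
  have "g \<in> borel_measurable (lebesgue_on S)"
    using continuous_on_subset[OF assms closure_subset] sets_domain
    by (rule continuous_imp_measurable_on_sets_lebesgue)
  then have "integrable (lebesgue_on S) g"
    using B closure_subset[of S] by (intro bounded_imp_integrable_lebesgue_on[OF lmeasurable_domain, of _ B]) blast+
  then show ?thesis
    using sets_domain by (simp add: set_integrable_def integrable_restrict_space)
qed

text \<open>The points of \<open>S\<close> where \<open>g\<close> is nonzero form an open null set,
  which is empty; continuity carries the zero to the closure.\<close>

lemma set_integral_continuous_eq_0D:
  fixes g :: "real ^ 'n \<Rightarrow> real"
  assumes g: "continuous_on (closure S) g" and nonneg: "\<And>x. x \<in> S \<Longrightarrow> 0 \<le> g x"
    and zero: "(LINT x:S|lebesgue. g x) = 0" and x: "x \<in> closure S"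
  shows "g x = 0"
proof -
  have gS: "continuous_on S g" using continuous_on_subset[OF g closure_subset] .
  have "AE x in lebesgue. indicator S x *\<^sub>R g x = 0"
  proof (subst integral_nonneg_eq_0_iff_AE[symmetric])
    show "integrable lebesgue (\<lambda>x. indicator S x *\<^sub>R g x)"
      using set_integrable_continuous[OF g] by (simp add: set_integrable_def)
    show "AE x in lebesgue. 0 \<le> indicator S x *\<^sub>R g x"
      using nonneg by (intro AE_I2) (auto simp: indicator_def)
    show "(LINT x|lebesgue. indicator S x *\<^sub>R g x) = 0"
      using zero by (simp add: set_lebesgue_integral_def)
  qed
  moreover have "{x. indicator S x *\<^sub>R g x \<noteq> 0} = S \<inter> g -` (- {0})"
    by (auto simp: indicator_def)
  moreover have op: "open (S \<inter> g -` (- {0}))"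
    using gS open_domain by (intro continuous_open_preimage) auto
  ultimately have "negligible (S \<inter> g -` (- {0}))"
    by (auto simp: negligible_iff_null_sets completion.AE_iff_null_sets)
  then have "S \<inter> g -` (- {0}) = {}" using op open_not_negligible by blast
  then have "\<And>y. y \<in> S \<Longrightarrow> g y = 0" by blast
  then show ?thesis using continuous_constant_on_closure[OF g _ x] by blast
qed

abbreviation continuous_up_to_boundary :: "(real ^ 'n \<Rightarrow> real) \<Rightarrow> bool" where
  "continuous_up_to_boundary \<equiv> continuous_on (closure S)"

lemma L2_inner_add:
  assumes "continuous_up_to_boundary u" "continuous_up_to_boundary v" "continuous_up_to_boundary w"
  shows "L2_inner S (u + v) w = L2_inner S u w + L2_inner S v w"
    and "L2_inner S w (u + v) = L2_inner S w u + L2_inner S w v"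
proof -
  show "L2_inner S (u + v) w = L2_inner S u w + L2_inner S v w"
    unfolding L2_inner_def plus_fun_apply ring_distribs
    using assms by (intro set_integral_add set_integrable_continuous continuous_on_mult)
  then show "L2_inner S w (u + v) = L2_inner S w u + L2_inner S w v"
    by (simp add: L2_inner_commute)
qed

lemma L2_inner_scale:
  "L2_inner S (\<lambda>x. c * u x) w = c * L2_inner S u w" "L2_inner S w (\<lambda>x. c * u x) = c * L2_inner S w u"
  by (simp_all add: L2_inner_def mult.assoc mult.left_commute[of _ c])

lemma L2_inner_sum:
  assumes "finite I" "continuous_up_to_boundary u" "\<And>i. i \<in> I \<Longrightarrow> continuous_up_to_boundary (g i)"
  shows "L2_inner S u (\<lambda>x. \<Sum>i\<in>I. c i * g i x) = (\<Sum>i\<in>I. c i * L2_inner S u (g i))"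
  using assms(1,3)
proof (induction I rule: finite_induct)
  case empty then show ?case by (simp add: L2_inner_def)
next
  case (insert i I)
  have "(\<lambda>x. \<Sum>i\<in>insert i I. c i * g i x) = (\<lambda>x. c i * g i x) + (\<lambda>x. \<Sum>i\<in>I. c i * g i x)"
    using insert.hyps by (simp add: fun_eq_iff)
  moreover have "L2_inner S u ((\<lambda>x. c i * g i x) + (\<lambda>x. \<Sum>i\<in>I. c i * g i x))
    = L2_inner S u (\<lambda>x. c i * g i x) + L2_inner S u (\<lambda>x. \<Sum>i\<in>I. c i * g i x)"
    using insert.prems assms(2)
    by (intro L2_inner_add continuous_on_sum continuous_on_mult continuous_on_const) auto
  ultimately show ?case
    using insert.IH insert.prems insert.hyps by (simp add: L2_inner_scale)
qed

lemma L2_inner_self_eq_0D: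
  assumes "continuous_up_to_boundary u" "L2_inner S u u = 0" "x \<in> closure S"
  shows "u x = 0"
proof -
  have "u x * u x = 0"
    using assms by (intro set_integral_continuous_eq_0D[of "\<lambda>x. u x * u x"] continuous_on_mult)
      (auto simp: L2_inner_def)
  then show ?thesis by simp
qed

lemma fe_space_continuous: "v \<in> fe_space S G M \<Longrightarrow> continuous_up_to_boundary v"
  using in_fe_space_iff continuous_on_pw_affine by blast

lemma subspace_fe_space: "fun_space.subspace (fe_space S G M)"
  by (rule fun_space.subspaceI)
    (simp_all add: in_fe_space_iff zero_fun_def plus_fun_def pw_affine_0 pw_affine_add pw_affine_scale)

lemma fe_space_subset_span: "fe_space S G M \<subseteq> fun_space.span (\<Phi> ` vertices M)"
proof
  fix v assume "v \<in> fe_space S G M"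
  then have "v x = (\<Sum>z\<in>vertices M. (\<lambda>x. v z * \<Phi> z x)) x" for x
    unfolding sum_fun_apply by (intro nodal_expansion) (auto simp: in_fe_space_iff)
  then have "v = (\<Sum>z\<in>vertices M. (\<lambda>x. v z * \<Phi> z x))" by (rule ext)
  moreover have "(\<Sum>z\<in>vertices M. (\<lambda>x. v z * \<Phi> z x)) \<in> fun_space.span (\<Phi> ` vertices M)"
    by (intro fun_space.span_sum fun_space.span_scale fun_space.span_base) auto
  ultimately show "v \<in> fun_space.span (\<Phi> ` vertices M)" by simp
qed

lemma fe_space_L2_eqI:
  assumes u: "u \<in> fe_space S G M" and v: "v \<in> fe_space S G M"
    and eq: "\<And>w. w \<in> fe_space S G M \<Longrightarrow> L2_inner S u w = L2_inner S v w"
  shows "u = v"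
proof
  fix x
  have d: "u - v \<in> fe_space S G M" using subspace_fe_space u v by (rule fun_space.subspace_diff)
  have "L2_inner S (u - v + v) (u - v) = L2_inner S (u - v) (u - v) + L2_inner S v (u - v)"
    using d u v by (intro L2_inner_add fe_space_continuous)
  then have "L2_inner S (u - v) (u - v) = 0" using eq[OF d] by simp
  note 0 = L2_inner_self_eq_0D[OF fe_space_continuous[OF d] this]
  have "(u - v) x = 0" if "x \<in> closure S" using 0[OF that] .
  then show "u x = v x" using u v by (cases "x \<in> closure S") (auto simp: in_fe_space_iff)
qed

lemma L2_projection_fe_space:
  assumes "u \<in> fe_space S G M" shows "L2_projection S (fe_space S G M) u = u"
  unfolding L2_projection_def
  using assms by (intro the_equality conjI) (auto intro: fe_space_L2_eqI)

text \<open>The function \<open>u\<close> may lie outside the space. Applied to a fine function on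
  the coarse mesh, this is the projection that yields coarse representatives.\<close>

lemma fe_space_L2_representation:
  assumes "continuous_up_to_boundary u"
  shows "\<exists>v\<in>fe_space S G M. \<forall>w\<in>fe_space S G M. L2_inner S v w = L2_inner S u w"
proof -
  have "\<exists>!q. q \<in> fe_space S G M \<and> (\<forall>w\<in>fe_space S G M. L2_inner S q w = L2_inner S u w)"
  proof (rule fun_space.form_represents_functional[OF subspace_fe_space _ fe_space_subset_span])
    show "finite (\<Phi> ` vertices M)" using finite_vertices by simp
    show "x = 0" if x: "x \<in> fe_space S G M" "L2_inner S x x = 0" for x
    proof
      fix y show "x y = 0 y"
        using x L2_inner_self_eq_0D[OF fe_space_continuous, of x G y]
        by (cases "y \<in> closure S") (auto simp: in_fe_space_iff)
    qed
  qed (use assms in \<open>simp_all add: L2_inner_add L2_inner_scale fe_space_continuous\<close>)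
  then show ?thesis by blast
qed

end

locale fitted_mesh = mesh S M for S :: "(real ^ 'n) set" and M +
  fixes G :: "(real ^ 'n) set"
  assumes fits: "fits_boundary_part M G"
begin

abbreviation "V \<equiv> fe_space S G M"
abbreviation "CH \<equiv> quasi_interpolation S G M"

lemma nodal_in_V: "z \<notin> G \<Longrightarrow> \<Phi> z \<in> V"
  using nodal_pw_affine nodal_outside nodal_zero_on_fitted_part[OF fits] by (auto simp: in_fe_space_iff)

lemma V_expansion:
  assumes "v \<in> V" shows "v = (\<lambda>x. \<Sum>z\<in>vertices M - G. v z * \<Phi> z x)"
proof
  fix x
  have "v x = (\<Sum>z\<in>vertices M. v z * \<Phi> z x)"
    using assms by (intro nodal_expansion) (auto simp: in_fe_space_iff)
  also have "\<dots> = (\<Sum>z\<in>vertices M - G. v z * \<Phi> z x)"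
    using assms finite_vertices by (intro sum.mono_neutral_right) (auto simp: in_fe_space_iff)
  finally show "v x = (\<Sum>z\<in>vertices M - G. v z * \<Phi> z x)" .
qed

text \<open>A nonnegative continuous function with integral zero vanishes, but the nodal function is
  1 at \<open>z\<close>. Hence the quotients in \<open>quasi_interpolation\<close> are
  genuine.\<close>

lemma nodal_mass_nonzero:
  assumes z: "z \<in> vertices M" shows "L2_inner S (\<lambda>x. 1) (\<Phi> z) \<noteq> 0"
proof
  assume "L2_inner S (\<lambda>x. 1) (\<Phi> z) = 0"
  then have zero: "(LINT x:S|lebesgue. \<Phi> z x) = 0" by (simp add: L2_inner_def)
  obtain T where T: "T \<in> M" "z \<in> corners T" using z by (auto simp: vertices_def corners_def)
  then have "z \<in> closure S"
    using full_simplex.corners_subset[OF full_simplex[OF T(1)]] subset_closure[OF T(1)] by blast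
  then have "\<Phi> z z = 0"
    using set_integral_continuous_eq_0D[OF continuous_on_pw_affine[OF nodal_pw_affine] nodal_nonneg zero] by blast
  then show False using z by (simp add: nodal_vertex)
qed

lemma CH_vertex:
  assumes z: "z \<in> vertices M - G"
  shows "CH u z = L2_inner S u (\<Phi> z) / L2_inner S (\<lambda>x. 1) (\<Phi> z)"
proof -
  let ?c = "\<lambda>y. L2_inner S u (\<Phi> y) / L2_inner S (\<lambda>x. 1) (\<Phi> y)"
  have "CH u z = (\<Sum>y\<in>vertices M - G. if y = z then ?c z else 0)"
    unfolding quasi_interpolation_def using z by (intro sum.cong) (auto simp: nodal_vertex)
  then show ?thesis using z finite_vertices by simp
qed

text \<open>Evaluation at the free vertices recovers the coefficients, so the operator remembers
  exactly the moments against the free nodal functions.\<close>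

lemma CH_eq_iff:
  "CH u = CH v \<longleftrightarrow> (\<forall>z\<in>vertices M - G. L2_inner S u (\<Phi> z) = L2_inner S v (\<Phi> z))"
proof
  assume eq: "CH u = CH v"
  show "\<forall>z\<in>vertices M - G. L2_inner S u (\<Phi> z) = L2_inner S v (\<Phi> z)"
  proof
    fix z assume z: "z \<in> vertices M - G"
    then show "L2_inner S u (\<Phi> z) = L2_inner S v (\<Phi> z)"
      using CH_vertex[OF z, of u] CH_vertex[OF z, of v] eq nodal_mass_nonzero[of z] by simp
  qed
qed (simp add: quasi_interpolation_def)

text \<open>The free nodal functions span \<open>V\<close>, so equal moments mean equal L2 products
  with all of \<open>V\<close>.\<close>

lemma CH_inj_on: "inj_on CH V"
proof (rule inj_onI)
  fix u v assume u: "u \<in> V" and v: "v \<in> V" and "CH u = CH v"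
  then have eq: "\<And>z. z \<in> vertices M - G \<Longrightarrow> L2_inner S u (\<Phi> z) = L2_inner S v (\<Phi> z)"
    unfolding CH_eq_iff by blast
  show "u = v"
  proof (rule fe_space_L2_eqI[OF u v])
    fix w assume w: "w \<in> V"
    have "L2_inner S x w = (\<Sum>z\<in>vertices M - G. w z * L2_inner S x (\<Phi> z))" if "x \<in> V" for x
      using that finite_vertices
      by (subst V_expansion[OF w], intro L2_inner_sum)
        (auto intro: fe_space_continuous nodal_in_V)
    then show "L2_inner S u w = L2_inner S v w" using u v eq by simp
  qed
qed

text \<open>The L2 projection onto \<open>V\<close> keeps the moments, although \<open>CH\<close> is
  in general a different operator.\<close>

lemma CH_surj:
  assumes "continuous_up_to_boundary u" shows "\<exists>v\<in>V. CH v = CH u"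
proof -
  obtain v where "v \<in> V" "\<And>w. w \<in> V \<Longrightarrow> L2_inner S v w = L2_inner S u w"
    using fe_space_L2_representation[OF assms] by blast
  then show ?thesis unfolding CH_eq_iff using nodal_in_V by blast
qed

lemma CH_add:
  assumes "continuous_up_to_boundary u" "continuous_up_to_boundary v"
  shows "CH (u + v) = CH u + CH v"
  using assms continuous_on_pw_affine[OF nodal_pw_affine]
  by (simp add: quasi_interpolation_def fun_eq_iff L2_inner_add add_divide_distrib
      ring_distribs sum.distrib)

lemma CH_scale: "CH (\<lambda>x. c * u x) = (\<lambda>x. c * CH u x)"
  by (simp add: quasi_interpolation_def fun_eq_iff L2_inner_scale sum_distrib_left mult.assoc)

end

section \<open>One-sided traces and the unit normal\<close>

text \<open>The definite description in \<open>one_sided_trace\<close> reveals nothing about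
  measurability. These means are Borel in \<open>x\<close> and converge to the trace wherever it
  exists.\<close>

definition ball_mean :: "(real ^ 'n) set \<Rightarrow> (real ^ 'n \<Rightarrow> 'b::euclidean_space) \<Rightarrow> real \<Rightarrow> real ^ 'n \<Rightarrow> 'b" where
  "ball_mean S F r x = (LINT y:S \<inter> ball x r|lebesgue. F y) /\<^sub>R measure lebesgue (S \<inter> ball x r)"

text \<open>Dominated convergence: as the centre moves, the indicators of the balls converge off the
  limiting sphere, which is negligible.\<close>

lemma continuous_on_ball_integral:
  fixes F :: "'a::euclidean_space \<Rightarrow> 'b::euclidean_space"
  assumes F: "set_integrable lebesgue S F"
  shows "continuous_on UNIV (\<lambda>x. LINT y:S \<inter> ball x r|lebesgue. F y)"
proof (intro continuous_at_imp_continuous_on ballI continuous_at_sequentiallyI)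
  fix x :: 'a and X :: "nat \<Rightarrow> 'a" assume X: "X \<longlonglongrightarrow> x"
  have eq: "indicator (S \<inter> ball z r) y *\<^sub>R F y = indicator (ball z r) y *\<^sub>R indicator S y *\<^sub>R F y" for z y
    by (auto simp: indicator_def)
  have int: "integrable lebesgue (\<lambda>y. indicator S y *\<^sub>R F y)"
    using F by (simp add: set_integrable_def)
  have meas: "(\<lambda>y. indicator (ball z r) y *\<^sub>R indicator S y *\<^sub>R F y) \<in> borel_measurable lebesgue" for z
    by (rule borel_measurable_scaleR[OF borel_measurable_indicator borel_measurable_integrable[OF int]]) simp
  show "(\<lambda>n. LINT y:S \<inter> ball (X n) r|lebesgue. F y) \<longlonglongrightarrow> (LINT y:S \<inter> ball x r|lebesgue. F y)"
    unfolding set_lebesgue_integral_def eq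
  proof (rule integral_dominated_convergence)
    show "integrable lebesgue (\<lambda>y. norm (indicator S y *\<^sub>R F y))" using int by (rule integrable_norm)
    show "AE y in lebesgue. (\<lambda>n. indicator (ball (X n) r) y *\<^sub>R indicator S y *\<^sub>R F y)
        \<longlonglongrightarrow> indicator (ball x r) y *\<^sub>R indicator S y *\<^sub>R F y"
    proof -
      have "AE y in lebesgue. y \<notin> sphere x r"
        using negligible_sphere[of x r] unfolding negligible_iff_null_sets by (rule AE_not_in)
      then show ?thesis
      proof (rule eventually_mono)
        fix y assume "y \<notin> sphere x r"
        then have ne: "dist x y \<noteq> r" by simp
        have lim: "(\<lambda>n. dist (X n) y) \<longlonglongrightarrow> dist x y" using X by (intro tendsto_intros)
        have "\<forall>\<^sub>F n in sequentially. y \<in> ball (X n) r \<longleftrightarrow> y \<in> ball x r"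
        proof (cases "dist x y < r")
          case True
          from order_tendstoD(2)[OF lim True] show ?thesis by (rule eventually_mono) (use True in auto)
        next
          case False
          then have "r < dist x y" using ne by simp
          from order_tendstoD(1)[OF lim this] show ?thesis by (rule eventually_mono) (use False in auto)
        qed
        then have "\<forall>\<^sub>F n in sequentially. indicator (ball (X n) r) y *\<^sub>R indicator S y *\<^sub>R F y
          = indicator (ball x r) y *\<^sub>R indicator S y *\<^sub>R F y"
          by (rule eventually_mono) (simp add: indicator_def)
        then show "(\<lambda>n. indicator (ball (X n) r) y *\<^sub>R indicator S y *\<^sub>R F y)
          \<longlonglongrightarrow> indicator (ball x r) y *\<^sub>R indicator S y *\<^sub>R F y"
          by (rule tendsto_eventually)
      qed
    qed
  qed (use meas in \<open>auto simp: indicator_def intro!: AE_I2\<close>)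
qed

lemma sets_Int_ball: "open S \<Longrightarrow> S \<inter> ball x r \<in> sets lebesgue" for S :: "(real ^ 'n) set"
  by (intro sets_completionI_sets) auto

lemma measure_Int_ball_pos:
  fixes S :: "(real ^ 'n) set"
  assumes "open S" "x \<in> closure S" "r > 0" shows "measure lebesgue (S \<inter> ball x r) > 0"
proof -
  have op: "open (S \<inter> ball x r)" using assms(1) by (intro open_Int open_ball)
  have "S \<inter> ball x r \<noteq> {}"
    using assms open_Int_closure_eq_empty[of "ball x r" S] by (auto simp: Int_commute)
  then have "\<not> negligible (S \<inter> ball x r)" using op open_not_negligible by blast
  moreover have "S \<inter> ball x r \<in> lmeasurable" using op by (intro lmeasurable_open) (auto intro: bounded_subset[OF bounded_ball])
  ultimately show ?thesis using negligible_iff_measure0[of "S \<inter> ball x r"]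
    by (metis measure_nonneg order_le_less negligible_iff_measure)
qed

lemma borel_measurable_ball_mean:
  fixes F :: "real ^ 'n \<Rightarrow> 'b::euclidean_space"
  assumes S: "open S" "S \<in> lmeasurable" and F: "set_integrable lebesgue S F"
  shows "ball_mean S F r \<in> borel_measurable borel"
proof -
  have "set_integrable lebesgue S (\<lambda>y. 1 :: real)"
    using S(2) by (simp add: set_integrable_def lmeasurable_iff_integrable)
  then have "continuous_on UNIV (\<lambda>x. LINT y:S \<inter> ball x r|lebesgue. 1 :: real)"
    by (rule continuous_on_ball_integral)
  moreover have "(LINT y:S \<inter> ball x r|lebesgue. 1 :: real) = measure lebesgue (S \<inter> ball x r)" for x
    by (simp add: set_lebesgue_integral_def)
  ultimately have "continuous_on UNIV (\<lambda>x. measure lebesgue (S \<inter> ball x r))" by simp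
  then have "(\<lambda>x. measure lebesgue (S \<inter> ball x r)) \<in> borel_measurable borel"
    by (rule borel_measurable_continuous_onI)
  moreover have "(\<lambda>x. LINT y:S \<inter> ball x r|lebesgue. F y) \<in> borel_measurable borel"
    by (rule borel_measurable_continuous_onI[OF continuous_on_ball_integral[OF F]])
  ultimately show ?thesis
    unfolding ball_mean_def[abs_def] by (intro borel_measurable_scaleR borel_measurable_inverse)
qed

text \<open>The distance from the mean to \<open>L\<close> is at most the mean deviation from
  \<open>L\<close>. As a limit, the trace is then unique.\<close>

lemma has_trace_imp_ball_mean:
  fixes F :: "real ^ 'n \<Rightarrow> 'b::euclidean_space"
  assumes S: "open S" "x \<in> closure S" and F: "set_integrable lebesgue S F" and tr: "has_trace S F x L"
  shows "((\<lambda>r. ball_mean S F r x) \<longlongrightarrow> L) (at_right 0)"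
proof -
  have "((\<lambda>r. ball_mean S F r x - L) \<longlongrightarrow> 0) (at_right 0)"
  proof (rule tendsto_norm_zero_cancel, rule tendsto_sandwich[OF _ _ tendsto_const])
    show "\<forall>\<^sub>F r in at_right 0. norm (ball_mean S F r x - L)
      \<le> (LINT y:S \<inter> ball x r|lebesgue. norm (F y - L)) / measure lebesgue (S \<inter> ball x r)"
      unfolding eventually_at_right_field
    proof (intro exI[of _ 1] conjI allI impI)
      fix r :: real assume r: "0 < r"
      let ?B = "S \<inter> ball x r" and ?m = "measure lebesgue (S \<inter> ball x r)"
      have m: "?m > 0" using S r by (rule measure_Int_ball_pos)
      have iF: "set_integrable lebesgue ?B F"
        by (rule set_integrable_subset[OF F sets_Int_ball[OF S(1)]]) auto
      have B: "?B \<in> lmeasurable"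
        using S(1) by (intro lmeasurable_open) (auto intro: bounded_subset[OF bounded_ball])
      then have "integrable lebesgue (\<lambda>y. indicat_real ?B y)" by (simp add: lmeasurable_iff_integrable)
      then have iL: "set_integrable lebesgue ?B (\<lambda>y. L)"
        unfolding set_integrable_def by (rule integrable_scaleR_left)
      have "(LINT y:?B|lebesgue. L) = ?m *\<^sub>R L"
        unfolding set_lebesgue_integral_def using \<open>integrable lebesgue (\<lambda>y. indicat_real ?B y)\<close> by simp
      then have "ball_mean S F r x - L = (LINT y:?B|lebesgue. F y - L) /\<^sub>R ?m"
        unfolding ball_mean_def set_integral_diff(2)[OF iF iL] using m by (simp add: scaleR_diff_right)
      then have "norm (ball_mean S F r x - L) = norm (LINT y:?B|lebesgue. F y - L) / ?m"
        using m by (simp add: divide_inverse_commute)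
      also have "norm (LINT y:?B|lebesgue. F y - L) \<le> (LINT y:?B|lebesgue. norm (F y - L))"
        by (rule set_integral_norm_bound[OF set_integral_diff(1)[OF iF iL]])
      finally show "norm (ball_mean S F r x - L) \<le> (LINT y:?B|lebesgue. norm (F y - L)) / ?m"
        using m by (simp add: divide_right_mono)
    qed simp
  qed (use tr in \<open>auto simp: has_trace_def\<close>)
  then show ?thesis by (rule LIM_zero_cancel)
qed

lemma one_sided_trace_eq:
  fixes F :: "real ^ 'n \<Rightarrow> 'b::euclidean_space"
  assumes "open S" "x \<in> closure S" "set_integrable lebesgue S F" "has_trace S F x L"
  shows "one_sided_trace S F x = L"
  unfolding one_sided_trace_def
proof (rule the_equality[where P = "\<lambda>L. has_trace S F x L", OF assms(4)])
  fix L' assume "has_trace S F x L'"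
  from has_trace_imp_ball_mean[OF assms(1-3) this] has_trace_imp_ball_mean[OF assms]
  show "L' = L" by (rule tendsto_unique[rotated]) simp
qed

lemma bounded_bilinear_matrix_vector_mult:
  "bounded_bilinear (\<lambda>(A :: real ^ 'n ^ 'm) (v :: real ^ 'n). A *v v)"
  unfolding bilinear_conv_bounded_bilinear[symmetric] bilinear_def
  by (auto intro!: linearI simp: matrix_vector_mult_add_rdistrib matrix_vector_right_distrib
      scaleR_matrix_vector_assoc matrix_vector_mult_scaleR)

lemma borel_measurable_matrix_vector_mult:
  assumes "A \<in> borel_measurable N" "v \<in> borel_measurable N"
  shows "(\<lambda>y. (A y :: real ^ 'n ^ 'm) *v v y) \<in> borel_measurable N"
proof (rule borel_measurable_continuous_Pair[OF assms])
  show "continuous_on UNIV (\<lambda>p. (fst p :: real ^ 'n ^ 'm) *v snd p)"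
    by (intro bounded_bilinear.continuous_on[OF bounded_bilinear_matrix_vector_mult] continuous_intros)
qed

lemma (in complete_measure) measurable_AE_eq:
  assumes f: "f \<in> measurable M N" and g: "g \<in> space M \<rightarrow> space N" and ae: "AE x in M. f x = g x"
  shows "g \<in> measurable M N"
proof (rule measurableI)
  show "g x \<in> space N" if "x \<in> space M" for x using g that by blast
  fix A assume "A \<in> sets N"
  then have mem: "f -` A \<inter> space M \<in> sets M" using f by (rule measurable_sets[rotated])
  have AE_mem: "AE x in M. x \<in> f -` A \<inter> space M \<longleftrightarrow> x \<in> g -` A \<inter> space M"
    using ae by (rule eventually_mono) auto
  show "g -` A \<inter> space M \<in> sets M" by (rule in_sets_AE[OF AE_mem mem]) auto
qed

text \<open>Where no normal in the sense of \<^const>\<open>unit_normal\<close> exists, the definite description is taken of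
  the empty predicate and hence has a fixed value.\<close>

locale interface =
  fixes S1 S2 :: "(real ^ 'n) set"
  assumes open_sides: "open S1" "open S2"
begin

definition \<Gamma> :: "(real ^ 'n) set" where "\<Gamma> = frontier S1 \<inter> frontier S2"

definition is_normal :: "real ^ 'n \<Rightarrow> real ^ 'n \<Rightarrow> bool" where
  "is_normal x n \<longleftrightarrow> norm n = 1 \<and> (\<exists>e>0.
     S1 \<inter> ball x e = {y \<in> ball x e. (y - x) \<bullet> n < 0} \<and>
     S2 \<inter> ball x e = {y \<in> ball x e. (y - x) \<bullet> n > 0})"

lemma unit_normal_eq_The: "unit_normal S1 S2 x = (THE n. is_normal x n)"
  by (simp add: unit_normal_def is_normal_def)

text \<open>Moving from \<open>x\<close> along \<open>n' - n\<close> decreases the product with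
  \<open>n\<close> and increases that with \<open>n'\<close>, so the point reached would lie in
  \<open>S1\<close> by the first description and outside it by the second.\<close>

lemma is_normal_unique:
  assumes "is_normal x n" "is_normal x n'" shows "n = n'"
proof (rule ccontr)
  assume ne: "n \<noteq> n'"
  obtain e where e: "e > 0" "S1 \<inter> ball x e = {y \<in> ball x e. (y - x) \<bullet> n < 0}"
    using assms(1) unfolding is_normal_def by blast
  obtain e' where e': "e' > 0" "S1 \<inter> ball x e' = {y \<in> ball x e'. (y - x) \<bullet> n' < 0}"
    using assms(2) unfolding is_normal_def by blast
  have n: "n \<bullet> n = 1" "n' \<bullet> n' = 1" using assms by (auto simp: is_normal_def norm_eq_1)
  have "0 < (n - n') \<bullet> (n - n')" using ne by simp
  then have lt: "n \<bullet> n' < 1" using n by (simp add: inner_diff inner_commute)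
  define t where "t = min e e' / (2 * norm (n' - n))"
  have t: "t > 0" "t * norm (n' - n) < min e e'" using e e' ne by (auto simp: t_def)
  define y where "y = x + t *\<^sub>R (n' - n)"
  have y: "y \<in> ball x e" "y \<in> ball x e'" using t by (auto simp: y_def dist_norm)
  have "t * (n \<bullet> n' - 1) < 0" "0 < t * (1 - n \<bullet> n')" using t(1) lt by (simp_all add: mult_less_0_iff)
  then have "(y - x) \<bullet> n < 0" "(y - x) \<bullet> n' > 0"
    using n by (simp_all add: y_def inner_diff_left inner_diff_right inner_commute)
  then have "y \<in> S1" "y \<notin> S1" using y e(2) e'(2) by force+
  then show False by simp
qed

lemma unit_normal_eq: "is_normal x n \<Longrightarrow> unit_normal S1 S2 x = n"
  unfolding unit_normal_eq_The by (rule the_equality) (auto intro: is_normal_unique)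

definition \<Gamma>\<^sub>n :: "(real ^ 'n) set" where "\<Gamma>\<^sub>n = {x \<in> \<Gamma>. \<exists>n. is_normal x n}"

lemma unit_normal_junk: "x \<notin> \<Gamma>\<^sub>n \<Longrightarrow> x \<in> \<Gamma> \<Longrightarrow> unit_normal S1 S2 x = (THE n. False)"
proof -
  assume "x \<notin> \<Gamma>\<^sub>n" "x \<in> \<Gamma>"
  then have "is_normal x = (\<lambda>n. False)" by (auto simp: \<Gamma>\<^sub>n_def)
  then show ?thesis unfolding unit_normal_eq_The by simp
qed

text \<open>A nearby interface point lies in neither open side, hence in the hyperplane through
  \<open>x\<close>; moving the centre within that hyperplane keeps the two half-spaces.\<close>

lemma is_normal_nearby:
  assumes x: "x \<in> \<Gamma>" "is_normal x n"
  shows "\<exists>e>0. \<forall>z\<in>\<Gamma> \<inter> ball x e. is_normal z n"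
proof -
  obtain e where e: "e > 0" "S1 \<inter> ball x e = {y \<in> ball x e. (y - x) \<bullet> n < 0}"
      "S2 \<inter> ball x e = {y \<in> ball x e. (y - x) \<bullet> n > 0}" and n: "norm n = 1"
    using x(2) unfolding is_normal_def by blast
  have "is_normal z n" if z: "z \<in> \<Gamma>" "z \<in> ball x e" for z
  proof -
    have "z \<notin> S1" "z \<notin> S2"
      using z(1) open_sides by (auto simp: \<Gamma>_def frontier_def interior_open)
    then have "(z - x) \<bullet> n = 0" using z(2) e(2,3) by force
    then have shift: "(y - z) \<bullet> n = (y - x) \<bullet> n" for y by (simp add: inner_diff_left)
    obtain d where d: "d > 0" "ball z d \<subseteq> ball x e" using z(2) open_ball openE by metis
    have "S1 \<inter> ball z d = {y \<in> ball z d. (y - z) \<bullet> n < 0}"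
      "S2 \<inter> ball z d = {y \<in> ball z d. (y - z) \<bullet> n > 0}"
      unfolding shift using d(2) e(2,3) by blast+
    then show ?thesis using d(1) n unfolding is_normal_def by blast
  qed
  then show ?thesis using e(1) by blast
qed

lemma closed_\<Gamma>: "closed \<Gamma>"
  unfolding \<Gamma>_def by (intro closed_Int frontier_closed)

lemma borel_\<Gamma>\<^sub>n: "\<Gamma>\<^sub>n \<in> sets borel"
proof -
  have "openin (top_of_set \<Gamma>) \<Gamma>\<^sub>n"
    unfolding openin_contains_ball
  proof (intro conjI ballI)
    show "\<Gamma>\<^sub>n \<subseteq> \<Gamma>" by (auto simp: \<Gamma>\<^sub>n_def)
    fix x assume "x \<in> \<Gamma>\<^sub>n"
    then obtain n where "x \<in> \<Gamma>" "is_normal x n" by (auto simp: \<Gamma>\<^sub>n_def)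
    then obtain e where "e > 0" "\<forall>z\<in>\<Gamma> \<inter> ball x e. is_normal z n" using is_normal_nearby by blast
    then show "\<exists>e>0. ball x e \<inter> \<Gamma> \<subseteq> \<Gamma>\<^sub>n" by (intro exI[of _ e]) (auto simp: \<Gamma>\<^sub>n_def)
  qed
  then obtain U where "open U" "\<Gamma>\<^sub>n = \<Gamma> \<inter> U" by (auto simp: openin_open)
  then show ?thesis using closed_\<Gamma> by (auto intro: borel_closed borel_open)
qed

lemma continuous_on_unit_normal: "continuous_on \<Gamma>\<^sub>n (unit_normal S1 S2)"
  unfolding continuous_on_def
proof
  fix x assume x: "x \<in> \<Gamma>\<^sub>n"
  then obtain n where n: "x \<in> \<Gamma>" "is_normal x n" by (auto simp: \<Gamma>\<^sub>n_def)
  obtain e where e: "e > 0" "\<forall>z\<in>\<Gamma> \<inter> ball x e. is_normal z n" using is_normal_nearby[OF n] by blast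
  have "\<forall>\<^sub>F z in at x within \<Gamma>\<^sub>n. unit_normal S1 S2 z = unit_normal S1 S2 x"
    unfolding eventually_at_topological
  proof (intro exI[of _ "ball x e"] conjI ballI impI)
    fix z assume "z \<in> ball x e" "z \<in> \<Gamma>\<^sub>n"
    then have "is_normal z n" using e(2) by (auto simp: \<Gamma>\<^sub>n_def)
    then show "unit_normal S1 S2 z = unit_normal S1 S2 x" using n(2) unit_normal_eq by simp
  qed (use e(1) in auto)
  then show "(unit_normal S1 S2 \<longlongrightarrow> unit_normal S1 S2 x) (at x within \<Gamma>\<^sub>n)"
    by (rule tendsto_eventually)
qed

lemma borel_measurable_unit_normal:
  "(\<lambda>x. indicator \<Gamma> x *\<^sub>R unit_normal S1 S2 x) \<in> borel_measurable borel"
proof -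
  have "(\<lambda>x. indicator \<Gamma>\<^sub>n x *\<^sub>R unit_normal S1 S2 x + indicator (\<Gamma> - \<Gamma>\<^sub>n) x *\<^sub>R (THE n. False))
    \<in> borel_measurable borel"
    using borel_\<Gamma>\<^sub>n borel_closed[OF closed_\<Gamma>]
    by (intro borel_measurable_add borel_measurable_continuous_on_indicator continuous_on_unit_normal
        borel_measurable_scaleR borel_measurable_indicator borel_measurable_const sets.Diff)
  moreover have "(\<lambda>x. indicator \<Gamma>\<^sub>n x *\<^sub>R unit_normal S1 S2 x + indicator (\<Gamma> - \<Gamma>\<^sub>n) x *\<^sub>R (THE n. False))
    = (\<lambda>x. indicator \<Gamma> x *\<^sub>R unit_normal S1 S2 x)"
  proof
    fix x
    have "x \<in> \<Gamma>\<^sub>n \<Longrightarrow> x \<in> \<Gamma>" by (simp add: \<Gamma>\<^sub>n_def)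
    then show "indicator \<Gamma>\<^sub>n x *\<^sub>R unit_normal S1 S2 x + indicator (\<Gamma> - \<Gamma>\<^sub>n) x *\<^sub>R (THE n. False)
      = indicator \<Gamma> x *\<^sub>R unit_normal S1 S2 x"
      using unit_normal_junk[of x] by (auto simp: indicator_def)
  qed
  ultimately show ?thesis by simp
qed

text \<open>The second entry of the maximum is the norm of the fixed value taken where no normal
  exists.\<close>

lemma norm_unit_normal_le:
  "x \<in> \<Gamma> \<Longrightarrow> norm (unit_normal S1 S2 x) \<le> max 1 (norm (THE n :: real ^ 'n. False))"
proof (cases "x \<in> \<Gamma>\<^sub>n")
  case True
  then obtain n where "is_normal x n" by (auto simp: \<Gamma>\<^sub>n_def)
  then show ?thesis using unit_normal_eq[of x n] by (simp add: is_normal_def)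
next
  case False
  assume "x \<in> \<Gamma>"
  then show ?thesis using unit_normal_junk[OF False] by simp
qed

end

section \<open>Energy and flux of piecewise affine functions\<close>

text \<open>Completeness of Lebesgue measure transfers measurability from \<open>f\<close> to
  \<open>g\<close>. Integrands containing \<open>grad\<close> inherit it in this way from their
  versions with \<open>pw_grad\<close>.\<close>

lemma integral_AE_eq_lebesgue:
  fixes f g :: "'a::euclidean_space \<Rightarrow> 'b::{banach, second_countable_topology}"
  assumes f: "set_integrable lebesgue S f" and ae: "AE x in lebesgue. x \<in> S \<longrightarrow> f x = g x"
  shows "set_integrable lebesgue S g" "(LINT x:S|lebesgue. f x) = (LINT x:S|lebesgue. g x)"
proof -
  have ae': "AE x in lebesgue. indicator S x *\<^sub>R f x = indicator S x *\<^sub>R g x"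
    using ae by (rule eventually_mono) (auto simp: indicator_def)
  have mf: "(\<lambda>x. indicator S x *\<^sub>R f x) \<in> borel_measurable lebesgue"
    using f unfolding set_integrable_def by (rule borel_measurable_integrable)
  have mg: "(\<lambda>x. indicator S x *\<^sub>R g x) \<in> borel_measurable lebesgue"
    by (rule completion.measurable_AE_eq[OF mf _ ae']) auto
  show "set_integrable lebesgue S g"
    using f integrable_cong_AE[OF mf mg ae'] unfolding set_integrable_def by simp
  show "(LINT x:S|lebesgue. f x) = (LINT x:S|lebesgue. g x)"
    unfolding set_lebesgue_integral_def by (rule integral_cong_AE[OF mf mg ae'])
qed

lemma AE_bounded_set_integrable_lebesgue:
  fixes f :: "'a::euclidean_space \<Rightarrow> 'b::{banach, second_countable_topology}"
  assumes S: "S \<in> lmeasurable" and f: "(\<lambda>x. indicator S x *\<^sub>R f x) \<in> borel_measurable lebesgue"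
    and B: "AE x in lebesgue. x \<in> S \<longrightarrow> norm (f x) \<le> B"
  shows "set_integrable lebesgue S f"
  unfolding set_integrable_def
proof (rule Bochner_Integration.integrable_bound)
  show "integrable lebesgue (\<lambda>x. B * indicat_real S x)"
    using S by (intro integrable_mult_right) (simp add: lmeasurable_iff_integrable)
  show "AE x in lebesgue. norm (indicator S x *\<^sub>R f x) \<le> norm (B * indicat_real S x)"
    using B by (rule eventually_mono) (auto simp: indicator_def)
qed (rule f)

locale coefficient_mesh = mesh S M for S :: "(real ^ 'n) set" and M +
  fixes A :: "real ^ 'n \<Rightarrow> real ^ 'n ^ 'n"
  assumes A_measurable: "(\<lambda>x. indicator S x *\<^sub>R A x) \<in> borel_measurable lebesgue"
    and A_bounded: "\<exists>B. AE x in lebesgue. x \<in> S \<longrightarrow> norm (A x) \<le> B"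
begin

lemma grad_AE:
  assumes "pw_affine M v" shows "AE x in lebesgue. x \<in> S \<longrightarrow> grad v x = pw_grad v x"
proof -
  have "AE x in lebesgue. x \<notin> mesh_frontier"
    using negligible_mesh_frontier unfolding negligible_iff_null_sets by (rule AE_not_in)
  then show ?thesis
  proof (rule eventually_mono, intro impI)
    fix x assume "x \<notin> mesh_frontier" "x \<in> S"
    then obtain T where T: "T \<in> M" "x \<in> interior T" using in_some_interior by blast
    then show "grad v x = pw_grad v x" using grad_interior[OF assms T] pw_grad_interior[OF T] by simp
  qed
qed

lemma pw_grad_add:
  assumes "pw_affine M u" "pw_affine M v"
  shows "pw_grad (u + v) x = pw_grad u x + pw_grad v x"
  using elem_grad_add[OF assms] unfolding pw_grad_def plus_fun_def
  by (simp add: scaleR_add_right sum.distrib)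

lemma pw_grad_scale:
  assumes "pw_affine M u" shows "pw_grad (\<lambda>x. c * u x) x = c *\<^sub>R pw_grad u x"
  using elem_grad_scale[OF assms] unfolding pw_grad_def
  by (simp add: scaleR_sum_right mult.commute)

definition flux :: "(real ^ 'n \<Rightarrow> real) \<Rightarrow> real ^ 'n \<Rightarrow> real ^ 'n" where
  "flux v y = A y *v grad v y"

definition pw_flux :: "(real ^ 'n \<Rightarrow> real) \<Rightarrow> real ^ 'n \<Rightarrow> real ^ 'n" where
  "pw_flux v y = A y *v pw_grad v y"

lemma flux_AE: "pw_affine M v \<Longrightarrow> AE x in lebesgue. x \<in> S \<longrightarrow> pw_flux v x = flux v x"
  by (rule eventually_mono[OF grad_AE]) (auto simp: flux_def pw_flux_def)

lemma lebesgue_pw_grad: "pw_grad v \<in> borel_measurable lebesgue"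
  by (rule measurable_completion) (simp add: borel_measurable_pw_grad)

lemma pw_flux_measurable: "(\<lambda>x. indicator S x *\<^sub>R pw_flux v x) \<in> borel_measurable lebesgue"
proof -
  have "(\<lambda>x. (indicator S x *\<^sub>R A x) *v pw_grad v x) \<in> borel_measurable lebesgue"
    by (rule borel_measurable_matrix_vector_mult[OF A_measurable lebesgue_pw_grad])
  then show ?thesis by (simp add: pw_flux_def scaleR_matrix_vector_assoc)
qed

lemma pw_flux_bounded: "\<exists>B. B \<ge> 0 \<and> (AE x in lebesgue. x \<in> S \<longrightarrow> norm (pw_flux v x) \<le> B)"
proof -
  obtain B where B: "AE x in lebesgue. x \<in> S \<longrightarrow> norm (A x) \<le> B" using A_bounded by blast
  obtain K where K: "K > 0" "\<And>(C :: real ^ 'n ^ 'n) (w :: real ^ 'n). norm (C *v w) \<le> norm C * norm w * K"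
    using bounded_bilinear.pos_bounded[OF bounded_bilinear_matrix_vector_mult] by blast
  let ?L = "\<Sum>T\<in>M. norm (elem_grad v T)"
  have L: "0 \<le> ?L" by (simp add: sum_nonneg)
  have "AE x in lebesgue. x \<in> S \<longrightarrow> norm (pw_flux v x) \<le> \<bar>B\<bar> * ?L * K"
    using B
  proof (rule eventually_mono, intro impI)
    fix x assume "x \<in> S \<longrightarrow> norm (A x) \<le> B" "x \<in> S"
    then have "norm (A x) \<le> \<bar>B\<bar>" by simp
    then have "norm (A x) * norm (pw_grad v x) * K \<le> \<bar>B\<bar> * ?L * K"
      using K(1) norm_pw_grad_le[of v x] by (intro mult_right_mono mult_mono) auto
    then show "norm (pw_flux v x) \<le> \<bar>B\<bar> * ?L * K"
      using K(2)[of "A x" "pw_grad v x"] by (simp add: pw_flux_def)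
  qed
  then show ?thesis using L K(1) by (intro exI[of _ "\<bar>B\<bar> * ?L * K"]) simp
qed

lemma set_integrable_pw_flux: "set_integrable lebesgue S (pw_flux v)"
  using AE_bounded_set_integrable_lebesgue[OF lmeasurable_domain pw_flux_measurable] pw_flux_bounded by blast

lemma set_integrable_flux: "pw_affine M v \<Longrightarrow> set_integrable lebesgue S (flux v)"
  using integral_AE_eq_lebesgue(1)[OF set_integrable_pw_flux flux_AE] .

lemma set_integrable_A: "set_integrable lebesgue S A"
  using AE_bounded_set_integrable_lebesgue[OF lmeasurable_domain A_measurable] A_bounded by blast

definition energy :: "(real ^ 'n \<Rightarrow> real) \<Rightarrow> (real ^ 'n \<Rightarrow> real) \<Rightarrow> real" where
  "energy u v = (LINT x:S|lebesgue. (A x *v grad u x) \<bullet> grad v x)"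

lemma set_integrable_pw_energy: "set_integrable lebesgue S (\<lambda>x. pw_flux u x \<bullet> pw_grad v x)"
proof -
  have m: "(\<lambda>x. indicator S x *\<^sub>R (pw_flux u x \<bullet> pw_grad v x)) \<in> borel_measurable lebesgue"
  proof -
    have "(\<lambda>x. (indicator S x *\<^sub>R pw_flux u x) \<bullet> pw_grad v x) \<in> borel_measurable lebesgue"
      by (rule borel_measurable_inner[OF pw_flux_measurable lebesgue_pw_grad])
    then show ?thesis by simp
  qed
  obtain B where B: "B \<ge> 0" "AE x in lebesgue. x \<in> S \<longrightarrow> norm (pw_flux u x) \<le> B"
    using pw_flux_bounded by blast
  show ?thesis
  proof (rule AE_bounded_set_integrable_lebesgue[OF lmeasurable_domain m])
    show "AE x in lebesgue. x \<in> S \<longrightarrow> norm (pw_flux u x \<bullet> pw_grad v x) \<le> B * (\<Sum>T\<in>M. norm (elem_grad v T))"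
      using B(2)
    proof (rule eventually_mono, intro impI)
      fix x assume "x \<in> S \<longrightarrow> norm (pw_flux u x) \<le> B" "x \<in> S"
      then have "norm (pw_flux u x) * norm (pw_grad v x) \<le> B * (\<Sum>T\<in>M. norm (elem_grad v T))"
        using B(1) norm_pw_grad_le[of v x] by (intro mult_mono) auto
      then show "norm (pw_flux u x \<bullet> pw_grad v x) \<le> B * (\<Sum>T\<in>M. norm (elem_grad v T))"
        using Cauchy_Schwarz_ineq2[of "pw_flux u x" "pw_grad v x"] by simp
    qed
  qed
qed

lemma energy_eq:
  assumes "pw_affine M u" "pw_affine M v"
  shows "set_integrable lebesgue S (\<lambda>x. (A x *v grad u x) \<bullet> grad v x)"
    "energy u v = (LINT x:S|lebesgue. pw_flux u x \<bullet> pw_grad v x)"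
proof -
  have "AE x in lebesgue. x \<in> S \<longrightarrow> pw_flux u x \<bullet> pw_grad v x = (A x *v grad u x) \<bullet> grad v x"
    using grad_AE[OF assms(1)] grad_AE[OF assms(2)]
    by eventually_elim (simp add: pw_flux_def)
  from integral_AE_eq_lebesgue[OF set_integrable_pw_energy this]
  show "set_integrable lebesgue S (\<lambda>x. (A x *v grad u x) \<bullet> grad v x)"
    "energy u v = (LINT x:S|lebesgue. pw_flux u x \<bullet> pw_grad v x)"
    by (simp_all add: energy_def)
qed

lemma energy_add:
  assumes "pw_affine M u" "pw_affine M v" "pw_affine M w"
  shows "energy (u + v) w = energy u w + energy v w"
proof -
  have uv: "pw_affine M (u + v)" using pw_affine_add[OF assms(1,2)] by (simp add: plus_fun_def)
  have "pw_flux (u + v) x \<bullet> pw_grad w x = pw_flux u x \<bullet> pw_grad w x + pw_flux v x \<bullet> pw_grad w x" for x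
    by (simp add: pw_flux_def pw_grad_add[OF assms(1,2)] matrix_vector_right_distrib inner_add_left)
  then show ?thesis
    by (simp add: energy_eq(2) uv assms set_integral_add(2)[OF set_integrable_pw_energy set_integrable_pw_energy])
qed

lemma energy_scale:
  assumes "pw_affine M u" "pw_affine M w"
  shows "energy (\<lambda>x. c * u x) w = c * energy u w"
proof -
  have "pw_flux (\<lambda>x. c * u x) x \<bullet> pw_grad w x = c * (pw_flux u x \<bullet> pw_grad w x)" for x
    by (simp add: pw_flux_def pw_grad_scale[OF assms(1)] matrix_vector_mult_scaleR)
  then show ?thesis by (simp add: energy_eq(2) pw_affine_scale assms)
qed

lemma energy_commute:
  assumes sym: "\<And>x. x \<in> S \<Longrightarrow> transpose (A x) = A x"
  shows "energy u v = energy v u"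
  unfolding energy_def
proof (rule set_lebesgue_integral_cong)
  show "S \<in> sets lebesgue" by (rule sets_domain)
  have "(A x *v grad u x) \<bullet> grad v x = (A x *v grad v x) \<bullet> grad u x" if "x \<in> S" for x
    using dot_lmul_matrix[of "grad u x" "A x" "grad v x"] transpose_matrix_vector[of "A x" "grad u x"] sym[OF that]
    by (simp add: inner_commute)
  then show "\<forall>x. x \<in> S \<longrightarrow> (A x *v grad u x) \<bullet> grad v x = (A x *v grad v x) \<bullet> grad u x" by blast
qed

text \<open>The gradient vanishes almost everywhere in \<open>S\<close>, and the interior of each
  element meets \<open>S\<close> in a nonempty open set. As the gradient is constant there, one
  non-exceptional point suffices.\<close>

lemma energy_zero_imp_pw_grad_zero:
  assumes v: "pw_affine M v" and zero: "energy v v = 0"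
    and nonneg: "\<And>x w. x \<in> S \<Longrightarrow> 0 \<le> (A x *v w) \<bullet> w"
    and definite: "\<And>x w. x \<in> S \<Longrightarrow> (A x *v w) \<bullet> w = 0 \<Longrightarrow> w = 0"
    and T: "T \<in> M"
  shows "elem_grad v T = 0"
proof -
  have "AE x in lebesgue. indicator S x *\<^sub>R ((A x *v grad v x) \<bullet> grad v x) = 0"
  proof (subst integral_nonneg_eq_0_iff_AE[symmetric])
    show "integrable lebesgue (\<lambda>x. indicator S x *\<^sub>R ((A x *v grad v x) \<bullet> grad v x))"
      using energy_eq(1)[OF v v] by (simp add: set_integrable_def)
    show "AE x in lebesgue. 0 \<le> indicator S x *\<^sub>R ((A x *v grad v x) \<bullet> grad v x)"
      using nonneg by (intro AE_I2) (auto simp: indicator_def)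
    show "(LINT x|lebesgue. indicator S x *\<^sub>R ((A x *v grad v x) \<bullet> grad v x)) = 0"
      using zero by (simp add: set_lebesgue_integral_def energy_def)
  qed
  then have "AE x in lebesgue. x \<in> S \<longrightarrow> grad v x = 0"
    by (rule eventually_mono) (auto simp: indicator_def intro: definite split: if_splits)
  then have null: "{x. \<not> (x \<in> S \<longrightarrow> grad v x = 0)} \<in> null_sets lebesgue"
    by (simp add: completion.AE_iff_null_sets)
  have "S \<inter> interior T \<noteq> {}"
  proof -
    have "interior T \<inter> closure S \<noteq> {}"
      using full_simplex.nonempty_interior[OF full_simplex[OF T]] interior_subset[of T] subset_closure[OF T] by blast
    then show ?thesis using open_Int_closure_eq_empty[of "interior T" S] by (simp add: Int_commute)
  qed
  moreover have "open (S \<inter> interior T)" using open_domain by (intro open_Int open_interior)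
  ultimately have "\<not> negligible (S \<inter> interior T)" using open_not_negligible by blast
  moreover have "S \<inter> interior T \<subseteq> {x. \<not> (x \<in> S \<longrightarrow> grad v x = 0)}" if "elem_grad v T \<noteq> 0"
    using grad_interior[OF v T] that by auto
  ultimately show ?thesis
    using null negligible_subset unfolding negligible_iff_null_sets[symmetric] by blast
qed

text \<open>At such points only one element is near \<open>x\<close>, so the trace of a flux reduces
  to the trace of the coefficient.\<close>

definition regular_trace :: "real ^ 'n \<Rightarrow> bool" where
  "regular_trace x \<longleftrightarrow> x \<in> closure S \<and> (\<exists>!T. T \<in> M \<and> x \<in> T) \<and> (\<exists>B. has_trace S A x B)"

text \<open>The other elements form a closed set missing \<open>x\<close>, so near \<open>x\<close>
  the domain lies in the interior of \<open>T\<close>. There the deviation of the flux is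
  \<open>A y - B\<close> applied to a fixed vector.\<close>

lemma has_trace_flux:
  assumes v: "pw_affine M v" and x: "x \<in> closure S" and T: "T \<in> M" "x \<in> T"
    and unique: "\<And>T'. T' \<in> M \<Longrightarrow> x \<in> T' \<Longrightarrow> T' = T" and B: "has_trace S A x B"
  shows "has_trace S (flux v) x (B *v elem_grad v T)"
proof -
  let ?a = "elem_grad v T"
  obtain K where K: "K > 0" "\<And>(C :: real ^ 'n ^ 'n) (w :: real ^ 'n). norm (C *v w) \<le> norm C * norm w * K"
    using bounded_bilinear.pos_bounded[OF bounded_bilinear_matrix_vector_mult] by blast
  have "closed (\<Union>(M - {T}))"
    using finite_mesh full_simplex.closed[OF full_simplex] by (intro closed_Union) auto
  then have "open (- \<Union>(M - {T}))" by (rule open_Compl)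
  moreover have "x \<in> - \<Union>(M - {T})" using unique by blast
  ultimately obtain e where e: "e > 0" "ball x e \<subseteq> - \<Union>(M - {T})" by (rule openE)
  have inside: "S \<inter> ball x e \<subseteq> interior T"
  proof (rule interior_maximal)
    show "S \<inter> ball x e \<subseteq> T" using e(2) Union_mesh closure_subset[of S] by blast
    show "open (S \<inter> ball x e)" using open_domain by (intro open_Int open_ball)
  qed
  show ?thesis unfolding has_trace_def
  proof (rule tendsto_sandwich[OF _ _ tendsto_const])
    let ?c = "norm ?a * K"
    show "((\<lambda>r. ?c * ((LINT y:S \<inter> ball x r|lebesgue. norm (A y - B)) / measure lebesgue (S \<inter> ball x r)))
        \<longlongrightarrow> 0) (at_right 0)"
      using tendsto_mult_right_zero[OF B[unfolded has_trace_def], of ?c] .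
    show "\<forall>\<^sub>F r in at_right 0. 0 \<le> (LINT y:S \<inter> ball x r|lebesgue. norm (flux v y - B *v ?a)) / measure lebesgue (S \<inter> ball x r)"
      unfolding set_lebesgue_integral_def
      by (intro always_eventually allI divide_nonneg_nonneg Bochner_Integration.integral_nonneg) auto
    show "\<forall>\<^sub>F r in at_right 0. (LINT y:S \<inter> ball x r|lebesgue. norm (flux v y - B *v ?a)) / measure lebesgue (S \<inter> ball x r)
      \<le> ?c * ((LINT y:S \<inter> ball x r|lebesgue. norm (A y - B)) / measure lebesgue (S \<inter> ball x r))"
      unfolding eventually_at_right_field
    proof (intro exI[of _ e] conjI allI impI e(1))
      fix r assume r: "0 < r" "r < e"
      let ?B = "S \<inter> ball x r"
      have sets: "?B \<in> sets lebesgue" using open_domain by (rule sets_Int_ball)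
      have "?B \<in> lmeasurable" using lmeasurable_domain by (rule fmeasurable_Int_fmeasurable) simp
      then have const: "set_integrable lebesgue ?B (\<lambda>y. c)" for c :: "'d::euclidean_space"
        unfolding set_integrable_def by (intro integrable_scaleR_left) (simp add: lmeasurable_iff_integrable)
      have i1: "set_integrable lebesgue ?B (\<lambda>y. norm (flux v y - B *v ?a))"
        by (intro set_integrable_norm set_integral_diff(1) const
            set_integrable_subset[OF set_integrable_flux[OF v] sets]) simp
      have i2: "set_integrable lebesgue ?B (\<lambda>y. norm (A y - B))"
        by (intro set_integrable_norm set_integral_diff(1) const
            set_integrable_subset[OF set_integrable_A sets]) simp
      have "(LINT y:?B|lebesgue. norm (flux v y - B *v ?a)) \<le> (LINT y:?B|lebesgue. ?c * norm (A y - B))"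
      proof (rule set_integral_mono[OF i1])
        show "set_integrable lebesgue ?B (\<lambda>y. ?c * norm (A y - B))" using i2 by (intro set_integrable_mult_right)
        fix y assume "y \<in> ?B"
        then have "y \<in> interior T" using inside r by auto
        then have "flux v y - B *v ?a = (A y - B) *v ?a"
          using grad_interior[OF v T(1)] by (simp add: flux_def matrix_vector_mult_diff_rdistrib)
        then show "norm (flux v y - B *v ?a) \<le> ?c * norm (A y - B)"
          using K(2)[of "A y - B" ?a] by (simp add: mult_ac)
      qed
      then have "(LINT y:?B|lebesgue. norm (flux v y - B *v ?a)) \<le> ?c * (LINT y:?B|lebesgue. norm (A y - B))" by simp
      from divide_right_mono[OF this measure_nonneg]
      show "(LINT y:?B|lebesgue. norm (flux v y - B *v ?a)) / measure lebesgue ?B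
        \<le> ?c * ((LINT y:?B|lebesgue. norm (A y - B)) / measure lebesgue ?B)" by simp
    qed
  qed
qed

abbreviation flux_trace :: "(real ^ 'n \<Rightarrow> real) \<Rightarrow> real ^ 'n \<Rightarrow> real ^ 'n" where
  "flux_trace v \<equiv> one_sided_trace S (\<lambda>y. A y *v grad v y)"

text \<open>Both \<open>T\<close> and \<open>B\<close> are fixed before \<open>v\<close> is chosen;
  this uniformity makes the trace linear in \<open>v\<close>.\<close>

lemma flux_trace_regular:
  assumes "regular_trace x"
  shows "\<exists>T B. T \<in> M \<and> (\<forall>v. pw_affine M v \<longrightarrow>
    has_trace S (flux v) x (B *v elem_grad v T) \<and> flux_trace v x = B *v elem_grad v T)"
proof -
  obtain T B where T: "T \<in> M" "x \<in> T" "\<And>T'. T' \<in> M \<Longrightarrow> x \<in> T' \<Longrightarrow> T' = T"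
    and B: "has_trace S A x B" and x: "x \<in> closure S"
    using assms unfolding regular_trace_def by blast
  have "has_trace S (flux v) x (B *v elem_grad v T) \<and> flux_trace v x = B *v elem_grad v T"
    if v: "pw_affine M v" for v
  proof -
    have tr: "has_trace S (flux v) x (B *v elem_grad v T)"
      by (rule has_trace_flux[OF v x T B])
    show ?thesis
      using tr one_sided_trace_eq[OF open_domain x set_integrable_flux[OF v] tr]
      by (simp add: flux_def[abs_def])
  qed
  then show ?thesis using T(1) by blast
qed

lemma flux_trace_add:
  assumes x: "regular_trace x" and uv: "pw_affine M u" "pw_affine M v"
  shows "flux_trace (u + v) x = flux_trace u x + flux_trace v x"
proof -
  obtain T B where T: "T \<in> M" and tr: "\<And>v. pw_affine M v \<Longrightarrow> flux_trace v x = B *v elem_grad v T"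
    using flux_trace_regular[OF x] by blast
  have "pw_affine M (u + v)" using pw_affine_add[OF uv] by (simp add: plus_fun_def)
  then show ?thesis
    using tr uv elem_grad_add[OF uv T] by (simp add: plus_fun_def matrix_vector_right_distrib)
qed

lemma flux_trace_scale:
  assumes x: "regular_trace x" and u: "pw_affine M u"
  shows "flux_trace (\<lambda>x. c * u x) x = c *\<^sub>R flux_trace u x"
proof -
  obtain T B where T: "T \<in> M" and tr: "\<And>v. pw_affine M v \<Longrightarrow> flux_trace v x = B *v elem_grad v T"
    using flux_trace_regular[OF x] by blast
  show ?thesis
    using tr u pw_affine_scale[OF u] elem_grad_scale[OF u T] by (simp add: matrix_vector_mult_scaleR)
qed

lemma flux_trace_eq_lim:
  assumes x: "regular_trace x" and v: "pw_affine M v"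
  shows "(\<lambda>n. ball_mean S (flux v) (inverse (real (Suc n))) x) \<longlonglongrightarrow> flux_trace v x"
proof -
  obtain L where L: "has_trace S (flux v) x L" "flux_trace v x = L"
    using flux_trace_regular[OF x] v by blast
  have "x \<in> closure S" using x by (simp add: regular_trace_def)
  from has_trace_imp_ball_mean[OF open_domain this set_integrable_flux[OF v] L(1)]
  have lim: "((\<lambda>r. ball_mean S (flux v) r x) \<longlongrightarrow> L) (at_right 0)" .
  have "filterlim (\<lambda>n. inverse (real (Suc n))) (at_right 0) sequentially"
    using LIMSEQ_inverse_real_of_nat by (auto simp: filterlim_at intro!: always_eventually)
  from filterlim_compose[OF lim this] show ?thesis by (simp add: L(2))
qed

lemma flux_trace_measurable:
  assumes v: "pw_affine M v"
  obtains g where "g \<in> borel_measurable borel" "\<And>x. regular_trace x \<Longrightarrow> flux_trace v x = g x"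
proof
  let ?g = "\<lambda>x. lim (\<lambda>n. ball_mean S (flux v) (inverse (real (Suc n))) x)"
  show "?g \<in> borel_measurable borel"
    by (intro borel_measurable_lim_metric
        borel_measurable_ball_mean[OF open_domain lmeasurable_domain set_integrable_flux[OF v]])
  show "flux_trace v x = ?g x" if "regular_trace x" for x
    using flux_trace_eq_lim[OF that v] by (simp add: limI)
qed

text \<open>Means over small balls obey the essential bound of the flux, and so does their
  limit.\<close>

lemma flux_trace_bounded:
  assumes v: "pw_affine M v"
  obtains B where "\<And>x. regular_trace x \<Longrightarrow> norm (flux_trace v x) \<le> B"
proof -
  obtain B where B: "B \<ge> 0" "AE x in lebesgue. x \<in> S \<longrightarrow> norm (pw_flux v x) \<le> B"
    using pw_flux_bounded by blast
  have bound: "AE x in lebesgue. x \<in> S \<longrightarrow> norm (flux v x) \<le> B"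
    using B(2) flux_AE[OF v] by eventually_elim auto
  have mean: "norm (ball_mean S (flux v) r x) \<le> B" if x: "x \<in> closure S" and r: "r > 0" for r x
  proof -
    let ?B = "S \<inter> ball x r" and ?m = "measure lebesgue (S \<inter> ball x r)"
    have m: "?m > 0" by (rule measure_Int_ball_pos[OF open_domain x r])
    have int: "set_integrable lebesgue ?B (flux v)"
      by (rule set_integrable_subset[OF set_integrable_flux[OF v] sets_Int_ball[OF open_domain]]) simp
    have "?B \<in> lmeasurable" using lmeasurable_domain by (rule fmeasurable_Int_fmeasurable) simp
    then have ind: "integrable lebesgue (indicat_real ?B)" by (simp add: lmeasurable_iff_integrable)
    have "norm (LINT y:?B|lebesgue. flux v y) \<le> (LINT y:?B|lebesgue. norm (flux v y))"
      by (rule set_integral_norm_bound[OF int])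
    also have "\<dots> \<le> (LINT y|lebesgue. indicat_real ?B y * B)"
      unfolding set_lebesgue_integral_def
    proof (rule integral_mono_AE)
      show "integrable lebesgue (\<lambda>y. indicat_real ?B y *\<^sub>R norm (flux v y))"
        using set_integrable_norm[OF int] by (simp add: set_integrable_def)
      show "integrable lebesgue (\<lambda>y. indicat_real ?B y * B)" using ind by simp
      show "AE y in lebesgue. indicat_real ?B y *\<^sub>R norm (flux v y) \<le> indicat_real ?B y * B"
        using bound by (rule eventually_mono) (auto simp: indicator_def)
    qed
    also have "\<dots> = ?m * B" by simp
    finally have "norm (LINT y:?B|lebesgue. flux v y) / ?m \<le> B" using m by (simp add: divide_le_eq mult.commute)
    then show ?thesis using m by (simp add: ball_mean_def divide_inverse_commute)
  qed
  have "norm (flux_trace v x) \<le> B" if x: "regular_trace x" for x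
  proof (rule tendsto_upperbound[OF tendsto_norm[OF flux_trace_eq_lim[OF x v]]])
    show "\<forall>\<^sub>F n in sequentially. norm (ball_mean S (flux v) (inverse (real (Suc n))) x) \<le> B"
      using x mean by (intro always_eventually allI) (simp add: regular_trace_def)
  qed simp
  then show ?thesis using that by blast
qed

end

section \<open>Integrals over the interface\<close>

lemma borel_measurable_surface_measure:
  "f \<in> borel_measurable borel \<Longrightarrow> f \<in> borel_measurable surface_measure"
  by (rule measurableI) (auto intro!: borel_sets_surface_measure dest: measurable_sets_borel)

lemma surface_measure_measurable_AE_eq:
  assumes "f \<in> borel_measurable surface_measure" "AE x in surface_measure. f x = g x"
  shows "g \<in> borel_measurable surface_measure"
  using assms(1) _ assms(2) unfolding surface_measure_def by (rule completion.measurable_AE_eq) auto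

locale finite_surface =
  fixes G :: "(real ^ 'n) set"
  assumes closed_surface: "closed G" and bounded_surface: "bounded G"
    and finite_area: "emeasure surface_measure G < \<infinity>"
begin

text \<open>The bound is essential because fluxes have traces only almost everywhere. Finite area
  then makes all products of such functions integrable.\<close>

definition bounded_on_surface :: "(real ^ 'n \<Rightarrow> real) \<Rightarrow> bool" where
  "bounded_on_surface g \<longleftrightarrow> (\<lambda>x. indicator G x * g x) \<in> borel_measurable surface_measure \<and>
     (\<exists>B. AE x in surface_measure. x \<in> G \<longrightarrow> \<bar>g x\<bar> \<le> B)"

lemma sets_surface: "G \<in> sets surface_measure"
  using closed_surface by (intro borel_sets_surface_measure borel_closed)

lemma surface_integrable:
  assumes "bounded_on_surface g" "bounded_on_surface h"
  shows "set_integrable surface_measure G (\<lambda>x. g x * h x)"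
proof -
  obtain B where B: "AE x in surface_measure. x \<in> G \<longrightarrow> \<bar>g x\<bar> \<le> B"
    using assms(1) unfolding bounded_on_surface_def by blast
  obtain C where C: "AE x in surface_measure. x \<in> G \<longrightarrow> \<bar>h x\<bar> \<le> C"
    using assms(2) unfolding bounded_on_surface_def by blast
  show ?thesis unfolding set_integrable_def
  proof (rule Bochner_Integration.integrable_bound)
    show "integrable surface_measure (\<lambda>x. (B * C) * indicat_real G x)"
      using finite_area sets_surface by (intro integrable_mult_right integrable_real_indicator) auto
    have "(\<lambda>x. (indicator G x * g x) * (indicator G x * h x)) \<in> borel_measurable surface_measure"
      using assms unfolding bounded_on_surface_def by (elim conjE) (rule borel_measurable_times)
    then show "(\<lambda>x. indicator G x *\<^sub>R (g x * h x)) \<in> borel_measurable surface_measure"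
      by (rule back_subst[of "\<lambda>f. f \<in> borel_measurable surface_measure"]) (auto simp: indicator_def)
    show "AE x in surface_measure. norm (indicator G x *\<^sub>R (g x * h x)) \<le> norm ((B * C) * indicat_real G x)"
      using B C
    proof eventually_elim
      case (elim x)
      show ?case
      proof (cases "x \<in> G")
        case True
        then have "\<bar>g x\<bar> * \<bar>h x\<bar> \<le> B * C" using elim by (intro mult_mono) auto
        then have "\<bar>g x * h x\<bar> \<le> \<bar>B * C\<bar>"
          unfolding abs_mult[of "g x" "h x"] by (rule order_trans) (rule abs_ge_self)
        then show ?thesis using True by simp
      qed simp
    qed
  qed
qed

lemma bounded_on_surface_AE_eq:
  assumes "bounded_on_surface g" "AE x in surface_measure. x \<in> G \<longrightarrow> g x = h x"
  shows "bounded_on_surface h"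
proof -
  obtain B where B: "AE x in surface_measure. x \<in> G \<longrightarrow> \<bar>g x\<bar> \<le> B"
    using assms(1) unfolding bounded_on_surface_def by blast
  have "AE x in surface_measure. x \<in> G \<longrightarrow> \<bar>h x\<bar> \<le> B" using B assms(2) by eventually_elim auto
  moreover have "AE x in surface_measure. indicator G x * g x = indicator G x * h x"
    using assms(2) by (rule eventually_mono) (auto simp: indicator_def)
  moreover have "(\<lambda>x. indicator G x * g x) \<in> borel_measurable surface_measure"
    using assms(1) unfolding bounded_on_surface_def by (rule conjunct1)
  ultimately show ?thesis
    unfolding bounded_on_surface_def
    by (intro conjI exI[of _ B]) (rule surface_measure_measurable_AE_eq)
qed

lemma bounded_on_surface_add:
  assumes "bounded_on_surface g" "bounded_on_surface h" shows "bounded_on_surface (\<lambda>x. g x + h x)"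
proof -
  obtain B where B: "AE x in surface_measure. x \<in> G \<longrightarrow> \<bar>g x\<bar> \<le> B"
    using assms(1) unfolding bounded_on_surface_def by blast
  obtain C where C: "AE x in surface_measure. x \<in> G \<longrightarrow> \<bar>h x\<bar> \<le> C"
    using assms(2) unfolding bounded_on_surface_def by blast
  have "AE x in surface_measure. x \<in> G \<longrightarrow> \<bar>g x + h x\<bar> \<le> B + C" using B C by eventually_elim auto
  then show ?thesis
    using assms unfolding bounded_on_surface_def by (auto simp: distrib_left)
qed

lemma bounded_on_surface_scale:
  assumes "bounded_on_surface g" shows "bounded_on_surface (\<lambda>x. c * g x)"
proof -
  obtain B where B: "AE x in surface_measure. x \<in> G \<longrightarrow> \<bar>g x\<bar> \<le> B"
    using assms(1) unfolding bounded_on_surface_def by blast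
  have "AE x in surface_measure. x \<in> G \<longrightarrow> \<bar>c * g x\<bar> \<le> \<bar>c\<bar> * B"
    using B by eventually_elim (auto simp: abs_mult mult_left_mono)
  then show ?thesis
    using assms unfolding bounded_on_surface_def
    by (auto simp: mult.left_commute[of _ c])
qed

lemma bounded_on_surface_continuous:
  assumes "continuous_on G g" shows "bounded_on_surface g"
proof -
  have "compact G" using closed_surface bounded_surface by (simp add: compact_eq_bounded_closed)
  then have "bounded (g ` G)" using assms by (intro compact_imp_bounded compact_continuous_image)
  then obtain B where B: "\<forall>y\<in>g ` G. norm y \<le> B" unfolding bounded_pos by blast
  have "(\<lambda>x. indicator G x *\<^sub>R g x) \<in> borel_measurable borel"
    using assms borel_closed[OF closed_surface] by (intro borel_measurable_continuous_on_indicator)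
  then have "(\<lambda>x. indicator G x * g x) \<in> borel_measurable surface_measure"
    by (intro borel_measurable_surface_measure) simp
  then show ?thesis using B unfolding bounded_on_surface_def by (auto intro!: exI[of _ B] AE_I2)
qed

text \<open>The function \<open>k\<close> equals the sum only almost everywhere, the form in which
  additivity of \<open>mean_flux\<close> is available; completeness of the measure makes
  \<open>k\<close> measurable.\<close>

lemma surface_inner_add:
  assumes "bounded_on_surface g" "bounded_on_surface g'" "bounded_on_surface h"
    and k: "AE x in surface_measure. x \<in> G \<longrightarrow> k x = g x + g' x"
  shows "surface_inner G k h = surface_inner G g h + surface_inner G g' h"
proof -
  have kb: "bounded_on_surface k"
    by (rule bounded_on_surface_AE_eq[OF bounded_on_surface_add[OF assms(1,2)]])
      (use k in \<open>auto elim: eventually_mono\<close>)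
  have i: "set_integrable surface_measure G (\<lambda>x. k x * h x)"
    "set_integrable surface_measure G (\<lambda>x. g x * h x)" "set_integrable surface_measure G (\<lambda>x. g' x * h x)"
    using surface_integrable assms kb by blast+
  note s = set_integral_add[OF i(2,3)]
  have "surface_inner G k h = (LINT x:G|surface_measure. g x * h x + g' x * h x)"
    unfolding surface_inner_def set_lebesgue_integral_def
  proof (rule integral_cong_AE)
    show "(\<lambda>x. indicator G x *\<^sub>R (k x * h x)) \<in> borel_measurable surface_measure"
      "(\<lambda>x. indicator G x *\<^sub>R (g x * h x + g' x * h x)) \<in> borel_measurable surface_measure"
      using i(1) s(1) unfolding set_integrable_def by (auto intro: borel_measurable_integrable)
    show "AE x in surface_measure. indicator G x *\<^sub>R (k x * h x) = indicator G x *\<^sub>R (g x * h x + g' x * h x)"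
      using k by (rule eventually_mono) (auto simp: indicator_def distrib_right)
  qed
  then show ?thesis using s(2) by (simp add: surface_inner_def)
qed

lemma surface_inner_scale:
  assumes "bounded_on_surface g" "bounded_on_surface h"
    and k: "AE x in surface_measure. x \<in> G \<longrightarrow> k x = c * g x"
  shows "surface_inner G k h = c * surface_inner G g h"
proof -
  have kb: "bounded_on_surface k"
    by (rule bounded_on_surface_AE_eq[OF bounded_on_surface_scale[OF assms(1)]])
      (use k in \<open>auto elim: eventually_mono\<close>)
  have i: "set_integrable surface_measure G (\<lambda>x. k x * h x)" "set_integrable surface_measure G (\<lambda>x. g x * h x)"
    using surface_integrable assms kb by blast+
  have "surface_inner G k h = (LINT x:G|surface_measure. c * (g x * h x))"
    unfolding surface_inner_def set_lebesgue_integral_def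
  proof (rule integral_cong_AE)
    show "(\<lambda>x. indicator G x *\<^sub>R (k x * h x)) \<in> borel_measurable surface_measure"
      "(\<lambda>x. indicator G x *\<^sub>R (c * (g x * h x))) \<in> borel_measurable surface_measure"
      using i(1) set_integrable_mult_right[OF i(2), of c]
      unfolding set_integrable_def by (auto intro: borel_measurable_integrable)
    show "AE x in surface_measure. indicator G x *\<^sub>R (k x * h x) = indicator G x *\<^sub>R (c * (g x * h x))"
      using k by (rule eventually_mono) (auto simp: indicator_def)
  qed
  then show ?thesis by (simp add: surface_inner_def)
qed

lemma surface_inner_self_eq_0D:
  assumes "bounded_on_surface g" "surface_inner G g g = 0"
  shows "AE x in surface_measure. x \<in> G \<longrightarrow> g x = 0"
proof -
  have "AE x in surface_measure. indicator G x *\<^sub>R (g x * g x) = 0"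
  proof (subst integral_nonneg_eq_0_iff_AE[symmetric])
    show "integrable surface_measure (\<lambda>x. indicator G x *\<^sub>R (g x * g x))"
      using surface_integrable[OF assms(1,1)] by (simp add: set_integrable_def)
    show "(LINT x|surface_measure. indicator G x *\<^sub>R (g x * g x)) = 0"
      using assms(2) by (simp add: surface_inner_def set_lebesgue_integral_def)
  qed (auto intro!: AE_I2 simp: indicator_def)
  then show ?thesis by (rule eventually_mono) (auto simp: indicator_def split: if_splits)
qed

end

lemma surface_inner_commute: "surface_inner G g h = surface_inner G h g"
  by (simp add: surface_inner_def mult.commute)

lemma surface_inner_self_nonneg: "0 \<le> surface_inner G g g"
  unfolding surface_inner_def set_lebesgue_integral_def
  by (rule Bochner_Integration.integral_nonneg) (simp add: indicator_def)

interpretation broken_space: vector_space "\<lambda>(c::real) (v::'n broken). (\<lambda>x. c * fst v x, \<lambda>x. c * snd v x)"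
  by standard (simp_all add: prod_eq_iff fun_eq_iff distrib_left distrib_right)

abbreviation broken_scale :: "real \<Rightarrow> 'n broken \<Rightarrow> 'n broken" where
  "broken_scale c v \<equiv> (\<lambda>x. c * fst v x, \<lambda>x. c * snd v x)"

section \<open>The discontinuous Galerkin form on the fine space\<close>

context multiscale_setting
begin

lemma dim_ge_2: "CARD('n) \<ge> 2" using dimension by auto

lemma open_Om: "open (Om D)" and bounded_Om: "bounded (Om D)" and Om_nonempty: "Om D \<noteq> {}"
  and connected_Om: "connected (Om D)"
  using domain by (auto simp: polyhedral_domain_def)

lemma open_Om2: "open (Om2 D)"
  unfolding Om2_def using open_Om by (intro open_Diff) auto

lemma disjoint_closure: "Om2 D \<inter> closure (Om1 D) = {}"
  by (auto simp: Om2_def)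

lemma disjoint_closure': "Om1 D \<inter> closure (Om2 D) = {}"
proof -
  have "Om1 D \<inter> Om2 D = {}" using disjoint_closure closure_subset[of "Om1 D"] by blast
  then show ?thesis using open_Int_closure_eq_empty[OF subdomain(1)] by blast
qed

lemma Om_parts: "Om1 D \<subseteq> Om D" "Om2 D \<subseteq> Om D" "Om D \<subseteq> closure (Om1 D) \<union> Om2 D"
  using subdomain(2) by (auto simp: Om2_def)

lemma Gam_eq: "Gam D = closure (Om1 D) \<inter> closure (Om2 D)"
  using disjoint_closure disjoint_closure' subdomain(1) open_Om2
  by (auto simp: Gam_def frontier_def interior_open)

text \<open>An interface point is a limit of points from both sides, whereas the interior of the
  closure of one side misses the other side.\<close>

lemma Gam_not_interior:
  assumes "x \<in> Gam D" shows "x \<notin> interior (closure (Om1 D))" "x \<notin> interior (closure (Om2 D))"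
proof -
  have x: "x \<in> closure (Om1 D)" "x \<in> closure (Om2 D)" using assms Gam_eq by auto
  show "x \<notin> interior (closure (Om1 D))"
  proof
    assume "x \<in> interior (closure (Om1 D))"
    then have "interior (closure (Om1 D)) \<inter> Om2 D \<noteq> {}"
      using x(2) open_Int_closure_eq_empty[of "interior (closure (Om1 D))" "Om2 D"] by auto
    then show False using disjoint_closure interior_subset[of "closure (Om1 D)"] by blast
  qed
  show "x \<notin> interior (closure (Om2 D))"
  proof
    assume "x \<in> interior (closure (Om2 D))"
    then have "interior (closure (Om2 D)) \<inter> Om1 D \<noteq> {}"
      using x(1) open_Int_closure_eq_empty[of "interior (closure (Om2 D))" "Om1 D"] by auto
    then show False using disjoint_closure' interior_subset[of "closure (Om2 D)"] by blast
  qed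
qed

lemma Co_part_measurable:
  assumes "S \<in> sets lebesgue" "S \<subseteq> Om D"
  shows "(\<lambda>x. indicator S x *\<^sub>R Co D x) \<in> borel_measurable lebesgue"
proof -
  have "Om D \<in> sets lebesgue" using open_Om by (intro sets_completionI_sets) auto
  then have "(\<lambda>x. indicator (Om D) x *\<^sub>R Co D x) \<in> borel_measurable lebesgue"
    using coefficient(1) by (subst (asm) borel_measurable_restrict_space_iff) auto
  then have "(\<lambda>x. indicator S x *\<^sub>R indicator (Om D) x *\<^sub>R Co D x) \<in> borel_measurable lebesgue"
    by (rule borel_measurable_scaleR[OF borel_measurable_indicator[OF assms(1)]])
  moreover have "(\<lambda>x. indicator S x *\<^sub>R indicator (Om D) x *\<^sub>R Co D x) = (\<lambda>x. indicator S x *\<^sub>R Co D x)"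
  proof
    fix x show "indicator S x *\<^sub>R indicator (Om D) x *\<^sub>R Co D x = indicator S x *\<^sub>R Co D x"
      using assms(2) by (cases "x \<in> S") auto
  qed
  ultimately show ?thesis by simp
qed

lemma Co_part_bounded:
  assumes "S \<subseteq> Om D" shows "\<exists>B. AE x in lebesgue. x \<in> S \<longrightarrow> norm (Co D x) \<le> B"
proof -
  obtain B where "AE x in lebesgue_on (Om D). norm (Co D x) \<le> B" using coefficient(2) by blast
  moreover have "Om D \<in> sets lebesgue" using open_Om by (intro sets_completionI_sets) auto
  ultimately have "AE x in lebesgue. x \<in> Om D \<longrightarrow> norm (Co D x) \<le> B"
    by (simp add: AE_restrict_space_iff)
  then show ?thesis using assms by (intro exI[of _ B]) (auto elim: eventually_mono)
qed

sublocale m1: coefficient_mesh "Om1 D" "Mh1 D" "Co D"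
proof (unfold_locales)
  show "open (Om1 D)" "mesh_of (Om1 D) (Mh1 D)" by (fact subdomain(1) fine_meshes(1))+
  then interpret mesh "Om1 D" "Mh1 D" by unfold_locales
  show "(\<lambda>x. indicator (Om1 D) x *\<^sub>R Co D x) \<in> borel_measurable lebesgue"
    "\<exists>B. AE x in lebesgue. x \<in> Om1 D \<longrightarrow> norm (Co D x) \<le> B"
    using sets_domain Om_parts by (auto intro: Co_part_measurable Co_part_bounded)
qed

sublocale m2: coefficient_mesh "Om2 D" "Mh2 D" "Co D"
proof (unfold_locales)
  show "open (Om2 D)" "mesh_of (Om2 D) (Mh2 D)" by (fact open_Om2 fine_meshes(2))+
  then interpret mesh "Om2 D" "Mh2 D" by unfold_locales
  show "(\<lambda>x. indicator (Om2 D) x *\<^sub>R Co D x) \<in> borel_measurable lebesgue"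
    "\<exists>B. AE x in lebesgue. x \<in> Om2 D \<longrightarrow> norm (Co D x) \<le> B"
    using sets_domain Om_parts by (auto intro: Co_part_measurable Co_part_bounded)
qed

sublocale mH: fitted_mesh "Om2 D" "MH2 D" "Gam2 D"
  by unfold_locales (fact open_Om2 coarse_mesh)+

sublocale sides: interface "Om1 D" "Om2 D"
  by unfold_locales (fact subdomain(1) open_Om2)+

sublocale surface: finite_surface "Gam D"
proof unfold_locales
  show "closed (Gam D)" unfolding Gam_eq by (intro closed_Int closed_closure)
  show "bounded (Gam D)" unfolding Gam_eq
    using m1.compact_closure_domain by (intro bounded_Int) (auto intro: compact_imp_bounded)
qed (fact interface(2))

text \<open>The exceptional set consists of the skeletons of both meshes and of the points without a
  coefficient trace. Elsewhere \<open>unique_element\<close> applies, as interface points are not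
  interior to either closure.\<close>

lemma AE_regular_trace:
  "AE x in surface_measure. x \<in> Gam D \<longrightarrow> m1.regular_trace x \<and> m2.regular_trace x"
proof -
  have "AE x in surface_measure. x \<notin> m1.skeleton" "AE x in surface_measure. x \<notin> m2.skeleton"
    by (intro AE_not_in m1.skeleton_null m2.skeleton_null dimension)+
  then show ?thesis
    using coefficient_trace
  proof eventually_elim
    case (elim x)
    show ?case
    proof (intro impI conjI)
      assume x: "x \<in> Gam D"
      then have cl: "x \<in> closure (Om1 D)" "x \<in> closure (Om2 D)" using Gam_eq by auto
      show "m1.regular_trace x"
        using m1.unique_element[OF cl(1) Gam_not_interior(1)[OF x] elim(1)] elim(3) x cl(1)
        unfolding m1.regular_trace_def by blast
      show "m2.regular_trace x"
        using m2.unique_element[OF cl(2) Gam_not_interior(2)[OF x] elim(2)] elim(4) x cl(2)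
        unfolding m2.regular_trace_def by blast
    qed
  qed
qed

lemma in_Vhh_iff: "v \<in> Vhh D \<longleftrightarrow> fst v \<in> Vh1 D \<and> snd v \<in> Vh2 D"
  by (cases v) (simp add: Vhh_def)

lemma Vhh_pw_affine: "v \<in> Vhh D \<Longrightarrow> pw_affine (Mh1 D) (fst v)" "v \<in> Vhh D \<Longrightarrow> pw_affine (Mh2 D) (snd v)"
  by (simp_all add: in_Vhh_iff Vh1_def Vh2_def m1.in_fe_space_iff m2.in_fe_space_iff)

lemma subspace_Vhh: "broken_space.subspace (Vhh D)"
proof (rule broken_space.subspaceI)
  show "0 \<in> Vhh D"
    using fun_space.subspace_0[OF m1.subspace_fe_space] fun_space.subspace_0[OF m2.subspace_fe_space]
    by (simp add: in_Vhh_iff Vh1_def Vh2_def)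
  show "u + v \<in> Vhh D" if "u \<in> Vhh D" "v \<in> Vhh D" for u v
    using that fun_space.subspace_add[OF m1.subspace_fe_space] fun_space.subspace_add[OF m2.subspace_fe_space]
    by (simp add: in_Vhh_iff Vh1_def Vh2_def)
  show "broken_scale c u \<in> Vhh D" if "u \<in> Vhh D" for c u
    using that fun_space.subspace_scale[OF m1.subspace_fe_space] fun_space.subspace_scale[OF m2.subspace_fe_space]
    by (simp add: in_Vhh_iff Vh1_def Vh2_def)
qed

lemma jump_continuous: "v \<in> Vhh D \<Longrightarrow> continuous_on (Gam D) (jump v)"
  unfolding jump_def[abs_def] Gam_eq
  by (intro continuous_on_diff
      continuous_on_subset[OF m1.continuous_on_pw_affine[OF Vhh_pw_affine(1)]]
      continuous_on_subset[OF m2.continuous_on_pw_affine[OF Vhh_pw_affine(2)]]) auto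

lemma jump_bounded: "v \<in> Vhh D \<Longrightarrow> surface.bounded_on_surface (jump v)"
  by (intro surface.bounded_on_surface_continuous jump_continuous)

text \<open>Almost everywhere on the interface the flux traces coincide with Borel functions, the
  limits of means; the bounds for traces and normal multiply.\<close>

lemma mean_flux_bounded:
  assumes v: "v \<in> Vhh D" shows "surface.bounded_on_surface (mean_flux D v)"
proof -
  note v1 = Vhh_pw_affine(1)[OF v] and v2 = Vhh_pw_affine(2)[OF v]
  let ?n = "unit_normal (Om1 D) (Om2 D)"
  have Gam: "sides.\<Gamma> = Gam D" by (simp add: sides.\<Gamma>_def Gam_def)
  obtain g where g: "g \<in> borel_measurable borel" "\<And>x. m1.regular_trace x \<Longrightarrow> m1.flux_trace (fst v) x = g x"
    using m1.flux_trace_measurable[OF v1] by blast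
  obtain h where h: "h \<in> borel_measurable borel" "\<And>x. m2.regular_trace x \<Longrightarrow> m2.flux_trace (snd v) x = h x"
    using m2.flux_trace_measurable[OF v2] by blast
  obtain B where B: "\<And>x. m1.regular_trace x \<Longrightarrow> norm (m1.flux_trace (fst v) x) \<le> B"
    using m1.flux_trace_bounded[OF v1] by blast
  obtain C where C: "\<And>x. m2.regular_trace x \<Longrightarrow> norm (m2.flux_trace (snd v) x) \<le> C"
    using m2.flux_trace_bounded[OF v2] by blast
  let ?N = "max 1 (norm (THE n :: real ^ 'n. False))"
  have "(\<lambda>x. (g x \<bullet> (indicator (Gam D) x *\<^sub>R ?n x) + h x \<bullet> (indicator (Gam D) x *\<^sub>R ?n x)) / 2) \<in> borel_measurable borel"
    using g(1) h(1) sides.borel_measurable_unit_normal[unfolded Gam]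
    by (intro borel_measurable_divide borel_measurable_add borel_measurable_inner borel_measurable_const)
  then have m: "(\<lambda>x. (g x \<bullet> (indicator (Gam D) x *\<^sub>R ?n x) + h x \<bullet> (indicator (Gam D) x *\<^sub>R ?n x)) / 2)
      \<in> borel_measurable surface_measure"
    by (rule borel_measurable_surface_measure)
  have "(\<lambda>x. indicator (Gam D) x * mean_flux D v x) \<in> borel_measurable surface_measure"
  proof (rule surface_measure_measurable_AE_eq[OF m])
    show "AE x in surface_measure. (g x \<bullet> (indicator (Gam D) x *\<^sub>R ?n x) + h x \<bullet> (indicator (Gam D) x *\<^sub>R ?n x)) / 2
       = indicator (Gam D) x * mean_flux D v x"
      using AE_regular_trace
    proof (rule eventually_mono)
      fix x assume x: "x \<in> Gam D \<longrightarrow> m1.regular_trace x \<and> m2.regular_trace x"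
      show "(g x \<bullet> (indicator (Gam D) x *\<^sub>R ?n x) + h x \<bullet> (indicator (Gam D) x *\<^sub>R ?n x)) / 2
       = indicator (Gam D) x * mean_flux D v x"
        using x g(2)[of x] h(2)[of x] by (cases "x \<in> Gam D") (auto simp: mean_flux_def)
    qed
  qed
  moreover have "AE x in surface_measure. x \<in> Gam D \<longrightarrow> \<bar>mean_flux D v x\<bar> \<le> (B * ?N + C * ?N) / 2"
    using AE_regular_trace
  proof (rule eventually_mono, intro impI)
    fix x assume "x \<in> Gam D \<longrightarrow> m1.regular_trace x \<and> m2.regular_trace x" and x: "x \<in> Gam D"
    then have "norm (m1.flux_trace (fst v) x) \<le> B" "norm (m2.flux_trace (snd v) x) \<le> C"
      using B C by auto
    moreover have "norm (?n x) \<le> ?N" using sides.norm_unit_normal_le[of x] x Gam by simp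
    ultimately have "norm (m1.flux_trace (fst v) x) * norm (?n x) \<le> B * ?N"
      "norm (m2.flux_trace (snd v) x) * norm (?n x) \<le> C * ?N"
      by (auto intro!: mult_mono intro: order_trans[OF norm_ge_zero])
    then have "\<bar>m1.flux_trace (fst v) x \<bullet> ?n x\<bar> \<le> B * ?N" "\<bar>m2.flux_trace (snd v) x \<bullet> ?n x\<bar> \<le> C * ?N"
      using Cauchy_Schwarz_ineq2 order_trans by blast+
    then have "\<bar>m1.flux_trace (fst v) x \<bullet> ?n x + m2.flux_trace (snd v) x \<bullet> ?n x\<bar> \<le> B * ?N + C * ?N"
      by linarith
    then show "\<bar>mean_flux D v x\<bar> \<le> (B * ?N + C * ?N) / 2" by (simp add: mean_flux_def)
  qed
  ultimately show ?thesis unfolding surface.bounded_on_surface_def by blast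
qed

lemma mean_flux_add:
  assumes u: "u \<in> Vhh D" and v: "v \<in> Vhh D"
  shows "AE x in surface_measure. x \<in> Gam D \<longrightarrow> mean_flux D (u + v) x = mean_flux D u x + mean_flux D v x"
  using AE_regular_trace
proof (rule eventually_mono, intro impI)
  fix x assume "x \<in> Gam D \<longrightarrow> m1.regular_trace x \<and> m2.regular_trace x" "x \<in> Gam D"
  then show "mean_flux D (u + v) x = mean_flux D u x + mean_flux D v x"
    using m1.flux_trace_add[OF _ Vhh_pw_affine(1)[OF u] Vhh_pw_affine(1)[OF v], of x]
      m2.flux_trace_add[OF _ Vhh_pw_affine(2)[OF u] Vhh_pw_affine(2)[OF v], of x]
    by (simp add: mean_flux_def inner_add_left add_divide_distrib)
qed

lemma mean_flux_scale:
  assumes u: "u \<in> Vhh D"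
  shows "AE x in surface_measure. x \<in> Gam D \<longrightarrow> mean_flux D (broken_scale c u) x = c * mean_flux D u x"
  using AE_regular_trace
proof (rule eventually_mono, intro impI)
  fix x assume "x \<in> Gam D \<longrightarrow> m1.regular_trace x \<and> m2.regular_trace x" "x \<in> Gam D"
  then show "mean_flux D (broken_scale c u) x = c * mean_flux D u x"
    using m1.flux_trace_scale[OF _ Vhh_pw_affine(1)[OF u], of x c]
      m2.flux_trace_scale[OF _ Vhh_pw_affine(2)[OF u], of x c]
    by (simp add: mean_flux_def distrib_left)
qed

lemma bulk_form_eq: "bulk_form D u v = m1.energy (fst u) (fst v) + m2.energy (snd u) (snd v)"
  by (simp add: bulk_form_def m1.energy_def m2.energy_def)

text \<open>The bulk integrands agree pointwise by symmetry of the coefficient, and the two flux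
  terms swap. Linearity in the second argument thus follows from that in the first.\<close>

lemma dg_form_commute: "dg_form D \<gamma> u v = dg_form D \<gamma> v u"
proof -
  have "bulk_form D u v = bulk_form D v u"
  proof -
    have "m1.energy (fst u) (fst v) = m1.energy (fst v) (fst u)"
      by (rule m1.energy_commute) (use coefficient(3) Om_parts in blast)
    moreover have "m2.energy (snd u) (snd v) = m2.energy (snd v) (snd u)"
      by (rule m2.energy_commute) (use coefficient(3) Om_parts in blast)
    ultimately show ?thesis by (simp add: bulk_form_eq)
  qed
  moreover have "surface_inner (Gam D) (\<lambda>x. \<gamma> / fine_size D * jump u x) (jump v)
    = surface_inner (Gam D) (\<lambda>x. \<gamma> / fine_size D * jump v x) (jump u)"
    by (simp add: surface_inner_def mult_ac)
  ultimately show ?thesis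
    unfolding dg_form_def
    using surface_inner_commute[of "Gam D" "mean_flux D u" "jump v"]
      surface_inner_commute[of "Gam D" "mean_flux D v" "jump u"] by linarith
qed

lemma dg_form_add:
  assumes u: "u \<in> Vhh D" and v: "v \<in> Vhh D" and w: "w \<in> Vhh D"
  shows "dg_form D \<gamma> (u + v) w = dg_form D \<gamma> u w + dg_form D \<gamma> v w"
proof -
  have "bulk_form D (u + v) w = bulk_form D u w + bulk_form D v w"
    unfolding bulk_form_eq using Vhh_pw_affine u v w
    by (simp add: m1.energy_add m2.energy_add)
  moreover have "surface_inner (Gam D) (mean_flux D (u + v)) (jump w)
    = surface_inner (Gam D) (mean_flux D u) (jump w) + surface_inner (Gam D) (mean_flux D v) (jump w)"
    using u v w by (intro surface.surface_inner_add mean_flux_bounded jump_bounded mean_flux_add)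
  moreover have "surface_inner (Gam D) (jump (u + v)) (mean_flux D w)
    = surface_inner (Gam D) (jump u) (mean_flux D w) + surface_inner (Gam D) (jump v) (mean_flux D w)"
    using u v w by (intro surface.surface_inner_add mean_flux_bounded jump_bounded AE_I2) (simp_all add: jump_def)
  moreover have "surface_inner (Gam D) (\<lambda>x. \<gamma> / fine_size D * jump (u + v) x) (jump w)
    = surface_inner (Gam D) (\<lambda>x. \<gamma> / fine_size D * jump u x) (jump w)
    + surface_inner (Gam D) (\<lambda>x. \<gamma> / fine_size D * jump v x) (jump w)"
    using u v w by (intro surface.surface_inner_add surface.bounded_on_surface_scale jump_bounded AE_I2)
      (simp_all add: jump_def algebra_simps)
  ultimately show ?thesis by (simp add: dg_form_def)
qed

lemma dg_form_scale:
  assumes u: "u \<in> Vhh D" and w: "w \<in> Vhh D"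
  shows "dg_form D \<gamma> (broken_scale c u) w = c * dg_form D \<gamma> u w"
proof -
  have "bulk_form D (broken_scale c u) w = c * bulk_form D u w"
    unfolding bulk_form_eq using Vhh_pw_affine u w
    by (simp add: m1.energy_scale m2.energy_scale distrib_left)
  moreover have "surface_inner (Gam D) (mean_flux D (broken_scale c u)) (jump w)
    = c * surface_inner (Gam D) (mean_flux D u) (jump w)"
    using u w by (intro surface.surface_inner_scale mean_flux_bounded jump_bounded mean_flux_scale)
  moreover have "surface_inner (Gam D) (jump (broken_scale c u)) (mean_flux D w)
    = c * surface_inner (Gam D) (jump u) (mean_flux D w)"
    using u w by (intro surface.surface_inner_scale mean_flux_bounded jump_bounded AE_I2)
      (simp_all add: jump_def algebra_simps)
  moreover have "surface_inner (Gam D) (\<lambda>x. \<gamma> / fine_size D * jump (broken_scale c u) x) (jump w)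
    = c * surface_inner (Gam D) (\<lambda>x. \<gamma> / fine_size D * jump u x) (jump w)"
    using u w by (intro surface.surface_inner_scale surface.bounded_on_surface_scale jump_bounded AE_I2)
      (simp_all add: jump_def algebra_simps)
  ultimately show ?thesis by (simp add: dg_form_def algebra_simps)
qed

end

section \<open>Coercivity and the multiscale decomposition\<close>

lemma (in mesh) finite_range_of_zero_gradient:
  assumes v: "pw_affine M v" and zero: "\<And>T. T \<in> M \<Longrightarrow> elem_grad v T = 0"
  shows "finite (v ` closure S)"
proof -
  have "finite (v ` T)" if T: "T \<in> M" for T
  proof -
    obtain c where "\<And>x. x \<in> T \<Longrightarrow> v x = c + elem_grad v T \<bullet> x" using elem_grad[OF v T] by blast
    then have "v ` T \<subseteq> {c}" using zero[OF T] by auto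
    then show ?thesis by (rule finite_subset) simp
  qed
  then have "finite (\<Union>T\<in>M. v ` T)" using finite_mesh by blast
  then show ?thesis by (simp add: Union_mesh[symmetric] image_Union)
qed

lemma psd_sqrt_energy:
  assumes "is_psd_sqrt R B" shows "(norm (R *v w))\<^sup>2 = (B *v w) \<bullet> w"
proof -
  have R: "transpose R = R" "R ** R = B" using assms by (auto simp: is_psd_sqrt_def)
  have "(B *v w) \<bullet> w = (R *v (R *v w)) \<bullet> w" by (simp add: matrix_vector_mul_assoc R(2))
  also have "\<dots> = (transpose R *v (R *v w)) \<bullet> w" by (simp only: R(1))
  also have "\<dots> = (R *v w) \<bullet> (R *v w)"
    unfolding transpose_matrix_vector by (rule dot_lmul_matrix)
  finally show ?thesis by (simp add: power2_norm_eq_inner)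
qed

context multiscale_setting
begin

text \<open>The penalty divides by this size. An element has interior points, so its diameter is
  positive.\<close>

lemma fine_size_pos: "fine_size D > 0"
proof -
  have fin: "finite (Mh1 D \<union> Mh2 D)" using m1.finite_mesh m2.finite_mesh by simp
  have "Mh1 D \<noteq> {}"
  proof
    assume "Mh1 D = {}"
    then have "closure (Om1 D) = {}" using m1.Union_mesh by simp
    then show False using subdomain(3) by simp
  qed
  then obtain T where T: "T \<in> Mh1 D" by blast
  interpret T: full_simplex T using T by (rule m1.full_simplex)
  obtain x where "x \<in> interior T" using T.nonempty_interior by blast
  then obtain e where e: "e > 0" "cball x e \<subseteq> T" by (auto simp: mem_interior_cball)
  obtain b :: "real ^ 'n" where b: "b \<in> Basis" using nonempty_Basis by blast
  have "x + e *\<^sub>R b \<in> cball x e" using e(1) b by (simp add: dist_norm)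
  then have "x \<in> T" "x + e *\<^sub>R b \<in> T" using e by auto
  then have "dist x (x + e *\<^sub>R b) \<le> diameter T"
    using T.compact by (intro diameter_bounded_bound compact_imp_bounded)
  then have "0 < diameter T" using e(1) b by (simp add: dist_norm)
  also have "\<dots> \<le> Max (diameter ` (Mh1 D \<union> Mh2 D))" using fin T by (intro Max_ge) auto
  finally show ?thesis by (simp add: fine_size_def mesh_size_def)
qed

text \<open>Inside the domain the interface is locally the full Lipschitz graph, so shifting it
  along \<open>e\<close> by up to 1 sweeps out an open set, as the thickening bound demands.\<close>

lemma hausdorff_outer_Gam_ball_pos:
  assumes x: "x \<in> Gam D" "x \<in> Om D" and r: "r > 0"
  shows "hausdorff_outer (CARD('n) - 1) (Gam D \<inter> ball x r) > 0"
proof -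
  obtain U e g C where U: "open U" "x \<in> U" and e: "norm e = 1" and g: "C-lipschitz_on {y. y \<bullet> e = 0} g"
    and graph: "Gam D \<inter> U \<subseteq> {y. y \<bullet> e = g (y - (y \<bullet> e) *\<^sub>R e)}"
    and below: "Om1 D \<inter> U = {y \<in> Om D \<inter> U. y \<bullet> e < g (y - (y \<bullet> e) *\<^sub>R e)}"
    and above: "Om2 D \<inter> U = {y \<in> Om D \<inter> U. y \<bullet> e > g (y - (y \<bullet> e) *\<^sub>R e)}"
    using interface(1)[unfolded lipschitz_interface_def, rule_format, OF x(1)]
    by (elim exE conjE) (rule that)
  have ee: "e \<bullet> e = 1" using e by (simp add: norm_eq_1)
  have C: "C \<ge> 0" using g by (rule lipschitz_on_nonneg)
  define p where "p = (\<lambda>y. y - (y \<bullet> e) *\<^sub>R e)"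
  have below': "z \<in> Om1 D" if "z \<in> Om D" "z \<in> U" "z \<bullet> e < g (p z)" for z
    using that below unfolding p_def by blast
  have above': "z \<in> Om2 D" if "z \<in> Om D" "z \<in> U" "z \<bullet> e > g (p z)" for z
    using that above unfolding p_def by blast
  have pe: "p y \<bullet> e = 0" for y by (simp add: p_def inner_diff_left ee)
  have p_shift: "p (y + t *\<^sub>R e) = p y" for y t
    by (simp add: p_def inner_add_left ee algebra_simps)
  have cont_p: "continuous_on UNIV p" unfolding p_def by (intro continuous_intros)
  have cont_gp: "continuous_on UNIV (\<lambda>y. g (p y))"
    by (rule continuous_on_compose2[OF lipschitz_on_continuous_on[OF g] cont_p]) (use pe in auto)
  have "open (U \<inter> Om D \<inter> ball x r)" using U(1) open_Om by (intro open_Int open_ball)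
  moreover have "x \<in> U \<inter> Om D \<inter> ball x r" using U(2) x(2) r by simp
  ultimately obtain \<rho> where \<rho>: "\<rho> > 0" "ball x \<rho> \<subseteq> U \<inter> Om D \<inter> ball x r" by (rule openE)
  \<comment> \<open>A point within \<open>\<eta>\<close> of \<open>p x\<close> in the hyperplane
    lifts to a graph point within \<open>(1 + C) * \<eta> = \<rho>\<close> of
    \<open>x\<close>.\<close>
  define \<eta> where "\<eta> = \<rho> / (1 + C)"
  have \<eta>: "\<eta> > 0" using \<rho>(1) C by (simp add: \<eta>_def)
  \<comment> \<open>The hypothesis only places the interface inside the graph. Conversely, points
    just below and just above a graph point lie in the two subdomains, so it belongs to both
    closures.\<close>
  have on_graph: "y \<in> Gam D" if y: "y \<in> ball x \<rho>" "y \<bullet> e = g (p y)" for y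
  proof -
    have near: "\<exists>t>0. t < \<epsilon> \<and> y + t *\<^sub>R e \<in> ball x \<rho> \<and> y - t *\<^sub>R e \<in> ball x \<rho>" if \<epsilon>: "\<epsilon> > 0" for \<epsilon>
    proof -
      obtain d where d: "d > 0" "ball y d \<subseteq> ball x \<rho>" by (rule openE[OF open_ball y(1)])
      define t where "t = min \<epsilon> d / 2"
      have t: "t > 0" "t < \<epsilon>" "t < d" using d(1) \<epsilon> by (auto simp: t_def)
      then have "y + t *\<^sub>R e \<in> ball y d" "y - t *\<^sub>R e \<in> ball y d" using e by (auto simp: dist_norm)
      then have "y + t *\<^sub>R e \<in> ball x \<rho>" "y - t *\<^sub>R e \<in> ball x \<rho>" using d(2) by blast+
      then show ?thesis using t by blast
    qed
    have "y \<in> closure (Om1 D)" unfolding closure_approachable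
    proof (intro allI impI)
      fix \<epsilon> :: real assume "\<epsilon> > 0"
      then obtain t where t: "t > 0" "t < \<epsilon>" "y - t *\<^sub>R e \<in> ball x \<rho>" using near by blast
      have "p (y - t *\<^sub>R e) = p y" using p_shift[of y "- t"] by simp
      moreover have "(y - t *\<^sub>R e) \<bullet> e < g (p y)" using y(2) t(1) by (simp add: inner_diff_left ee)
      moreover have "y - t *\<^sub>R e \<in> Om D" "y - t *\<^sub>R e \<in> U" using t(3) \<rho>(2) by blast+
      ultimately have "y - t *\<^sub>R e \<in> Om1 D" by (intro below') simp_all
      moreover have "dist (y - t *\<^sub>R e) y < \<epsilon>" using t e by (simp add: dist_norm)
      ultimately show "\<exists>z\<in>Om1 D. dist z y < \<epsilon>" by blast
    qed
    moreover have "y \<in> closure (Om2 D)" unfolding closure_approachable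
    proof (intro allI impI)
      fix \<epsilon> :: real assume "\<epsilon> > 0"
      then obtain t where t: "t > 0" "t < \<epsilon>" "y + t *\<^sub>R e \<in> ball x \<rho>" using near by blast
      have "(y + t *\<^sub>R e) \<bullet> e > g (p y)" using y(2) t(1) by (simp add: inner_add_left ee)
      moreover have "y + t *\<^sub>R e \<in> Om D" "y + t *\<^sub>R e \<in> U" using t(3) \<rho>(2) by blast+
      ultimately have "y + t *\<^sub>R e \<in> Om2 D" by (intro above') (simp_all add: p_shift)
      moreover have "dist (y + t *\<^sub>R e) y < \<epsilon>" using t e by (simp add: dist_norm)
      ultimately show "\<exists>z\<in>Om2 D. dist z y < \<epsilon>" by blast
    qed
    ultimately show ?thesis by (simp add: Gam_eq)
  qed
  have xg: "x \<bullet> e = g (p x)" using graph x(1) U(2) by (auto simp: p_def)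
  \<comment> \<open>An open slab above the graph, whose height 1 matches the unit segment of the
    thickening.\<close>
  define W where "W = {w. dist (p w) (p x) < \<eta>} \<inter> {w. g (p w) < w \<bullet> e} \<inter> {w. w \<bullet> e < g (p w) + 1}"
  have "open W" unfolding W_def
    by (intro open_Int open_Collect_less continuous_intros cont_p cont_gp)
  moreover have "x + (1/2) *\<^sub>R e \<in> W"
    unfolding W_def using \<eta> by (simp add: p_shift inner_add_left ee xg)
  then have "W \<noteq> {}" by blast
  moreover have "W \<subseteq> {y + s *\<^sub>R e |y s. y \<in> Gam D \<inter> ball x r \<and> s \<in> {0..1}}"
  proof
    fix w assume w: "w \<in> W"
    define y where "y = p w + g (p w) *\<^sub>R e"
    define s where "s = w \<bullet> e - g (p w)"
    have py: "p y = p w"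
    proof -
      have "p y = p (p w)" unfolding y_def by (rule p_shift)
      also have "\<dots> = p w - (p w \<bullet> e) *\<^sub>R e" unfolding p_def by (rule refl)
      finally show ?thesis by (simp add: pe)
    qed
    have ye: "y \<bullet> e = g (p y)" by (simp add: py) (simp add: y_def inner_add_left pe ee)
    have "x = p x + g (p x) *\<^sub>R e" using xg by (simp add: p_def)
    then have "dist y x = norm ((p w - p x) + (g (p w) - g (p x)) *\<^sub>R e)"
      unfolding dist_norm y_def by (metis add_diff_add scaleR_diff_left)
    also have "\<dots> \<le> dist (p w) (p x) + dist (g (p w)) (g (p x))"
      using norm_triangle_ineq[of "p w - p x" "(g (p w) - g (p x)) *\<^sub>R e"] e by (simp add: dist_norm)
    also have "dist (g (p w)) (g (p x)) \<le> C * dist (p w) (p x)"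
      using lipschitz_onD[OF g] pe by simp
    finally have "dist y x \<le> (1 + C) * dist (p w) (p x)" by (simp add: distrib_right)
    also have "\<dots> < (1 + C) * \<eta>" using w C by (intro mult_strict_left_mono) (auto simp: W_def)
    also have "\<dots> = \<rho>" using C by (simp add: \<eta>_def)
    finally have y: "y \<in> ball x \<rho>" by (simp add: dist_commute)
    then have "y \<in> Gam D \<inter> ball x r" using on_graph[OF y ye] \<rho>(2) by blast
    moreover have "w = y + s *\<^sub>R e" by (simp add: y_def s_def p_def algebra_simps)
    moreover have "s \<in> {0..1}" using w by (auto simp: W_def s_def)
    ultimately show "w \<in> {y + s *\<^sub>R e |y s. y \<in> Gam D \<inter> ball x r \<and> s \<in> {0..1}}" by blast
  qed
  ultimately show ?thesis
    using hausdorff_outer_pos_of_thickening[where W = W and G = "Gam D \<inter> ball x r", OF e] dim_ge_2 by simp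
qed

lemma AE_zero_on_Gam_imp_zero:
  assumes cont: "continuous_on (Gam D) h" and zero: "AE x in surface_measure. x \<in> Gam D \<longrightarrow> h x = 0"
    and x: "x \<in> Gam D" "x \<in> Om D"
  shows "h x = (0 :: real)"
proof (rule ccontr)
  assume "h x \<noteq> 0"
  then obtain r where r: "r > 0" "\<And>y. y \<in> Gam D \<Longrightarrow> dist x y < r \<Longrightarrow> h y \<noteq> 0"
    using continuous_within_avoid[of x "Gam D" h 0] cont x(1) continuous_on_eq_continuous_within by blast
  have borel: "Gam D \<inter> ball x r \<in> sets borel"
    using surface.closed_surface by (intro sets.Int borel_closed borel_open) auto
  obtain N where N: "{x \<in> space surface_measure. \<not> (x \<in> Gam D \<longrightarrow> h x = 0)} \<subseteq> N"
      "emeasure surface_measure N = 0" "N \<in> sets surface_measure"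
    using AE_E[OF zero] by blast
  have "Gam D \<inter> ball x r \<subseteq> N" using N(1) r(2) by auto
  then have "emeasure surface_measure (Gam D \<inter> ball x r) \<le> emeasure surface_measure N"
    using N(3) by (rule emeasure_mono)
  then have "hausdorff_outer (CARD('n) - 1) (Gam D \<inter> ball x r) = 0"
    using N(2) emeasure_surface_measure[OF dim_ge_2 borel] by simp
  then show False using hausdorff_outer_Gam_ball_pos[OF x r(1)] by simp
qed

lemma zero_gradient_and_jump_imp_zero:
  assumes v: "v \<in> Vhh D"
    and grad1: "\<And>T. T \<in> Mh1 D \<Longrightarrow> elem_grad (fst v) T = 0"
    and grad2: "\<And>T. T \<in> Mh2 D \<Longrightarrow> elem_grad (snd v) T = 0"
    and jump: "AE x in surface_measure. x \<in> Gam D \<longrightarrow> jump v x = 0"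
  shows "v = 0"
proof -
  note c1 = m1.continuous_on_pw_affine[OF Vhh_pw_affine(1)[OF v]]
    and c2 = m2.continuous_on_pw_affine[OF Vhh_pw_affine(2)[OF v]]
  define w where "w = (\<lambda>x. if x \<in> closure (Om1 D) then fst v x else snd v x)"
  let ?A = "Om D \<inter> closure (Om1 D)" and ?B = "Om D \<inter> closure (Om2 D)"
  have Om_eq: "?A \<union> ?B = Om D" using Om_parts(3) closure_subset[of "Om2 D"] by blast
  \<comment> \<open>Agreement is claimed inside the domain only, where pieces of the interface have
    positive area; this suffices since the domain itself is connected.\<close>
  have agree: "fst v x = snd v x" if "x \<in> Om D" "x \<in> closure (Om1 D)" "x \<in> closure (Om2 D)" for x
    using AE_zero_on_Gam_imp_zero[OF jump_continuous[OF v] jump, of x] that by (simp add: Gam_eq jump_def)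
  have "continuous_on (?A \<union> ?B) w" unfolding w_def
  proof (rule continuous_on_cases_local)
    show "closedin (top_of_set (?A \<union> ?B)) ?A" "closedin (top_of_set (?A \<union> ?B)) ?B"
      unfolding Om_eq by (auto intro!: closedin_closed_Int)
    show "continuous_on ?A (fst v)" "continuous_on ?B (snd v)"
      using c1 c2 by (auto intro: continuous_on_subset)
  qed (use agree Om_parts(3) in auto)
  then have "continuous_on (Om D) w" by (simp only: Om_eq)
  moreover have "finite (w ` Om D)"
  proof (rule finite_subset)
    show "w ` Om D \<subseteq> fst v ` closure (Om1 D) \<union> snd v ` closure (Om2 D)"
      using Om_parts(3) closure_subset[of "Om2 D"] by (auto simp: w_def)
    show "finite (fst v ` closure (Om1 D) \<union> snd v ` closure (Om2 D))"
      using m1.finite_range_of_zero_gradient[OF Vhh_pw_affine(1)[OF v] grad1]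
        m2.finite_range_of_zero_gradient[OF Vhh_pw_affine(2)[OF v] grad2] by simp
  qed
  ultimately have "w constant_on Om D" by (rule continuous_finite_range_constant[OF connected_Om])
  then obtain c where c: "\<And>x. x \<in> Om D \<Longrightarrow> w x = c" unfolding constant_on_def by blast
  have w1: "fst v x = c" if x: "x \<in> closure (Om1 D)" for x
  proof (rule continuous_constant_on_closure[OF c1 _ x])
    fix y assume "y \<in> Om1 D"
    then have "y \<in> Om D" "y \<in> closure (Om1 D)" using Om_parts(1) closure_subset[of "Om1 D"] by blast+
    then show "fst v y = c" using c[of y] by (simp add: w_def)
  qed
  have w2: "snd v x = c" if x: "x \<in> closure (Om2 D)" for x
  proof (rule continuous_constant_on_closure[OF c2 _ x])
    fix y assume "y \<in> Om2 D"
    then have "y \<in> Om D" "y \<notin> closure (Om1 D)" using Om_parts(2) disjoint_closure by blast+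
    then show "snd v y = c" using c[of y] by (simp add: w_def)
  qed
  \<comment> \<open>A bounded nonempty set has a boundary point. Whichever closure contains it, it
    lies on the Dirichlet part of that subdomain, which forces the constant to be 0.\<close>
  have "frontier (Om D) \<noteq> {}"
    using frontier_eq_empty[of "Om D"] Om_nonempty bounded_Om not_bounded_UNIV by metis
  then obtain y where y: "y \<in> frontier (Om D)" by blast
  then have y': "y \<in> closure (Om D)" "y \<notin> Om D"
    using open_Om by (auto simp: frontier_def interior_open)
  have "closure (Om D) \<subseteq> closure (Om1 D) \<union> closure (Om2 D)"
    using Om_parts(3) closure_subset[of "Om2 D"] by (intro closure_minimal) auto
  then have "y \<in> closure (Om1 D) \<or> y \<in> closure (Om2 D)" using y'(1) by blast
  then have "c = 0"
  proof
    assume cl: "y \<in> closure (Om1 D)"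
    have "y \<in> Gam1 D"
      using y y'(2) cl Om_parts(1) subdomain(1) by (auto simp: Gam1_def frontier_def interior_open)
    then show "c = 0" using w1[OF cl] v by (simp add: in_Vhh_iff Vh1_def m1.in_fe_space_iff)
  next
    assume cl: "y \<in> closure (Om2 D)"
    have "y \<in> Gam2 D"
      using y y'(2) cl Om_parts(2) open_Om2 by (auto simp: Gam2_def frontier_def interior_open)
    then show "c = 0" using w2[OF cl] v by (simp add: in_Vhh_iff Vh2_def m2.in_fe_space_iff)
  qed
  have "fst v x = 0" for x
    using w1[of x] \<open>c = 0\<close> v by (cases "x \<in> closure (Om1 D)") (auto simp: in_Vhh_iff Vh1_def m1.in_fe_space_iff)
  moreover have "snd v x = 0" for x
    using w2[of x] \<open>c = 0\<close> v by (cases "x \<in> closure (Om2 D)") (auto simp: in_Vhh_iff Vh2_def m2.in_fe_space_iff)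
  ultimately show ?thesis by (simp add: prod_eq_iff fun_eq_iff)
qed

text \<open>The square root turns a vanishing quadratic form into \<open>Co D x *v w = 0\<close>. A
  nonzero \<open>w\<close> would then be an eigenvector for the eigenvalue 0, which the spectral
  bound excludes.\<close>

lemma coefficient_definite:
  assumes x: "x \<in> Om D" and R: "is_psd_sqrt R (Co D x)" and zero: "(Co D x *v w) \<bullet> w = 0"
  shows "w = 0"
proof (rule ccontr)
  assume "w \<noteq> 0"
  have "R *v w = 0" using psd_sqrt_energy[OF R, of w] zero by simp
  moreover have "Co D x = R ** R" using R by (simp add: is_psd_sqrt_def)
  ultimately have "Co D x *v w = 0 *\<^sub>R w" by (simp add: matrix_vector_mul_assoc[symmetric])
  then have "\<alpha> \<le> 0"
    using coefficient(4)[OF x, unfolded spectrum_within_def, rule_format, of w 0] \<open>w \<noteq> 0\<close> by simp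
  then show False using ellipticity(1) by simp
qed

text \<open>Every summand of \<open>dg_norm_sq\<close> is nonnegative, so a vanishing form makes
  each of them vanish, in particular both energies and the jump term.\<close>

lemma dg_form_definite:
  assumes R: "\<And>x. x \<in> Om D \<Longrightarrow> is_psd_sqrt (R x) (Co D x)" and \<gamma>: "\<gamma> > 0"
    and coercive: "c > 0" "dg_form D \<gamma> v v \<ge> c * dg_norm_sq D R \<gamma> v"
    and v: "v \<in> Vhh D" and zero: "dg_form D \<gamma> v v = 0"
  shows "v = 0"
proof -
  have nonneg: "0 \<le> (Co D x *v w) \<bullet> w" if "x \<in> Om D" for x w
    using psd_sqrt_energy[OF R[OF that], of w] zero_le_power2[of "norm (R x *v w)"] by simp
  have e1: "(LINT x:Om1 D|lebesgue. (norm (R x *v grad (fst v) x))\<^sup>2) = m1.energy (fst v) (fst v)"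
    unfolding m1.energy_def using Om_parts(1) psd_sqrt_energy[OF R]
    by (intro set_lebesgue_integral_cong m1.sets_domain) auto
  have e2: "(LINT x:Om2 D|lebesgue. (norm (R x *v grad (snd v) x))\<^sup>2) = m2.energy (snd v) (snd v)"
    unfolding m2.energy_def using Om_parts(2) psd_sqrt_energy[OF R]
    by (intro set_lebesgue_integral_cong m2.sets_domain) auto
  have pos: "0 \<le> m1.energy (fst v) (fst v)" "0 \<le> m2.energy (snd v) (snd v)"
    unfolding e1[symmetric] e2[symmetric] set_lebesgue_integral_def
    by (auto intro!: Bochner_Integration.integral_nonneg)
  have "0 \<le> \<gamma> / fine_size D * surface_inner (Gam D) (jump v) (jump v)"
    "0 \<le> fine_size D / \<gamma> * surface_inner (Gam D) (mean_flux D v) (mean_flux D v)"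
    using \<gamma> fine_size_pos by (simp_all add: surface_inner_self_nonneg)
  moreover have "dg_norm_sq D R \<gamma> v \<le> 0"
    using coercive zero by (simp add: mult_le_0_iff)
  ultimately have z: "m1.energy (fst v) (fst v) = 0" "m2.energy (snd v) (snd v) = 0"
    "\<gamma> / fine_size D * surface_inner (Gam D) (jump v) (jump v) = 0"
    using pos unfolding dg_norm_sq_def e1 e2 by linarith+
  then have "surface_inner (Gam D) (jump v) (jump v) = 0" using \<gamma> fine_size_pos by simp
  then have "AE x in surface_measure. x \<in> Gam D \<longrightarrow> jump v x = 0"
    by (rule surface.surface_inner_self_eq_0D[OF jump_bounded[OF v]])
  moreover have "elem_grad (fst v) T = 0" if "T \<in> Mh1 D" for T
    by (rule m1.energy_zero_imp_pw_grad_zero[OF Vhh_pw_affine(1)[OF v] z(1) _ _ that])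
      (use nonneg coefficient_definite R Om_parts(1) in blast)+
  moreover have "elem_grad (snd v) T = 0" if "T \<in> Mh2 D" for T
    by (rule m2.energy_zero_imp_pw_grad_zero[OF Vhh_pw_affine(2)[OF v] z(2) _ _ that])
      (use nonneg coefficient_definite R Om_parts(2) in blast)+
  ultimately show ?thesis using zero_gradient_and_jump_imp_zero[OF v] by blast
qed

section \<open>The interpolation operator, its kernel and the corrector\<close>

lemma VhH_subset_Vhh: "VhH D \<subseteq> Vhh D"
proof -
  have "v \<in> Vh2 D" if v: "v \<in> VH2 D" for v
  proof -
    have "pw_affine (Mh2 D) v"
      unfolding pw_affine_def
    proof
      fix T assume "T \<in> Mh2 D"
      then obtain T' where T': "T' \<in> MH2 D" "T \<subseteq> T'" using coarse_mesh(5) unfolding refines_def by blast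
      have "pw_affine (MH2 D) v" using v by (simp add: VH2_def mH.in_fe_space_iff)
      then obtain p where "p \<in> P1" "\<forall>x\<in>T'. v x = p x" using T'(1) unfolding pw_affine_def by blast
      then show "\<exists>p\<in>P1. \<forall>x\<in>T. v x = p x" using T'(2) by blast
    qed
    then show ?thesis using v by (simp add: VH2_def Vh2_def mH.in_fe_space_iff m2.in_fe_space_iff)
  qed
  then show ?thesis by (auto simp: VhH_def Vhh_def)
qed

lemma ChH_eq: "v \<in> Vhh D \<Longrightarrow> ChH D v = (fst v, mH.CH (snd v))"
  using m1.L2_projection_fe_space[of "fst v" "Gam1 D"] by (simp add: ChH_def in_Vhh_iff Vh1_def)

lemma Vhh_continuous: "v \<in> Vhh D \<Longrightarrow> continuous_on (closure (Om2 D)) (snd v)"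
  by (rule m2.continuous_on_pw_affine[OF Vhh_pw_affine(2)])

lemma ChH_add:
  assumes "u \<in> Vhh D" "v \<in> Vhh D" shows "ChH D (u + v) = ChH D u + ChH D v"
  using assms broken_space.subspace_add[OF subspace_Vhh assms]
  by (simp add: ChH_eq mH.CH_add Vhh_continuous plus_prod_def)

lemma ChH_scale:
  assumes "v \<in> Vhh D" shows "ChH D (broken_scale c v) = broken_scale c (ChH D v)"
  using assms broken_space.subspace_scale[OF subspace_Vhh assms, of c]
  by (simp add: ChH_eq mH.CH_scale)

lemma ChH_diff:
  assumes "u \<in> Vhh D" "v \<in> Vhh D" shows "ChH D (u - v) = ChH D u - ChH D v"
proof -
  have "u - v \<in> Vhh D" using broken_space.subspace_diff[OF subspace_Vhh assms] .
  from ChH_add[OF this assms(2)] show ?thesis by simp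
qed

lemma ChH_inj_on: "inj_on (ChH D) (VhH D)"
proof (rule inj_onI)
  fix u v assume u: "u \<in> VhH D" and v: "v \<in> VhH D" and eq: "ChH D u = ChH D v"
  have "u \<in> Vhh D" "v \<in> Vhh D" using u v VhH_subset_Vhh by blast+
  then have "fst u = fst v" "mH.CH (snd u) = mH.CH (snd v)" using eq by (simp_all add: ChH_eq)
  moreover have "snd u \<in> mH.V" "snd v \<in> mH.V" using u v by (auto simp: VhH_def VH2_def)
  ultimately show "u = v" using mH.CH_inj_on by (simp add: prod_eq_iff inj_on_def)
qed

text \<open>The component on the first subdomain is kept; the other is replaced by a coarse function
  with the same moments.\<close>

lemma ChH_coarse_representative:
  assumes v: "v \<in> Vhh D" obtains w where "w \<in> VhH D" "ChH D w = ChH D v"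
proof -
  obtain w where w: "w \<in> mH.V" "mH.CH w = mH.CH (snd v)"
    using mH.CH_surj[OF Vhh_continuous[OF v]] by blast
  have in_VhH: "(fst v, w) \<in> VhH D" using v w(1) by (simp add: VhH_def VH2_def in_Vhh_iff)
  moreover from this have "(fst v, w) \<in> Vhh D" using VhH_subset_Vhh by blast
  then have "ChH D (fst v, w) = ChH D v" using v w(2) by (simp add: ChH_eq)
  ultimately show ?thesis using that by blast
qed

lemma subspace_W0h: "broken_space.subspace (W0h D)"
proof (rule broken_space.subspaceI)
  have "0 \<in> Vhh D" using broken_space.subspace_0[OF subspace_Vhh] by simp
  then have "0 \<in> Vhh D" "ChH D (0 - 0) = 0" using ChH_diff[of 0 0] by simp_all
  then show "0 \<in> W0h D" by (simp add: W0h_def)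
  show "u + v \<in> W0h D" if "u \<in> W0h D" "v \<in> W0h D" for u v
    using that broken_space.subspace_add[OF subspace_Vhh] by (simp add: W0h_def ChH_add)
  show "broken_scale c u \<in> W0h D" if "u \<in> W0h D" for c u
    using that broken_space.subspace_scale[OF subspace_Vhh, of u c]
    by (simp add: W0h_def ChH_scale zero_prod_def zero_fun_def)
qed

text \<open>All nodal functions are taken, also those at boundary vertices, so a generator may lie
  outside \<open>Vhh D\<close>. The set serves as a finite bound on the dimension.\<close>

definition broken_generators :: "'n broken set" where
  "broken_generators = (\<lambda>\<phi>. (\<phi>, 0)) ` m1.\<Phi> ` vertices (Mh1 D) \<union> (\<lambda>\<phi>. (0, \<phi>)) ` m2.\<Phi> ` vertices (Mh2 D)"

lemma finite_broken_generators: "finite broken_generators"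
  unfolding broken_generators_def using m1.finite_vertices m2.finite_vertices by simp

text \<open>On either side, the functions whose embedding as a pair lies in the span form a subspace
  that contains the nodal functions.\<close>

lemma Vhh_subset_span: "Vhh D \<subseteq> broken_space.span broken_generators"
proof
  fix v assume v: "v \<in> Vhh D"
  let ?V1 = "{\<phi>. (\<phi>, 0) \<in> broken_space.span broken_generators}"
  let ?V2 = "{\<phi>. (0, \<phi>) \<in> broken_space.span broken_generators}"
  have "fun_space.subspace ?V1"
  proof (rule fun_space.subspaceI)
    show "0 \<in> ?V1" using broken_space.span_zero by (simp add: zero_prod_def)
    show "\<phi> + \<psi> \<in> ?V1" if "\<phi> \<in> ?V1" "\<psi> \<in> ?V1" for \<phi> \<psi>
      using that broken_space.span_add[of "(\<phi>, 0)" broken_generators "(\<psi>, 0)"] by simp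
    show "(\<lambda>x. c * \<phi> x) \<in> ?V1" if "\<phi> \<in> ?V1" for c \<phi>
      using that broken_space.span_scale[of "(\<phi>, 0)" broken_generators c] by (simp add: zero_fun_def)
  qed
  moreover have "m1.\<Phi> ` vertices (Mh1 D) \<subseteq> ?V1"
    by (auto intro!: broken_space.span_base simp: broken_generators_def)
  ultimately have "fun_space.span (m1.\<Phi> ` vertices (Mh1 D)) \<subseteq> ?V1"
    by (intro fun_space.span_minimal)
  then have f: "(fst v, 0) \<in> broken_space.span broken_generators"
    using m1.fe_space_subset_span[of "Gam1 D"] v unfolding in_Vhh_iff Vh1_def by blast
  have "fun_space.subspace ?V2"
  proof (rule fun_space.subspaceI)
    show "0 \<in> ?V2" using broken_space.span_zero by (simp add: zero_prod_def)
    show "\<phi> + \<psi> \<in> ?V2" if "\<phi> \<in> ?V2" "\<psi> \<in> ?V2" for \<phi> \<psi>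
      using that broken_space.span_add[of "(0, \<phi>)" broken_generators "(0, \<psi>)"] by simp
    show "(\<lambda>x. c * \<phi> x) \<in> ?V2" if "\<phi> \<in> ?V2" for c \<phi>
      using that broken_space.span_scale[of "(0, \<phi>)" broken_generators c] by (simp add: zero_fun_def)
  qed
  moreover have "m2.\<Phi> ` vertices (Mh2 D) \<subseteq> ?V2"
    by (auto intro!: broken_space.span_base simp: broken_generators_def)
  ultimately have "fun_space.span (m2.\<Phi> ` vertices (Mh2 D)) \<subseteq> ?V2"
    by (intro fun_space.span_minimal)
  then have s: "(0, snd v) \<in> broken_space.span broken_generators"
    using m2.fe_space_subset_span[of "Gam2 D"] v unfolding in_Vhh_iff Vh2_def by blast
  have "(fst v, 0) + (0, snd v) = v" by (simp add: prod_eq_iff)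
  then show "v \<in> broken_space.span broken_generators" using broken_space.span_add[OF f s] by simp
qed

text \<open>Turns the description in \<open>Qh\<close> into facts: on the finite-dimensional
  \<open>W0h D\<close> a definite form represents the functional \<open>dg_form D \<gamma> v\<close>
  by exactly one element.\<close>

lemma Qh_characterization:
  assumes definite: "\<And>v. v \<in> Vhh D \<Longrightarrow> dg_form D \<gamma> v v = 0 \<Longrightarrow> v = 0" and v: "v \<in> Vhh D"
  shows "Qh D \<gamma> v \<in> W0h D" and "w \<in> W0h D \<Longrightarrow> dg_form D \<gamma> (Qh D \<gamma> v) w = dg_form D \<gamma> v w"
proof -
  have sub: "\<And>w. w \<in> W0h D \<Longrightarrow> w \<in> Vhh D" by (simp add: W0h_def)
  have add2: "dg_form D \<gamma> z (x + y) = dg_form D \<gamma> z x + dg_form D \<gamma> z y"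
    if "x \<in> Vhh D" "y \<in> Vhh D" "z \<in> Vhh D" for x y z
    using dg_form_add[OF that] by (simp add: dg_form_commute[of _ z])
  have scale2: "dg_form D \<gamma> z (broken_scale c x) = c * dg_form D \<gamma> z x"
    if "x \<in> Vhh D" "z \<in> Vhh D" for c x z
    using dg_form_scale[OF that] by (simp add: dg_form_commute[of _ z])
  have "\<exists>!q. q \<in> W0h D \<and> (\<forall>w\<in>W0h D. dg_form D \<gamma> q w = dg_form D \<gamma> v w)"
  proof (rule broken_space.form_represents_functional[OF subspace_W0h finite_broken_generators])
    show "W0h D \<subseteq> broken_space.span broken_generators" using sub Vhh_subset_span by blast
  qed (use sub v in \<open>simp_all add: dg_form_add dg_form_scale add2 scale2 definite\<close>)
  then have "(THE q. q \<in> W0h D \<and> (\<forall>w\<in>W0h D. dg_form D \<gamma> q w = dg_form D \<gamma> v w)) \<in> W0h D \<and>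
    (\<forall>w\<in>W0h D. dg_form D \<gamma> (THE q. q \<in> W0h D \<and> (\<forall>w\<in>W0h D. dg_form D \<gamma> q w = dg_form D \<gamma> v w)) w
      = dg_form D \<gamma> v w)"
    by (rule theI')
  then show "Qh D \<gamma> v \<in> W0h D" "w \<in> W0h D \<Longrightarrow> dg_form D \<gamma> (Qh D \<gamma> v) w = dg_form D \<gamma> v w"
    unfolding Qh_def by blast+
qed

lemma Galerkin_error_in_W0h:
  assumes definite: "\<And>v. v \<in> Vhh D \<Longrightarrow> dg_form D \<gamma> v v = 0 \<Longrightarrow> v = 0"
    and e: "e \<in> Vhh D" and orth: "\<And>z. z \<in> Vms D \<gamma> \<Longrightarrow> dg_form D \<gamma> e z = 0"
  shows "e \<in> W0h D"
proof -
  obtain y where y: "y \<in> VhH D" "ChH D y = ChH D e" using ChH_coarse_representative[OF e] by blast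
  have yV: "y \<in> Vhh D" using y(1) VhH_subset_Vhh by blast
  define q where "q = Qh D \<gamma> y"
  have q: "q \<in> W0h D" "\<And>w. w \<in> W0h D \<Longrightarrow> dg_form D \<gamma> q w = dg_form D \<gamma> y w"
    unfolding q_def by (rule Qh_characterization[OF definite yV]; assumption)+
  have qV: "q \<in> Vhh D" "ChH D q = 0" using q(1) by (auto simp: W0h_def)
  define z where "z = y - q"
  have zV: "z \<in> Vhh D" unfolding z_def using subspace_Vhh yV qV(1) by (rule broken_space.subspace_diff)
  have "z \<in> Vms D \<gamma>" using y(1) by (auto simp: Vms_def z_def q_def)
  have ewV: "e - z \<in> Vhh D" using subspace_Vhh e zV by (rule broken_space.subspace_diff)
  have "ChH D (e - z) = 0"
    using ChH_diff[OF e zV] ChH_diff[OF yV qV(1)] y(2) qV(2) by (simp add: z_def)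
  then have w: "e - z \<in> W0h D" using ewV by (simp add: W0h_def)
  \<comment> \<open>Here \<open>z + q = y\<close>, and \<open>q\<close> has the same products with
    \<open>W0h D\<close> as \<open>y\<close>; so the product of \<open>z\<close> with
    \<open>e - z\<close> vanishes, and symmetry exchanges the arguments.\<close>
  have "dg_form D \<gamma> (z + q) (e - z) = dg_form D \<gamma> z (e - z) + dg_form D \<gamma> q (e - z)"
    using zV qV(1) ewV by (rule dg_form_add)
  then have "dg_form D \<gamma> (e - z) z = 0" using q(2)[OF w] by (simp add: z_def dg_form_commute[of \<gamma> "e - _"])
  moreover have "dg_form D \<gamma> ((e - z) + z) z = dg_form D \<gamma> (e - z) z + dg_form D \<gamma> z z"
    using ewV zV zV by (rule dg_form_add)
  ultimately have "dg_form D \<gamma> z z = 0" using orth[OF \<open>z \<in> Vms D \<gamma>\<close>] by simp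
  then have "z = 0" using definite zV by blast
  then show ?thesis using w by simp
qed

end

theorem proposition1:
  fixes D :: "('n::finite) setting"
    and f :: "real ^ 'n \<Rightarrow> real"
    and R :: "real ^ 'n \<Rightarrow> real ^ 'n ^ 'n"
    and \<alpha> \<beta> \<kappa> \<alpha>\<^sub>0 \<gamma>\<^sub>0 :: real
    and u ums uhH :: "'n broken"
  assumes setting: "multiscale_setting D f \<alpha> \<beta> \<kappa>"
    and sqrt_coefficient: "\<And>x. x \<in> Om D \<Longrightarrow> is_psd_sqrt (R x) (Co D x)"
    and threshold_pos: "\<alpha>\<^sub>0 > 0"
    and threshold: "\<And>\<gamma>. \<gamma> \<ge> \<alpha>\<^sub>0 \<Longrightarrow>
          \<exists>c>0. \<forall>v\<in>Vhh D. dg_form D \<gamma> v v \<ge> c * dg_norm_sq D R \<gamma> v"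
    and penalty: "\<gamma>\<^sub>0 \<ge> \<alpha>\<^sub>0"
    and u: "u \<in> Vhh D" "\<And>v. v \<in> Vhh D \<Longrightarrow> dg_form D \<gamma>\<^sub>0 u v = load_form D f v"
    and ums: "ums \<in> Vms D \<gamma>\<^sub>0"
      "\<And>v. v \<in> Vms D \<gamma>\<^sub>0 \<Longrightarrow> dg_form D \<gamma>\<^sub>0 ums v = load_form D f v"
    and uhH: "uhH = the_inv_into (VhH D) (ChH D) (ChH D ums)"
  shows "u - ums \<in> W0h D \<and> ChH D u = ChH D uhH \<and> (\<forall>x\<in>Om1 D. fst u x = fst ums x)"
proof -
  interpret multiscale_setting D f \<alpha> \<beta> \<kappa> by (rule setting)
  obtain c where c: "c > 0" "\<And>v. v \<in> Vhh D \<Longrightarrow> dg_form D \<gamma>\<^sub>0 v v \<ge> c * dg_norm_sq D R \<gamma>\<^sub>0 v"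
    using threshold[OF penalty] by blast
  have "\<gamma>\<^sub>0 > 0" using threshold_pos penalty by simp
  then have definite: "v = 0" if "v \<in> Vhh D" "dg_form D \<gamma>\<^sub>0 v v = 0" for v
    using dg_form_definite[OF sqrt_coefficient _ c(1) c(2)] that by blast
  have Vms_Vhh: "z \<in> Vhh D" if "z \<in> Vms D \<gamma>\<^sub>0" for z
  proof -
    obtain y where y: "y \<in> VhH D" "z = y - Qh D \<gamma>\<^sub>0 y" using \<open>z \<in> Vms D \<gamma>\<^sub>0\<close> by (auto simp: Vms_def)
    have yV: "y \<in> Vhh D" using y(1) VhH_subset_Vhh by blast
    have "Qh D \<gamma>\<^sub>0 y \<in> W0h D" by (rule Qh_characterization[OF definite yV])
    then have "Qh D \<gamma>\<^sub>0 y \<in> Vhh D" by (simp add: W0h_def)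
    then show ?thesis unfolding y(2) using broken_space.subspace_diff[OF subspace_Vhh yV] by blast
  qed
  have umsV: "ums \<in> Vhh D" using ums(1) by (rule Vms_Vhh)
  have e: "u - ums \<in> Vhh D" using subspace_Vhh u(1) umsV by (rule broken_space.subspace_diff)
  \<comment> \<open>Multiscale functions are also fine functions, so both equations may be tested
    with \<open>z\<close> and the load cancels.\<close>
  have orth: "dg_form D \<gamma>\<^sub>0 (u - ums) z = 0" if z: "z \<in> Vms D \<gamma>\<^sub>0" for z
    using dg_form_add[OF e umsV Vms_Vhh[OF z], of \<gamma>\<^sub>0] u(2)[OF Vms_Vhh[OF z]] ums(2)[OF z] by simp
  have W: "u - ums \<in> W0h D" by (rule Galerkin_error_in_W0h[OF definite e orth])
  then have "ChH D (u - ums) = 0" by (simp add: W0h_def)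
  then have eq: "ChH D u = ChH D ums" using ChH_diff[OF u(1) umsV] by simp
  then have "fst u = fst ums" using u(1) umsV by (simp add: ChH_eq)
  moreover have "ChH D uhH = ChH D ums"
  proof -
    \<comment> \<open>The inverse \<open>the_inv_into\<close> is meaningful only on the image of
      \<open>VhH D\<close>; a coarse representative shows that \<open>ChH D ums\<close> belongs to
      it.\<close>
    obtain y where "y \<in> VhH D" "ChH D y = ChH D ums" using ChH_coarse_representative[OF umsV] by blast
    then have "ChH D ums \<in> ChH D ` VhH D" by (metis imageI)
    then show ?thesis unfolding uhH by (rule f_the_inv_into_f[OF ChH_inj_on])
  qed
  ultimately show ?thesis using W eq by simp
qed

end
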